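(* For every semitopological semigroup $S$, the following three fixed point properties are equivalent. $(D)$: For every locally convex space $(X,\tau)$ whose topology is determined by a family $Q$ of continuous seminorms and every nonempty $\tau$-compact convex subset $K$ of $X$, every $Q$-nonexpansive dynamical system $(S,(K,\tau))$ has a fixed point. $(E)$: For every locally convex space $(X,\tau)$ whose topology is determined by a family $Q$ of continuous seminorms and every nonempty weakly compact convex subset $K$ of $X$, every $Q$-nonexpansive dynamical system $(S,(K,\mathrm{weak}))$ such that the family of translations $\lambda_s:K\to K$, $s\in S$, is equicontinuous in the weak topology has a fixed point. $(E')$: For every locally convex space $(X,\tau)$ whose topology is determined by a family $Q$ of continuous seminorms and every nonempty weakly compact convex subset $K$ of $X$ that has $Q$-normal structure, every $Q$-nonexpansive dynamical system $(S,(K,\mathrm{weak}))$ such that the family of translations $\lambda_s:K\to K$, $s\in S$, is equicontinuous in the weak topology has a fixed point.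
   Context: A semitopological semigroup is a (nonempty) semigroup $S$ with a Hausdorff topology such that for each $t\in S$ the maps $s\mapsto ts$ and $s\mapsto st$ are continuous. Locally convex spaces are Hausdorff. A dynamical system $(S,K)$ consists of a semitopological semigroup $S$, a topological space $K$ and an action $S\times K\to K$, $(s,x)\mapsto sx$, with $s_1(s_2x)=(s_1s_2)x$, which is separately continuous (all maps $s\mapsto sx$ and all translations $\lambda_s:x\mapsto sx$ are continuous). $(S,(K,\tau))$, respectively $(S,(K,\mathrm{weak}))$, means that $K$ carries the topology $\tau$, respectively the weak topology. For $K$ in a locally convex space with topology determined by the family $Q$ of seminorms, the system is $Q$-nonexpansive if $p(sx-sy)\le p(x-y)$ for all $p\in Q$, $s\in S$, $x,y\in K$. A set $A\subset X$ is $Q$-bounded if for each $p\in Q$ there is $d>0$ with $p(x)\le d$ for all $x\in A$. A subset $K$ of $X$ has $Q$-normal structure if for each $Q$-bounded subset $A$ of $K$ containing more than one point there are $u\in\overline{\mathrm{co}}\,K$ (the closed convex hull) and $p\in Q$ such that $\sup\{p(x-u):x\in A\}<\sup\{p(x-y):x,y\in A\}$. A fixed point is $x\in K$ with $sx=x$ for all $s\in S$. *)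

theory Defs
  imports "HOL-Analysis.Analysis"
begin

class semitopological_semigroup = semigroup_mult + t2_space +
  assumes continuous_mult_left: "open U \<Longrightarrow> open {s. t * s \<in> U}"
    and continuous_mult_right: "open U \<Longrightarrow> open {s. s * t \<in> U}"

text \<open>
  HOL cannot quantify over types inside a formula. The vector spaces considered are therefore the
  linear subspaces \<open>X\<close> of an arbitrary real vector space \<open>'v\<close>, each with a topology of
  its own (\<^typ>\<open>'v topology\<close> with topspace \<open>X\<close>). Seminorms and functionals are total
  functions of which only the restriction to \<open>X\<close> matters.
\<close>

definition locally_convex_space :: "'v::real_vector set \<Rightarrow> 'v topology \<Rightarrow> bool" where
  "locally_convex_space X \<tau> \<longleftrightarrow>
     subspace X \<and> topspace \<tau> = X \<and> Hausdorff_space \<tau> \<and>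
     continuous_map (prod_topology \<tau> \<tau>) \<tau> (\<lambda>(x, y). x + y) \<and>
     continuous_map (prod_topology euclideanreal \<tau>) \<tau> (\<lambda>(c, x). c *\<^sub>R x) \<and>
     (\<forall>U. openin \<tau> U \<and> 0 \<in> U \<longrightarrow> (\<exists>V. openin \<tau> V \<and> convex V \<and> 0 \<in> V \<and> V \<subseteq> U))"

definition seminorm_on :: "'v::real_vector set \<Rightarrow> ('v \<Rightarrow> real) \<Rightarrow> bool" where
  "seminorm_on X p \<longleftrightarrow>
     (\<forall>x\<in>X. 0 \<le> p x) \<and>
     (\<forall>x\<in>X. \<forall>y\<in>X. p (x + y) \<le> p x + p y) \<and>
     (\<forall>c. \<forall>x\<in>X. p (c *\<^sub>R x) = \<bar>c\<bar> * p x)"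

text \<open>The set \<open>X\<close> is added to the subbase so that the topspace is \<open>X\<close> even if \<open>Q\<close> is empty.\<close>

definition seminorm_topology :: "'v::real_vector set \<Rightarrow> ('v \<Rightarrow> real) set \<Rightarrow> 'v topology" where
  "seminorm_topology X Q =
     topology_generated_by (insert X {{y \<in> X. p (y - x) < e} | p x e. p \<in> Q \<and> x \<in> X \<and> 0 < e})"

definition determined_by_seminorms ::
    "'v::real_vector set \<Rightarrow> 'v topology \<Rightarrow> ('v \<Rightarrow> real) set \<Rightarrow> bool" where
  "determined_by_seminorms X \<tau> Q \<longleftrightarrow>
     (\<forall>p\<in>Q. seminorm_on X p \<and> continuous_map \<tau> euclideanreal p) \<and> \<tau> = seminorm_topology X Q"

definition continuous_functionals ::
    "'v::real_vector set \<Rightarrow> 'v topology \<Rightarrow> ('v \<Rightarrow> real) set" where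
  "continuous_functionals X \<tau> =
     {f. (\<forall>x\<in>X. \<forall>y\<in>X. f (x + y) = f x + f y) \<and> (\<forall>c. \<forall>x\<in>X. f (c *\<^sub>R x) = c * f x) \<and>
         continuous_map \<tau> euclideanreal f}"

definition weak_topology :: "'v::real_vector set \<Rightarrow> 'v topology \<Rightarrow> 'v topology" where
  "weak_topology X \<tau> =
     topology_generated_by
       {{x \<in> X. f x \<in> U} | f U. f \<in> continuous_functionals X \<tau> \<and> open U}"

text \<open>
  \<open>dynamical_system T act\<close> is the system \<open>(S, K)\<close>, where \<open>K\<close> is the topspace of \<open>T\<close> and
  \<open>S\<close> is the whole type \<open>'s\<close>; the values of \<open>act s\<close> outside \<open>K\<close> are irrelevant.
\<close>

definition dynamical_system ::
    "'v topology \<Rightarrow> ('s::semitopological_semigroup \<Rightarrow> 'v \<Rightarrow> 'v) \<Rightarrow> bool" where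
  "dynamical_system T act \<longleftrightarrow>
     (\<forall>s. \<forall>x\<in>topspace T. act s x \<in> topspace T) \<and>
     (\<forall>s\<^sub>1 s\<^sub>2. \<forall>x\<in>topspace T. act s\<^sub>1 (act s\<^sub>2 x) = act (s\<^sub>1 * s\<^sub>2) x) \<and>
     (\<forall>x\<in>topspace T. continuous_map euclidean T (\<lambda>s. act s x)) \<and>
     (\<forall>s. continuous_map T T (act s))"

definition nonexpansive ::
    "('v::real_vector \<Rightarrow> real) set \<Rightarrow> 'v set \<Rightarrow> ('s \<Rightarrow> 'v \<Rightarrow> 'v) \<Rightarrow> bool" where
  "nonexpansive Q K act \<longleftrightarrow>
     (\<forall>p\<in>Q. \<forall>s. \<forall>x\<in>K. \<forall>y\<in>K. p (act s x - act s y) \<le> p (x - y))"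

text \<open>
  Equicontinuity at every point of \<open>K\<close>, with respect to the translation-invariant uniformity of
  the vector topology \<open>T\<close>. For compact \<open>K\<close> this is the same as uniform equicontinuity.
\<close>

definition equicontinuous_translations ::
    "'v::real_vector topology \<Rightarrow> 'v set \<Rightarrow> ('s \<Rightarrow> 'v \<Rightarrow> 'v) \<Rightarrow> bool" where
  "equicontinuous_translations T K act \<longleftrightarrow>
     (\<forall>x\<in>K. \<forall>U. openin T U \<and> 0 \<in> U \<longrightarrow>
        (\<exists>V. openin (subtopology T K) V \<and> x \<in> V \<and> (\<forall>s. \<forall>y\<in>V. act s y - act s x \<in> U)))"

definition seminorm_bounded :: "('v \<Rightarrow> real) set \<Rightarrow> 'v set \<Rightarrow> bool" where
  "seminorm_bounded Q A \<longleftrightarrow> (\<forall>p\<in>Q. \<exists>d>0. \<forall>x\<in>A. p x \<le> d)"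

definition normal_structure ::
    "'v::real_vector topology \<Rightarrow> ('v \<Rightarrow> real) set \<Rightarrow> 'v set \<Rightarrow> bool" where
  "normal_structure \<tau> Q K \<longleftrightarrow>
     (\<forall>A. A \<subseteq> K \<and> seminorm_bounded Q A \<and> (\<exists>x\<in>A. \<exists>y\<in>A. x \<noteq> y) \<longrightarrow>
        (\<exists>u \<in> \<tau> closure_of (convex hull K). \<exists>p\<in>Q.
           Sup {p (x - u) | x. x \<in> A} < Sup {p (x - y) | x y. x \<in> A \<and> y \<in> A}))"

definition has_fixed_point :: "'v set \<Rightarrow> ('s \<Rightarrow> 'v \<Rightarrow> 'v) \<Rightarrow> bool" where
  "has_fixed_point K act \<longleftrightarrow> (\<exists>x\<in>K. \<forall>s. act s x = x)"

definition property_D ::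
    "'s::semitopological_semigroup itself \<Rightarrow> 'v::real_vector itself \<Rightarrow> bool" where
  "property_D S V \<longleftrightarrow>
     (\<forall>(X :: 'v set) \<tau> Q K (act :: 's \<Rightarrow> 'v \<Rightarrow> 'v).
        locally_convex_space X \<tau> \<and> determined_by_seminorms X \<tau> Q \<and>
        K \<subseteq> X \<and> K \<noteq> {} \<and> compactin \<tau> K \<and> convex K \<and>
        dynamical_system (subtopology \<tau> K) act \<and> nonexpansive Q K act \<longrightarrow>
        has_fixed_point K act)"

definition property_E ::
    "'s::semitopological_semigroup itself \<Rightarrow> 'v::real_vector itself \<Rightarrow> bool" where
  "property_E S V \<longleftrightarrow>
     (\<forall>(X :: 'v set) \<tau> Q K (act :: 's \<Rightarrow> 'v \<Rightarrow> 'v).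
        locally_convex_space X \<tau> \<and> determined_by_seminorms X \<tau> Q \<and>
        K \<subseteq> X \<and> K \<noteq> {} \<and> compactin (weak_topology X \<tau>) K \<and> convex K \<and>
        dynamical_system (subtopology (weak_topology X \<tau>) K) act \<and> nonexpansive Q K act \<and>
        equicontinuous_translations (weak_topology X \<tau>) K act \<longrightarrow>
        has_fixed_point K act)"

definition property_E' ::
    "'s::semitopological_semigroup itself \<Rightarrow> 'v::real_vector itself \<Rightarrow> bool" where
  "property_E' S V \<longleftrightarrow>
     (\<forall>(X :: 'v set) \<tau> Q K (act :: 's \<Rightarrow> 'v \<Rightarrow> 'v).
        locally_convex_space X \<tau> \<and> determined_by_seminorms X \<tau> Q \<and>
        K \<subseteq> X \<and> K \<noteq> {} \<and> compactin (weak_topology X \<tau>) K \<and> convex K \<and>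
        normal_structure \<tau> Q K \<and>
        dynamical_system (subtopology (weak_topology X \<tau>) K) act \<and> nonexpansive Q K act \<and>
        equicontinuous_translations (weak_topology X \<tau>) K act \<longrightarrow>
        has_fixed_point K act)"

end

theory Submission
  imports Defs
begin

text \<open>
  The hard implication is (D) to (E). Let \<open>F\<close> be a minimal weakly closed invariant subset of a
  minimal weakly closed convex invariant set. If every translation maps \<open>F\<close> onto \<open>F\<close>, then by
  equicontinuity translations are recurrent on \<open>F\<close>, hence isometric for every \<open>p \<in> Q\<close>, as \<open>p\<close> is
  weakly lower semicontinuous. Since \<open>F\<close> has weakly open pieces of arbitrarily small \<open>p\<close>-diameter,
  it is \<open>p\<close>-precompact, and De Marr's argument (normal structure of precompact sets, applied to the
  minimal convex set) shows that \<open>F\<close> is a point.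

  If some translation is not onto, an invariant mean on the translates of a suitable function
  \<open>h\<close> on \<open>F\<close> would give a contradiction, and (D) provides such a mean once the compact convex set
  of means is realised inside \<open>'v\<close>. By equicontinuity the translates of \<open>h\<close> are separable in the
  uniform norm, so a linear injection of the bounded sequences into \<open>'v\<close> suffices; it exists if
  finitely many functionals never separate the points of \<open>K\<close>. Otherwise \<open>\<tau>\<close> and the weak topology
  agree on \<open>K\<close> and (D) applies to \<open>K\<close> itself.
\<close>

subsection \<open>Hahn--Banach\<close>

text \<open>The obstacle is that (D) is assumed for one fixed type \<open>'v\<close> only. The usual
  route from (D) to an invariant mean applies (D) to the compact convex set of all means on a
  function space, but such a space need not embed in \<open>'v\<close>. So a mean is remembered only
  through its values on the orbit of a single function \<open>h\<close>, that is, as a real function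
  of indices. By equicontinuity the orbit is totally bounded for the uniform norm; hence these
  functions are determined by a sequence of values, and on them pointwise and uniform convergence
  agree, so that one norm provides the locally convex space that (D) asks for. The room for bounded
  sequences is taken from \<open>K\<close> itself: an infinite-dimensional weakly compact convex set
  contains enough weakly convergent geometric series.

  The way back from (E') to (D) is soft. On a \<tau>-compact set \<tau> and the weak topology
  coincide, nonexpansiveness then is weak equicontinuity, and precompactness gives normal
  structure.\<close>

definition sublinear :: "('v::real_vector \<Rightarrow> real) \<Rightarrow> bool" where
  "sublinear q \<longleftrightarrow> (\<forall>x y. q (x + y) \<le> q x + q y) \<and> (\<forall>c\<ge>0. \<forall>x. q (c *\<^sub>R x) = c * q x)"

lemma sublinear_lower_bound:
  assumes "sublinear q"
  shows "- q (- x) \<le> q x"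
proof -
  have "q (x + - x) \<le> q x + q (- x)" "q (0 *\<^sub>R x) = 0 * q x"
    using assms unfolding sublinear_def by blast+
  then show ?thesis by simp
qed

text \<open>Using \<open>le\<close> for \<open>c\<close> and for \<open>inverse c\<close> gives both
  inequalities, so half of positive homogeneity is enough to check.\<close>

lemma sublinearI:
  assumes "\<And>x y. q (x + y) \<le> q x + q y"
    and zero: "q 0 = 0"
    and le: "\<And>c x. 0 < c \<Longrightarrow> q (c *\<^sub>R x) \<le> c * q x"
  shows "sublinear q"
proof -
  have "q (c *\<^sub>R x) = c * q x" if c: "c \<ge> 0" for c x
  proof (cases "c = 0")
    case False
    with c have c: "c > 0" by simp
    have "q x = q (inverse c *\<^sub>R (c *\<^sub>R x))" using c by simp
    also have "\<dots> \<le> inverse c * q (c *\<^sub>R x)" using c by (intro le) simp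
    finally have "c * q x \<le> q (c *\<^sub>R x)" using c by (simp add: field_simps)
    with le[OF c, of x] show ?thesis by simp
  qed (simp add: zero)
  then show ?thesis using assms unfolding sublinear_def by blast
qed

text \<open>The function \<open>r\<close> lies below \<open>q\<close> and satisfies
  \<open>r (- y) \<le> - q y\<close>, so it is already linear along \<open>y\<close>. It serves as
  the competitor that a minimal sublinear function cannot have.\<close>

lemma sublinear_shift:
  fixes y :: "'v::real_vector"
  assumes q: "sublinear q"
  defines "r \<equiv> \<lambda>x. INF t\<in>{0..}. q (x + t *\<^sub>R y) - t * q y"
  shows "sublinear r" "\<And>x t. t \<ge> 0 \<Longrightarrow> r x \<le> q (x + t *\<^sub>R y) - t * q y"
proof -
  have add: "q (x + z) \<le> q x + q z" for x z using q unfolding sublinear_def by blast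
  have scale: "c \<ge> 0 \<Longrightarrow> q (c *\<^sub>R x) = c * q x" for c x using q unfolding sublinear_def by blast
  have lb: "- q (- x) \<le> q (x + t *\<^sub>R y) - t * q y" if "t \<ge> 0" for x t
  proof -
    have "t * q y = q ((x + t *\<^sub>R y) + (- x))" using that by (simp add: scale)
    also have "\<dots> \<le> q (x + t *\<^sub>R y) + q (- x)" by (rule add)
    finally show ?thesis by simp
  qed
  have bdd: "bdd_below ((\<lambda>t. q (x + t *\<^sub>R y) - t * q y) ` {0..})" for x
    by (rule bdd_belowI2[where m = "- q (- x)"]) (use lb in auto)
  show up: "r x \<le> q (x + t *\<^sub>R y) - t * q y" if "t \<ge> 0" for x t
    unfolding r_def using that by (intro cINF_lower bdd) simp
  have approx: "\<exists>t\<ge>0. q (x + t *\<^sub>R y) - t * q y < r x + e" if "e > 0" for x e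
  proof -
    have "r x < r x + e" using that by simp
    then show ?thesis unfolding r_def
      using bdd by (subst (asm) cINF_less_iff) auto
  qed
  show "sublinear r"
  proof (rule sublinearI)
    fix x z
    show "r (x + z) \<le> r x + r z"
    proof (rule field_le_epsilon)
      fix e :: real assume "e > 0"
      then obtain s t where s: "s \<ge> 0" "q (x + s *\<^sub>R y) - s * q y < r x + e/2"
        and t: "t \<ge> 0" "q (z + t *\<^sub>R y) - t * q y < r z + e/2"
        using approx[of "e/2" x] approx[of "e/2" z] by auto
      have "r (x + z) \<le> q ((x + z) + (s + t) *\<^sub>R y) - (s + t) * q y"
        by (rule up) (use s t in simp)
      also have "(x + z) + (s + t) *\<^sub>R y = (x + s *\<^sub>R y) + (z + t *\<^sub>R y)"
        by (simp add: algebra_simps)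
      also have "q \<dots> \<le> q (x + s *\<^sub>R y) + q (z + t *\<^sub>R y)" by (rule add)
      finally show "r (x + z) \<le> r x + r z + e" using s t by (simp add: algebra_simps)
    qed
  next
    have "q 0 = 0" using scale[of 0 0] by simp
    then have "r 0 \<le> 0" using up[of 0 0] by simp
    moreover have "0 \<le> r 0" unfolding r_def
      by (rule cINF_greatest) (use lb[of _ 0] \<open>q 0 = 0\<close> in auto)
    ultimately show "r 0 = 0" by simp
  next
    fix c :: real and x assume c: "0 < c"
    show "r (c *\<^sub>R x) \<le> c * r x"
    proof (rule field_le_epsilon)
      fix e :: real assume "e > 0"
      then obtain s where s: "s \<ge> 0" "q (x + s *\<^sub>R y) - s * q y < r x + e/c"
        using approx[of "e/c" x] c by auto
      have "r (c *\<^sub>R x) \<le> q (c *\<^sub>R x + (c * s) *\<^sub>R y) - (c * s) * q y"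
        by (rule up) (use s c in simp)
      also have "c *\<^sub>R x + (c * s) *\<^sub>R y = c *\<^sub>R (x + s *\<^sub>R y)"
        by (simp add: algebra_simps)
      also have "q \<dots> - (c * s) * q y = c * (q (x + s *\<^sub>R y) - s * q y)"
        using c by (simp add: scale right_diff_distrib del: scaleR_add_right)
      also have "\<dots> \<le> c * (r x + e/c)"
        using c s by (intro mult_left_mono) auto
      finally show "r (c *\<^sub>R x) \<le> c * r x + e" using c by (simp add: algebra_simps)
    qed
  qed
qed

text \<open>By minimality the shift of \<open>q\<close> along \<open>y\<close> is \<open>q\<close>
  itself, and its bound at \<open>t = 1\<close> is the missing half of additivity.\<close>

lemma minimal_sublinear_linear:
  assumes q: "sublinear q" and min: "\<And>r. sublinear r \<Longrightarrow> r \<le> q \<Longrightarrow> r = q"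
  shows "linear q"
proof -
  have add: "q (x + z) \<le> q x + q z" for x z using q unfolding sublinear_def by blast
  have scale: "c \<ge> 0 \<Longrightarrow> q (c *\<^sub>R x) = c * q x" for c x using q unfolding sublinear_def by blast
  have eq: "q (x + y) = q x + q y" for x y
  proof -
    define r where "r \<equiv> \<lambda>x. INF t\<in>{0..}. q (x + t *\<^sub>R y) - t * q y"
    have r: "sublinear r" "\<And>x t. t \<ge> 0 \<Longrightarrow> r x \<le> q (x + t *\<^sub>R y) - t * q y"
      unfolding r_def by (fact sublinear_shift[OF q])+
    have "r \<le> q" using r(2)[of 0] scale[of 0 0] by (auto simp: le_fun_def)
    then have "r = q" using r(1) min by blast
    then have "q x \<le> q (x + y) - q y" using r(2)[of 1 x] by simp
    with add[of x y] show ?thesis by simp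
  qed
  have neg: "q (- x) = - q x" for x
    using eq[of x "- x"] scale[of 0 0] by simp
  show "linear q"
  proof (rule linearI)
    show "q (x + y) = q x + q y" for x y by (rule eq)
    show "q (c *\<^sub>R x) = c *\<^sub>R q x" for c x
    proof (cases "c \<ge> 0")
      case False
      then have "q (c *\<^sub>R x) = - q ((- c) *\<^sub>R x)" using neg[of "c *\<^sub>R x"] by simp
      then show ?thesis using False scale[of "- c" x] by simp
    qed (simp add: scale)
  qed
qed

text \<open>Zorn's lemma is applied downwards. A chain has its pointwise infimum as lower bound,
  which is finite because every member stays above \<open>- q (- x)\<close>.\<close>

theorem hahn_banach_sublinear:
  assumes q: "sublinear q"
  obtains f where "linear f" "\<And>x. f x \<le> q x"
proof -
  define A where "A = {r. sublinear r \<and> r \<le> q}"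
  let ?P = "\<lambda>r s :: 'a \<Rightarrow> real. s \<le> r"
  have "\<exists>m\<in>A. \<forall>a\<in>A. ?P m a \<longrightarrow> a = m"
  proof (rule predicate_Zorn)
    show "partial_order_on A (relation_of ?P A)"
      by (rule partial_order_on_relation_ofI) auto
    fix C assume "C \<in> Chains (relation_of ?P A)"
    then have CA: "C \<subseteq> A" and chain: "\<And>r s. r \<in> C \<Longrightarrow> s \<in> C \<Longrightarrow> r \<le> s \<or> s \<le> r"
      unfolding Chains_def relation_of_def by blast+
    show "\<exists>u\<in>A. \<forall>a\<in>C. ?P a u"
    proof (cases "C = {}")
      case True
      then show ?thesis using q unfolding A_def by blast
    next
      case False
      define u where "u x = (INF r\<in>C. r x)" for x
      have lb: "- q (- x) \<le> r x" if "r \<in> C" for r x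
      proof -
        have "sublinear r" "r \<le> q" using that CA unfolding A_def by auto
        then have "- r (- x) \<le> r x" "r (- x) \<le> q (- x)"
          using sublinear_lower_bound by (auto simp: le_fun_def)
        then show ?thesis by simp
      qed
      have bdd: "bdd_below ((\<lambda>r. r x) ` C)" for x
        by (rule bdd_belowI2[where m = "- q (- x)"]) (use lb in auto)
      have up: "u x \<le> r x" if "r \<in> C" for r x
        unfolding u_def using that by (intro cINF_lower bdd)
      have approx: "\<exists>r\<in>C. r x < u x + e" if "e > 0" for x e
      proof -
        have "u x < u x + e" using that by simp
        then show ?thesis unfolding u_def
          using bdd False by (subst (asm) cINF_less_iff) auto
      qed
      have sub: "sublinear r" if "r \<in> C" for r using that CA unfolding A_def by auto
      have "sublinear u"
      proof (rule sublinearI)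
        fix x z
        show "u (x + z) \<le> u x + u z"
        proof (rule field_le_epsilon)
          fix e :: real assume "e > 0"
          then obtain r s where r: "r \<in> C" "r x < u x + e/2" and s: "s \<in> C" "s z < u z + e/2"
            using approx[of "e/2" x] approx[of "e/2" z] by auto
          \<comment> \<open>The smaller of two comparable near-minimisers is nearly minimal at both
            points; this is where the chain condition is needed.\<close>
          obtain m where m: "m \<in> C" "m \<le> r" "m \<le> s" using chain[OF r(1) s(1)] r s by auto
          have "u (x + z) \<le> m (x + z)" using m by (intro up)
          also have "\<dots> \<le> m x + m z" using sub[OF m(1)] unfolding sublinear_def by blast
          also have "\<dots> \<le> r x + s z" using m by (auto simp: le_fun_def intro: add_mono)
          finally show "u (x + z) \<le> u x + u z + e" using r s by simp
        qed
      next
        have "r 0 = 0" if "r \<in> C" for r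
        proof -
          have "r (0 *\<^sub>R 0) = 0 * r 0" using sub[OF that] unfolding sublinear_def by blast
          then show ?thesis by simp
        qed
        then have "(\<lambda>r. r 0) ` C = {0}" using False by force
        then show "u 0 = 0" unfolding u_def by simp
      next
        fix c :: real and x assume c: "0 < c"
        show "u (c *\<^sub>R x) \<le> c * u x"
        proof (rule field_le_epsilon)
          fix e :: real assume "e > 0"
          then obtain s where s: "s \<in> C" "s x < u x + e/c"
            using approx[of "e/c" x] c by auto
          have "u (c *\<^sub>R x) \<le> s (c *\<^sub>R x)" using s by (intro up)
          also have "\<dots> = c * s x" using sub[OF s(1)] c unfolding sublinear_def by simp
          also have "\<dots> \<le> c * (u x + e/c)" using c s by (intro mult_left_mono) auto
          finally show "u (c *\<^sub>R x) \<le> c * u x + e" using c by (simp add: algebra_simps)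
        qed
      qed
      moreover have "u \<le> q"
      proof -
        obtain r where "r \<in> C" using False by blast
        with CA up have "r \<le> q" "u \<le> r" unfolding A_def by (auto simp: le_fun_def)
        then show ?thesis by simp
      qed
      ultimately show ?thesis using up unfolding A_def by (auto simp: le_fun_def)
    qed
  qed
  then obtain m where m: "sublinear m" "m \<le> q" and min: "\<And>r. r \<in> A \<Longrightarrow> r \<le> m \<Longrightarrow> r = m"
    unfolding A_def by blast
  have "linear m"
  proof (rule minimal_sublinear_linear[OF m(1)])
    fix r assume "sublinear r" "r \<le> m"
    with m min show "r = m" unfolding A_def by auto
  qed
  with m that show thesis by (auto simp: le_fun_def)
qed

section \<open>Seminorms on a subspace and separation of convex sets\<close>

lemma seminorm_onD:
  assumes "seminorm_on X p"
  shows "x \<in> X \<Longrightarrow> 0 \<le> p x"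
    "x \<in> X \<Longrightarrow> y \<in> X \<Longrightarrow> p (x + y) \<le> p x + p y"
    "x \<in> X \<Longrightarrow> p (c *\<^sub>R x) = \<bar>c\<bar> * p x"
  using assms unfolding seminorm_on_def by blast+

lemma seminorm_on_minus:
  assumes "seminorm_on X p" "x \<in> X"
  shows "p (- x) = p x"
  using seminorm_onD(3)[OF assms, of "-1"] by simp

lemma seminorm_on_diff_commute:
  assumes "seminorm_on X p" "subspace X" "x \<in> X" "y \<in> X"
  shows "p (x - y) = p (y - x)"
  using seminorm_on_minus[OF assms(1), of "x - y"] assms subspace_diff[of X] by simp

lemma seminorm_on_zero:
  assumes "seminorm_on X p" "subspace X"
  shows "p 0 = 0"
  using seminorm_onD(3)[OF assms(1), of 0 0] subspace_0[OF assms(2)] by simp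

lemma seminorm_on_diff_triangle:
  assumes p: "seminorm_on X p" "subspace X" and "x \<in> X" "y \<in> X" "z \<in> X"
  shows "p (x - z) \<le> p (x - y) + p (y - z)"
  using seminorm_onD(2)[OF p(1), of "x - y" "y - z"] assms subspace_diff[of X] by simp

lemma seminorm_on_abs_diff:
  assumes p: "seminorm_on X p" "subspace X" and "x \<in> X" "y \<in> X"
  shows "\<bar>p x - p y\<bar> \<le> p (x - y)"
  using seminorm_onD(2)[OF p(1), of "x - y" y] seminorm_onD(2)[OF p(1), of "y - x" x]
    seminorm_on_diff_commute[OF assms] assms subspace_diff[of X] by fastforce

text \<open>Hahn--Banach is applied to \<open>z \<mapsto> inf {p (z - t (c - x)) - t d | t \<ge> 0, c \<in> C}\<close>.\<close>

theorem separate_convex: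
  fixes p :: "'v::real_vector \<Rightarrow> real"
  assumes X: "subspace X" and p: "seminorm_on X p" and C: "convex C" "C \<subseteq> X" and x: "x \<in> X"
    and d: "0 \<le> d" "\<And>c. c \<in> C \<Longrightarrow> d \<le> p (c - x)"
  obtains f :: "'v \<Rightarrow> real" where "linear f" "\<And>z. z \<in> X \<Longrightarrow> f z \<le> p z"
    "\<And>c. c \<in> C \<Longrightarrow> f c \<le> f x - d"
proof (cases "C = {}")
  case True
  show thesis
    by (rule that[of "\<lambda>x. 0"]) (use True seminorm_onD(1)[OF p] in \<open>auto intro: linear_zero\<close>)
next
  case False
  then obtain c0 where c0: "c0 \<in> C" by blast
  \<comment> \<open>Hahn--Banach was proved for functions on the whole type, whereas
    \<open>p\<close> is meaningful on \<open>X\<close> only; a linear projection onto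
    \<open>X\<close> bridges the gap.\<close>
  obtain \<pi> :: "'v \<Rightarrow> 'v" where \<pi>: "range \<pi> \<subseteq> X" "linear \<pi>" "\<And>v. v \<in> X \<Longrightarrow> \<pi> v = v"
    using linear_exists_left_inverse_on[OF linear_id X] by auto
  have piX: "\<pi> z \<in> X" for z using \<pi>(1) by blast
  have [simp]: "\<pi> 0 = 0" using X by (intro \<pi>(3)) (rule subspace_0)
  note add = linear_add[OF \<pi>(2)] and scale = linear_scale[OF \<pi>(2)]
  define I where "I = {0::real..} \<times> C"
  define g where "g z tc = p (\<pi> z - fst tc *\<^sub>R (snd tc - x)) - fst tc * d" for z and tc :: "real \<times> 'v"
  define q where "q z = (INF tc\<in>I. g z tc)" for z
  have cx: "c - x \<in> X" if "c \<in> C" for c using that C x X by (auto intro: subspace_diff)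
  have scX: "t *\<^sub>R (c - x) \<in> X" if "c \<in> C" for c t using that cx X by (auto intro: subspace_scale)
  have difX: "\<pi> z - t *\<^sub>R (c - x) \<in> X" if "c \<in> C" for c t z
    using that scX X piX by (auto intro: subspace_diff)
  have "I \<noteq> {}" using c0 unfolding I_def by auto
  \<comment> \<open>Here the distance hypothesis enters: it keeps the infimum defining
    \<open>q\<close> finite.\<close>
  have lb: "- p (\<pi> z) \<le> g z tc" if "tc \<in> I" for z tc
  proof -
    obtain t c where tc: "tc = (t, c)" "t \<ge> 0" "c \<in> C" using \<open>tc \<in> I\<close> unfolding I_def by auto
    have "t * d \<le> t * p (c - x)" using tc d by (intro mult_left_mono) auto
    also have "\<dots> = p (t *\<^sub>R (c - x))" using seminorm_onD(3)[OF p cx[OF tc(3)], of t] tc by simp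
    also have "\<dots> = p (- (\<pi> z - t *\<^sub>R (c - x)) + \<pi> z)" by simp
    also have "\<dots> \<le> p (- (\<pi> z - t *\<^sub>R (c - x))) + p (\<pi> z)"
      by (rule seminorm_onD(2)[OF p subspace_neg[OF X difX[OF tc(3)]] piX])
    also have "p (- (\<pi> z - t *\<^sub>R (c - x))) = p (\<pi> z - t *\<^sub>R (c - x))"
      by (rule seminorm_on_minus[OF p difX[OF tc(3)]])
    finally show ?thesis unfolding g_def tc by simp
  qed
  have bdd: "bdd_below (g z ` I)" for z
    by (rule bdd_belowI2[where m = "- p (\<pi> z)"]) (use lb in auto)
  have up: "q z \<le> g z tc" if "tc \<in> I" for z tc
    unfolding q_def using that by (intro cINF_lower bdd)
  have approx: "\<exists>tc\<in>I. g z tc < q z + e" if "e > 0" for z e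
  proof -
    have "q z < q z + e" using that by simp
    then show ?thesis unfolding q_def
      using bdd \<open>I \<noteq> {}\<close> by (subst (asm) cINF_less_iff) auto
  qed
  have "sublinear q"
  proof (rule sublinearI)
    fix y z
    show "q (y + z) \<le> q y + q z"
    proof (rule field_le_epsilon)
      fix e :: real assume "e > 0"
      then obtain tc1 tc2 where 1: "tc1 \<in> I" "g y tc1 < q y + e/2" and 2: "tc2 \<in> I" "g z tc2 < q z + e/2"
        using approx[of "e/2" y] approx[of "e/2" z] by auto
      obtain s c where sc: "tc1 = (s, c)" "s \<ge> 0" "c \<in> C" using 1 unfolding I_def by auto
      obtain t b where tb: "tc2 = (t, b)" "t \<ge> 0" "b \<in> C" using 2 unfolding I_def by auto
      \<comment> \<open>The cone over the convex set \<open>C - x\<close> is closed under addition,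
        so the two index pairs can be merged into one.\<close>
      obtain a where a: "a \<in> C" "(s + t) *\<^sub>R (a - x) = s *\<^sub>R (c - x) + t *\<^sub>R (b - x)"
      proof (cases "s + t = 0")
        case True
        then have "s = 0" "t = 0" using sc tb by auto
        then show thesis using that sc by auto
      next
        case False
        define a where "a = (s / (s + t)) *\<^sub>R c + (t / (s + t)) *\<^sub>R b"
        have "a \<in> C" unfolding a_def
          using sc tb False by (intro convexD[OF C(1)]) (auto simp: add_divide_distrib[symmetric])
        moreover have "(s + t) *\<^sub>R a = s *\<^sub>R c + t *\<^sub>R b"
          unfolding a_def using False by (simp add: scaleR_add_right)
        ultimately show thesis using that by (simp add: algebra_simps)
      qed
      have "q (y + z) \<le> g (y + z) (s + t, a)"
        by (rule up) (use sc tb a in \<open>auto simp: I_def\<close>)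
      also have "\<dots> = p ((\<pi> y - s *\<^sub>R (c - x)) + (\<pi> z - t *\<^sub>R (b - x))) - (s + t) * d"
        unfolding g_def fst_conv snd_conv a(2) add by (simp add: algebra_simps)
      also have "\<dots> \<le> g y tc1 + g z tc2"
        unfolding g_def sc tb
        using seminorm_onD(2)[OF p difX[OF sc(3)] difX[OF tb(3)], of y s z t] by (simp add: algebra_simps)
      finally show "q (y + z) \<le> q y + q z + e" using 1 2 by simp
    qed
  next
    have "(0, c0) \<in> I" using c0 unfolding I_def by simp
    then have "q 0 \<le> g 0 (0, c0)" by (rule up)
    then have "q 0 \<le> 0" by (simp add: g_def seminorm_on_zero[OF p X])
    moreover have "0 \<le> q 0" unfolding q_def
      by (rule cINF_greatest) (use lb[of _ 0] \<open>I \<noteq> {}\<close> in \<open>auto simp: seminorm_on_zero[OF p X]\<close>)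
    ultimately show "q 0 = 0" by simp
  next
    fix c :: real and z assume c: "0 < c"
    show "q (c *\<^sub>R z) \<le> c * q z"
    proof (rule field_le_epsilon)
      fix e :: real assume "e > 0"
      then obtain tb where 1: "tb \<in> I" "g z tb < q z + e/c"
        using approx[of "e/c" z] c by auto
      then obtain t b where tb: "tb = (t, b)" "t \<ge> 0" "b \<in> C" unfolding I_def by auto
      have "q (c *\<^sub>R z) \<le> g (c *\<^sub>R z) (c * t, b)"
        by (rule up) (use tb c in \<open>auto simp: I_def\<close>)
      also have "\<dots> = p (c *\<^sub>R (\<pi> z - t *\<^sub>R (b - x))) - c * t * d"
        unfolding g_def by (simp add: scale algebra_simps)
      also have "\<dots> = c * g z tb"
        using c by (simp add: seminorm_onD(3)[OF p difX[OF tb(3)]] g_def tb right_diff_distrib)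
      also have "\<dots> \<le> c * (q z + e/c)" using c 1 by (intro mult_left_mono) auto
      finally show "q (c *\<^sub>R z) \<le> c * q z + e" using c by (simp add: algebra_simps)
    qed
  qed
  then obtain f where f: "linear f" "\<And>x. f x \<le> q x" by (rule hahn_banach_sublinear) blast
  show thesis
  proof (rule that[OF f(1)])
    fix z assume "z \<in> X"
    have "f z \<le> g z (0, c0)" using f(2)[of z] up[of "(0, c0)" z] c0 unfolding I_def by simp
    then show "f z \<le> p z" by (simp add: g_def \<pi>(3) \<open>z \<in> X\<close>)
  next
    fix c assume c: "c \<in> C"
    \<comment> \<open>With \<open>t = 1\<close> and this \<open>c\<close> the seminorm term vanishes
      and only \<open>- d\<close> is left.\<close>
    have "f (c - x) \<le> g (c - x) (1, c)"
      using f(2)[of "c - x"] up[of "(1, c)" "c - x"] c unfolding I_def by simp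
    then have "f (c - x) \<le> - d" by (simp add: g_def \<pi>(3) cx[OF c] seminorm_on_zero[OF p X])
    then show "f c \<le> f x - d" by (simp add: linear_diff[OF f(1)])
  qed
qed

subsection \<open>Seminorm topologies and weak topologies\<close>

definition seminorm_ball :: "'v::real_vector set \<Rightarrow> ('v \<Rightarrow> real) set \<Rightarrow> 'v \<Rightarrow> real \<Rightarrow> 'v set" where
  "seminorm_ball X P x e = {y \<in> X. \<forall>p\<in>P. p (y - x) < e}"

lemma topspace_seminorm_topology [simp]: "topspace (seminorm_topology X Q) = X"
  unfolding seminorm_topology_def by (auto simp: topology_generated_by_topspace)

text \<open>Replaces the subbase by a neighbourhood criterion. The sets satisfying the criterion
  form a topology containing the subbase, and the generated topology is the coarsest such
  one.\<close>

lemma openin_seminorm_topology: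
  assumes X: "subspace X" and Q: "\<And>p. p \<in> Q \<Longrightarrow> seminorm_on X p"
  shows "openin (seminorm_topology X Q) U \<longleftrightarrow>
    U \<subseteq> X \<and> (\<forall>x\<in>U. \<exists>P e. finite P \<and> P \<subseteq> Q \<and> 0 < e \<and> seminorm_ball X P x e \<subseteq> U)"
    (is "_ \<longleftrightarrow> ?O U")
proof
  let ?G = "insert X {{y \<in> X. p (y - x) < e} | p x e. p \<in> Q \<and> x \<in> X \<and> 0 < e}"
  have ball_sub: "{y \<in> X. p (y - x) < e} \<subseteq> X" for p x and e :: real by blast
  have "istopology ?O"
    unfolding istopology_def
  proof (intro conjI allI impI)
    fix S T assume S: "?O S" and T: "?O T"
    show "S \<inter> T \<subseteq> X" using S by blast
    show "\<forall>x\<in>S \<inter> T. \<exists>P e. finite P \<and> P \<subseteq> Q \<and> 0 < e \<and> seminorm_ball X P x e \<subseteq> S \<inter> T"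
    proof
      fix x assume "x \<in> S \<inter> T"
      then obtain P1 e1 P2 e2 where "finite P1" "P1 \<subseteq> Q" "0 < e1" "seminorm_ball X P1 x e1 \<subseteq> S"
        "finite P2" "P2 \<subseteq> Q" "0 < e2" "seminorm_ball X P2 x e2 \<subseteq> T"
        using S T by (meson IntD1 IntD2)
      then show "\<exists>P e. finite P \<and> P \<subseteq> Q \<and> 0 < e \<and> seminorm_ball X P x e \<subseteq> S \<inter> T"
        by (intro exI[of _ "P1 \<union> P2"] exI[of _ "min e1 e2"]) (auto simp: seminorm_ball_def)
    qed
  next
    fix K assume K: "\<forall>S\<in>K. ?O S"
    then show "\<Union>K \<subseteq> X" by blast
    show "\<forall>x\<in>\<Union>K. \<exists>P e. finite P \<and> P \<subseteq> Q \<and> 0 < e \<and> seminorm_ball X P x e \<subseteq> \<Union>K"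
    proof
      fix x assume "x \<in> \<Union>K"
      then obtain S where "S \<in> K" "x \<in> S" by blast
      have "\<exists>P e. finite P \<and> P \<subseteq> Q \<and> 0 < e \<and> seminorm_ball X P x e \<subseteq> S"
        using bspec[OF conjunct2[OF bspec[OF K \<open>S \<in> K\<close>]] \<open>x \<in> S\<close>] .
      then obtain P e where "finite P" "P \<subseteq> Q" "0 < e" "seminorm_ball X P x e \<subseteq> S"
        by (elim exE conjE)
      with \<open>S \<in> K\<close> show "\<exists>P e. finite P \<and> P \<subseteq> Q \<and> 0 < e \<and> seminorm_ball X P x e \<subseteq> \<Union>K"
        by (intro exI[of _ P] exI[of _ e]) blast
    qed
  qed
  moreover have "?O S" if "S \<in> ?G" for S
  proof (cases "S = X")
    case True
    then show ?thesis by (intro conjI ballI exI[of _ "{}"] exI[of _ 1]) (auto simp: seminorm_ball_def)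
  next
    case False
    with that obtain p x e where S: "S = {y \<in> X. p (y - x) < e}" and p: "p \<in> Q" and x: "x \<in> X"
      by blast
    show ?thesis
    proof (intro conjI ballI)
      show "S \<subseteq> X" using S by blast
      fix y assume "y \<in> S"
      then have y: "y \<in> X" "p (y - x) < e" using S by auto
      have "p (z - x) < e" if "z \<in> X" "p (z - y) < e - p (y - x)" for z
        using seminorm_on_diff_triangle[OF Q[OF p] X that(1) y(1) x] that by simp
      then show "\<exists>P e. finite P \<and> P \<subseteq> Q \<and> 0 < e \<and> seminorm_ball X P y e \<subseteq> S"
        using p y S by (intro exI[of _ "{p}"] exI[of _ "e - p (y - x)"]) (auto simp: seminorm_ball_def)
    qed
  qed
  ultimately have "generate_topology_on ?G U \<Longrightarrow> ?O U"
    by (rule generate_topology_on_coarsest)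
  then show "openin (seminorm_topology X Q) U \<Longrightarrow> ?O U"
    unfolding seminorm_topology_def openin_topology_generated_by_iff .
next
  let ?T = "seminorm_topology X Q"
  have ball: "openin ?T (seminorm_ball X P x e)" if "finite P" "P \<subseteq> Q" "0 < e" "x \<in> X" for P x e
    using that
  proof (induction P rule: finite_induct)
    case empty
    have "seminorm_ball X {} x e = topspace ?T" by (simp add: seminorm_ball_def)
    then show ?case using openin_topspace[of ?T] by metis
  next
    case (insert p P)
    have "openin ?T {y \<in> X. p (y - x) < e}"
      unfolding seminorm_topology_def
      by (rule topology_generated_by_Basis) (use insert in blast)
    moreover have "seminorm_ball X (insert p P) x e = {y \<in> X. p (y - x) < e} \<inter> seminorm_ball X P x e"
      by (auto simp: seminorm_ball_def)
    ultimately show ?case using insert by auto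
  qed
  assume O: "?O U"
  show "openin ?T U"
  proof (subst openin_subopen, intro ballI)
    fix x assume "x \<in> U"
    with O obtain P e where P: "finite P" "P \<subseteq> Q" "0 < e" "seminorm_ball X P x e \<subseteq> U" "x \<in> X" by blast
    have "x \<in> seminorm_ball X P x e"
      using P seminorm_on_zero[OF Q X] by (force simp: seminorm_ball_def)
    with ball[OF P(1-3,5)] P(4) show "\<exists>T. openin ?T T \<and> x \<in> T \<and> T \<subseteq> U" by blast
  qed
qed

lemma openin_seminorm_topology_singleton:
  assumes X: "subspace X" and p: "seminorm_on X p"
  shows "openin (seminorm_topology X {p}) U \<longleftrightarrow>
    U \<subseteq> X \<and> (\<forall>x\<in>U. \<exists>e>0. \<forall>y\<in>X. p (y - x) < e \<longrightarrow> y \<in> U)"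
proof -
  have "(\<exists>P e. finite P \<and> P \<subseteq> {p} \<and> 0 < e \<and> seminorm_ball X P x e \<subseteq> U) \<longleftrightarrow>
      (\<exists>e>0. \<forall>y\<in>X. p (y - x) < e \<longrightarrow> y \<in> U)" (is "?L \<longleftrightarrow> ?R") if "x \<in> U" for x
  proof
    assume ?L
    then obtain P e where "P \<subseteq> {p}" "0 < e" "seminorm_ball X P x e \<subseteq> U" by blast
    then show ?R by (intro exI[of _ e]) (auto simp: seminorm_ball_def)
  next
    assume ?R
    then obtain e where "e > 0" "\<forall>y\<in>X. p (y - x) < e \<longrightarrow> y \<in> U" by blast
    then show ?L by (intro exI[of _ "{p}"] exI[of _ e]) (auto simp: seminorm_ball_def)
  qed
  then show ?thesis using p by (subst openin_seminorm_topology[OF X]) auto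
qed

text \<open>Needed to apply (D): the space of index functions will be given a single norm.\<close>

lemma
  assumes X: "subspace X" and p: "seminorm_on X p" and pos: "\<And>x. x \<in> X \<Longrightarrow> x \<noteq> 0 \<Longrightarrow> 0 < p x"
  shows locally_convex_space_norm: "locally_convex_space X (seminorm_topology X {p})"
    and determined_by_norm: "determined_by_seminorms X (seminorm_topology X {p}) {p}"
proof -
  let ?T = "seminorm_topology X {p}"
  note op = openin_seminorm_topology_singleton[OF X p]
  note tri = seminorm_on_diff_triangle[OF p X]
  have p0: "p 0 = 0" by (rule seminorm_on_zero[OF p X])
  have ball: "openin ?T {y \<in> X. p (y - x) < e}" if "x \<in> X" for x e
    unfolding op
  proof (intro conjI ballI)
    fix y assume "y \<in> {y \<in> X. p (y - x) < e}"
    then show "\<exists>e'>0. \<forall>z\<in>X. p (z - y) < e' \<longrightarrow> z \<in> {y \<in> X. p (y - x) < e}"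
      using tri[of _ y x] that by (intro exI[of _ "e - p (y - x)"]) fastforce
  qed blast
  have cball: "convex {y \<in> X. p (y - 0) < e}" for e
  proof (rule convexI)
    fix x y and u v :: real
    assume xy: "x \<in> {y \<in> X. p (y - 0) < e}" "y \<in> {y \<in> X. p (y - 0) < e}" and uv: "0 \<le> u" "0 \<le> v" "u + v = 1"
    have X': "u *\<^sub>R x \<in> X" "v *\<^sub>R y \<in> X" using xy X by (auto intro: subspace_scale)
    have "p (u *\<^sub>R x + v *\<^sub>R y) \<le> u * p x + v * p y"
      using seminorm_onD(2)[OF p X'] seminorm_onD(3)[OF p, of x u] seminorm_onD(3)[OF p, of y v] xy uv by simp
    also have "\<dots> < e"
      using xy uv by (intro convex_bound_lt) auto
    finally show "u *\<^sub>R x + v *\<^sub>R y \<in> {y \<in> X. p (y - 0) < e}" using X' X by (auto intro: subspace_add)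
  qed
  show "determined_by_seminorms X ?T {p}"
    unfolding determined_by_seminorms_def
  proof (intro conjI ballI)
    fix q assume "q \<in> {p}"
    then have [simp]: "q = p" by simp
    show "seminorm_on X q" using p by simp
    show "continuous_map ?T euclideanreal q"
      unfolding continuous_map_def
    proof (intro conjI allI impI)
      fix U :: "real set" assume "openin euclideanreal U"
      then have U: "open U" by simp
      show "openin ?T {x \<in> topspace ?T. q x \<in> U}"
        unfolding op
      proof (intro conjI ballI)
        fix x assume "x \<in> {x \<in> topspace ?T. q x \<in> U}"
        then have x: "x \<in> X" "p x \<in> U" by auto
        then obtain e where e: "e > 0" "\<And>r. \<bar>r - p x\<bar> < e \<Longrightarrow> r \<in> U"
          using U unfolding open_dist dist_real_def by blast
        have "p y \<in> U" if "y \<in> X" "p (y - x) < e" for y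
          using seminorm_on_abs_diff[OF p X that(1) x(1)] that by (intro e(2)) simp
        then show "\<exists>e>0. \<forall>y\<in>X. p (y - x) < e \<longrightarrow> y \<in> {x \<in> topspace ?T. q x \<in> U}"
          using e by (intro exI[of _ e]) simp
      qed auto
    qed simp
  qed simp
  show "locally_convex_space X ?T"
    unfolding locally_convex_space_def
  proof (intro conjI allI impI)
    show "Hausdorff_space ?T"
      unfolding Hausdorff_space_def
    proof (intro allI impI)
      fix x y assume xy: "x \<in> topspace ?T \<and> y \<in> topspace ?T \<and> x \<noteq> y"
      then have "p (x - y) > 0" using X by (intro pos) (auto intro: subspace_diff)
      define e where "e = p (x - y) / 2"
      then have "e > 0" using \<open>p (x - y) > 0\<close> by simp
      have "disjnt {z \<in> X. p (z - x) < e} {z \<in> X. p (z - y) < e}"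
        unfolding disjnt_iff
      proof (intro allI notI)
        fix z assume "z \<in> {z \<in> X. p (z - x) < e} \<and> z \<in> {z \<in> X. p (z - y) < e}"
        then show False
          using tri[of x z y] seminorm_on_diff_commute[OF p X, of x z] xy by (auto simp: e_def)
      qed
      then show "\<exists>U V. openin ?T U \<and> openin ?T V \<and> x \<in> U \<and> y \<in> V \<and> disjnt U V"
        using ball xy \<open>e > 0\<close> p0
        by - (rule exI[of _ "{z \<in> X. p (z - x) < e}"], intro exI[of _ "{z \<in> X. p (z - y) < e}"], auto)
    qed
    show "continuous_map (prod_topology ?T ?T) ?T (\<lambda>(x, y). x + y)"
      unfolding continuous_map_def
    proof (intro conjI allI impI)
      show "(\<lambda>(x, y). x + y) \<in> topspace (prod_topology ?T ?T) \<rightarrow> topspace ?T"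
        using X by (auto intro: subspace_add)
      fix U assume U: "openin ?T U"
      show "openin (prod_topology ?T ?T) {z \<in> topspace (prod_topology ?T ?T). (case z of (x, y) \<Rightarrow> x + y) \<in> U}"
        unfolding openin_prod_topology_alt
      proof (intro allI impI)
        fix x y assume "(x, y) \<in> {z \<in> topspace (prod_topology ?T ?T). (case z of (x, y) \<Rightarrow> x + y) \<in> U}"
        then have xy: "x \<in> X" "y \<in> X" "x + y \<in> U" by auto
        then obtain e where e: "e > 0" "\<And>z. z \<in> X \<Longrightarrow> p (z - (x + y)) < e \<Longrightarrow> z \<in> U"
          using U unfolding op by blast
        have "a + b \<in> U" if "a \<in> X" "b \<in> X" "p (a - x) < e/2" "p (b - y) < e/2" for a b
        proof (rule e(2))
          show "a + b \<in> X" using that X by (auto intro: subspace_add)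
          have "p ((a - x) + (b - y)) \<le> p (a - x) + p (b - y)"
            using that xy X by (intro seminorm_onD(2)[OF p]) (auto intro: subspace_diff)
          then show "p (a + b - (x + y)) < e" using that by (simp add: algebra_simps)
        qed
        then show "\<exists>V W. openin ?T V \<and> openin ?T W \<and> x \<in> V \<and> y \<in> W \<and>
            V \<times> W \<subseteq> {z \<in> topspace (prod_topology ?T ?T). (case z of (x, y) \<Rightarrow> x + y) \<in> U}"
          using ball[of x "e/2"] ball[of y "e/2"] xy e p0
          by - (rule exI[of _ "{z \<in> X. p (z - x) < e/2}"], intro exI[of _ "{z \<in> X. p (z - y) < e/2}"], auto)
      qed
    qed
    show "continuous_map (prod_topology euclideanreal ?T) ?T (\<lambda>(c, x). c *\<^sub>R x)"
      unfolding continuous_map_def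
    proof (intro conjI allI impI)
      show "(\<lambda>(c, x). c *\<^sub>R x) \<in> topspace (prod_topology euclideanreal ?T) \<rightarrow> topspace ?T"
        using X by (auto intro: subspace_scale)
      fix U assume U: "openin ?T U"
      show "openin (prod_topology euclideanreal ?T)
        {z \<in> topspace (prod_topology euclideanreal ?T). (case z of (c, x) \<Rightarrow> c *\<^sub>R x) \<in> U}"
        unfolding openin_prod_topology_alt
      proof (intro allI impI)
        fix c :: real and x
        assume "(c, x) \<in> {z \<in> topspace (prod_topology euclideanreal ?T). (case z of (c, x) \<Rightarrow> c *\<^sub>R x) \<in> U}"
        then have cx: "x \<in> X" "c *\<^sub>R x \<in> U" by auto
        then obtain e where e: "e > 0" "\<And>z. z \<in> X \<Longrightarrow> p (z - c *\<^sub>R x) < e \<Longrightarrow> z \<in> U"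
          using U unfolding op by blast
        \<comment> \<open>\<open>d\<close> and \<open>h\<close> make each of the two parts of
          \<open>b *\<^sub>R y - c *\<^sub>R x\<close> contribute at most \<open>e / 2\<close>; the
          summands \<open>+ 1\<close> avoid division by zero, and \<open>d \<le> 1\<close> bounds
          \<open>\<bar>b\<bar>\<close> by \<open>\<bar>c\<bar> + 1\<close>.\<close>
        define d where "d = min 1 (e / (2 * (p x + 1)))"
        define h where "h = e / (2 * (\<bar>c\<bar> + 1))"
        have px: "p x \<ge> 0" using seminorm_onD(1)[OF p] cx by blast
        have "d > 0" "h > 0" using e px unfolding d_def h_def by auto
        have "b *\<^sub>R y \<in> U" if "y \<in> X" "\<bar>b - c\<bar> < d" "p (y - x) < h" for b y
        proof (rule e(2))
          show "b *\<^sub>R y \<in> X" using that X by (auto intro: subspace_scale)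
          have yx: "y - x \<in> X" using that cx X by (auto intro: subspace_diff)
          have "p (b *\<^sub>R y - c *\<^sub>R x) = p (b *\<^sub>R (y - x) + (b - c) *\<^sub>R x)" by (simp add: algebra_simps)
          also have "\<dots> \<le> p (b *\<^sub>R (y - x)) + p ((b - c) *\<^sub>R x)"
            using yx cx X by (intro seminorm_onD(2)[OF p]) (auto intro: subspace_scale)
          also have "\<dots> = \<bar>b\<bar> * p (y - x) + \<bar>b - c\<bar> * p x"
            using seminorm_onD(3)[OF p] yx cx by simp
          also have "\<bar>b\<bar> * p (y - x) \<le> (\<bar>c\<bar> + 1) * p (y - x)"
            using that seminorm_onD(1)[OF p yx] unfolding d_def by (intro mult_right_mono) auto
          also have "(\<bar>c\<bar> + 1) * p (y - x) < (\<bar>c\<bar> + 1) * h"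
            using that by (intro mult_strict_left_mono) auto
          also have "(\<bar>c\<bar> + 1) * h = e / 2" unfolding h_def by (simp add: field_simps)
          also have "\<bar>b - c\<bar> * p x \<le> (e / (2 * (p x + 1))) * (p x + 1)"
            using that px e unfolding d_def by (intro mult_mono) auto
          also have "\<dots> = e / 2" using px by (simp add: field_simps)
          finally show "p (b *\<^sub>R y - c *\<^sub>R x) < e" by simp
        qed
        moreover have "openin euclideanreal {b. \<bar>b - c\<bar> < d}"
          using open_ball[of c d] by (simp add: ball_def dist_real_def abs_minus_commute)
        ultimately show "\<exists>V W. openin euclideanreal V \<and> openin ?T W \<and> c \<in> V \<and> x \<in> W \<and>
            V \<times> W \<subseteq> {z \<in> topspace (prod_topology euclideanreal ?T). (case z of (c, x) \<Rightarrow> c *\<^sub>R x) \<in> U}"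
          using ball cx p0 \<open>d > 0\<close> \<open>h > 0\<close>
          by (intro exI[of _ "{b. \<bar>b - c\<bar> < d}"] exI[of _ "{z \<in> X. p (z - x) < h}"]) auto
      qed
    qed
    fix U assume U: "openin ?T U \<and> 0 \<in> U"
    then obtain e where "e > 0" "\<And>y. y \<in> X \<Longrightarrow> p (y - 0) < e \<Longrightarrow> y \<in> U" unfolding op by blast
    then show "\<exists>V. openin ?T V \<and> convex V \<and> 0 \<in> V \<and> V \<subseteq> U"
      using ball[of 0 e] cball[of e] subspace_0[OF X] p0
      by (intro exI[of _ "{y \<in> X. p (y - 0) < e}"]) auto
  qed (use X in auto)
qed

text \<open>If every point of \<open>K\<close> had a neighbourhood that the sequence eventually
  leaves, a finite subcover would leave no room for a late term. No countability of the topology is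
  involved, so only a cluster point, not a convergent subsequence, is obtained.\<close>

lemma cluster_point_compactin:
  fixes x :: "nat \<Rightarrow> 'a"
  assumes K: "compactin T K" and x: "\<And>n. x n \<in> K"
  obtains y where "y \<in> K" "\<And>U N. openin T U \<Longrightarrow> y \<in> U \<Longrightarrow> \<exists>n\<ge>N. x n \<in> U"
proof (rule ccontr)
  assume "\<not> thesis"
  with that have "\<forall>y\<in>K. \<exists>U N. openin T U \<and> y \<in> U \<and> (\<forall>n\<ge>N. x n \<notin> U)" by metis
  then obtain U N where U: "\<And>y. y \<in> K \<Longrightarrow> openin T (U y) \<and> y \<in> U y \<and> (\<forall>n\<ge>N y. x n \<notin> U y)"
    by metis
  have "\<exists>\<F>. finite \<F> \<and> \<F> \<subseteq> U ` K \<and> K \<subseteq> \<Union>\<F>"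
    by (rule compactinD[OF K]) (use U in auto)
  then obtain A where A: "finite A" "A \<subseteq> K" "K \<subseteq> \<Union>(U ` A)"
    by (metis finite_subset_image)
  define n where "n = Max (N ` A)"
  obtain y where y: "y \<in> A" "x n \<in> U y" using A(3) x[of n] by blast
  have "N y \<le> n" unfolding n_def using A y by auto
  then show False using U[of y] y A by blast
qed

section \<open>Locally convex spaces, their duals and weak topologies\<close>

locale lcs =
  fixes X :: "'v::real_vector set" and \<tau> Q
  assumes lcs: "locally_convex_space X \<tau>" and det: "determined_by_seminorms X \<tau> Q"
begin

abbreviation "dual \<equiv> continuous_functionals X \<tau>"
abbreviation "weak \<equiv> weak_topology X \<tau>"

lemma subspace_X: "subspace X"
  using lcs unfolding locally_convex_space_def by blast

lemma topspace_tau [simp]: "topspace \<tau> = X"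
  using lcs unfolding locally_convex_space_def by blast

lemma diff_in [intro, simp]: "x \<in> X \<Longrightarrow> y \<in> X \<Longrightarrow> x - y \<in> X"
  using subspace_X by (rule subspace_diff)

lemma add_in [intro, simp]: "x \<in> X \<Longrightarrow> y \<in> X \<Longrightarrow> x + y \<in> X"
  using subspace_X by (rule subspace_add)

lemma scale_in [intro, simp]: "x \<in> X \<Longrightarrow> c *\<^sub>R x \<in> X"
  using subspace_X by (rule subspace_scale)

lemma zero_in [simp]: "0 \<in> X"
  using subspace_X by (rule subspace_0)

lemma seminorm: "p \<in> Q \<Longrightarrow> seminorm_on X p"
  using det unfolding determined_by_seminorms_def by blast

lemma tau_eq: "\<tau> = seminorm_topology X Q"
  using det unfolding determined_by_seminorms_def by blast

lemma openin_tau: "openin \<tau> U \<longleftrightarrow>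
    U \<subseteq> X \<and> (\<forall>x\<in>U. \<exists>P e. finite P \<and> P \<subseteq> Q \<and> 0 < e \<and> seminorm_ball X P x e \<subseteq> U)"
  unfolding tau_eq by (rule openin_seminorm_topology[OF subspace_X seminorm])

text \<open>A point at which all of \<open>Q\<close> vanishes lies in every neighbourhood of
  \<open>0\<close>, against the Hausdorff property.\<close>

lemma seminorm_separates:
  assumes x: "x \<in> X" "x \<noteq> 0"
  obtains p where "p \<in> Q" "p x > 0"
proof (rule ccontr)
  assume "\<not> thesis"
  with that have zero: "p x = 0" if "p \<in> Q" for p
    using that seminorm_onD(1)[OF seminorm[OF that] x(1)] by fastforce
  have "Hausdorff_space \<tau>" using lcs unfolding locally_convex_space_def by blast
  then obtain U V where U: "openin \<tau> U" "openin \<tau> V" "0 \<in> U" "x \<in> V" "disjnt U V"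
    unfolding Hausdorff_space_def topspace_tau using x zero_in by metis
  then obtain P e where P: "P \<subseteq> Q" "0 < e" "seminorm_ball X P 0 e \<subseteq> U" unfolding openin_tau by meson
  then have "x \<in> seminorm_ball X P 0 e" using x zero by (force simp: seminorm_ball_def)
  with P U show False by (auto simp: disjnt_iff)
qed

lemma dual_add: "f \<in> dual \<Longrightarrow> x \<in> X \<Longrightarrow> y \<in> X \<Longrightarrow> f (x + y) = f x + f y"
  unfolding continuous_functionals_def by blast

lemma dual_scale: "f \<in> dual \<Longrightarrow> x \<in> X \<Longrightarrow> f (c *\<^sub>R x) = c * f x"
  unfolding continuous_functionals_def by blast

lemma dual_diff: "f \<in> dual \<Longrightarrow> x \<in> X \<Longrightarrow> y \<in> X \<Longrightarrow> f (x - y) = f x - f y"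
  using dual_add[of f "x - y" y] by simp

lemma dual_zero: "f \<in> dual \<Longrightarrow> f 0 = 0"
  using dual_diff[of f 0 0] by simp

lemma dual_seminorm: "f \<in> dual \<Longrightarrow> seminorm_on X (\<lambda>x. \<bar>f x\<bar>)"
  unfolding seminorm_on_def by (auto simp: dual_add dual_scale abs_mult)

lemma dominated_in_dual:
  assumes f: "linear f" and le: "\<And>z. z \<in> X \<Longrightarrow> f z \<le> p z" and p: "p \<in> Q"
  shows "f \<in> dual"
proof -
  have abs: "\<bar>f z\<bar> \<le> p z" if "z \<in> X" for z
    using le[OF that] le[of "- z"] subspace_neg[OF subspace_X that] seminorm_on_minus[OF seminorm[OF p] that]
      linear_neg[OF f] by force
  have "continuous_map \<tau> euclideanreal f"
    unfolding continuous_map_def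
  proof (intro conjI allI impI)
    fix U :: "real set" assume "openin euclideanreal U"
    then have U: "open U" by simp
    show "openin \<tau> {x \<in> topspace \<tau>. f x \<in> U}"
      unfolding openin_tau
    proof (intro conjI ballI)
      fix x assume "x \<in> {x \<in> topspace \<tau>. f x \<in> U}"
      then have x: "x \<in> X" "f x \<in> U" by auto
      then obtain e where e: "e > 0" "\<And>r. \<bar>r - f x\<bar> < e \<Longrightarrow> r \<in> U"
        using U unfolding open_dist dist_real_def by blast
      have "f y \<in> U" if "y \<in> X" "p (y - x) < e" for y
        using abs[of "y - x"] that x by (intro e(2)) (simp add: linear_diff[OF f])
      then show "\<exists>P e. finite P \<and> P \<subseteq> Q \<and> 0 < e \<and> seminorm_ball X P x e \<subseteq> {x \<in> topspace \<tau>. f x \<in> U}"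
        using e p by (intro exI[of _ "{p}"] exI[of _ e]) (auto simp: seminorm_ball_def)
    qed auto
  qed simp
  then show ?thesis
    unfolding continuous_functionals_def by (auto simp: linear_add[OF f] linear_scale[OF f])
qed

text \<open>Separation of \<open>x\<close> from the convex set \<open>{0}\<close>, which lies at
  \<open>p\<close>-distance \<open>p x\<close>.\<close>

lemma norming_functional:
  assumes p: "p \<in> Q" and x: "x \<in> X"
  obtains f where "f \<in> dual" "\<And>z. z \<in> X \<Longrightarrow> f z \<le> p z" "f x = p x"
proof -
  obtain f where f: "linear f" "\<And>z. z \<in> X \<Longrightarrow> f z \<le> p z" "\<And>c. c \<in> {0} \<Longrightarrow> f c \<le> f x - p x"
    by (rule separate_convex[OF subspace_X seminorm[OF p], of "{0}" x "p x"])
      (use x seminorm_onD(1)[OF seminorm[OF p]] seminorm_on_minus[OF seminorm[OF p]] in auto)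
  have "f x = p x" using f(2)[OF x] f(3)[of 0] linear_0[OF f(1)] by simp
  with f dominated_in_dual[OF f(1) _ p] that show thesis by blast
qed

lemma dual_separates:
  assumes x: "x \<in> X" and "\<And>f. f \<in> dual \<Longrightarrow> f x = 0"
  shows "x = 0"
proof (rule ccontr)
  assume "x \<noteq> 0"
  then obtain p where "p \<in> Q" "p x > 0" using x seminorm_separates by blast
  then obtain f where "f \<in> dual" "f x = p x" using norming_functional[of p x] x by blast
  with assms(2)[of f] \<open>p x > 0\<close> show False by simp
qed

text \<open>Presents the weak topology as a seminorm topology, so that the neighbourhood criterion
  becomes available for it as well.\<close>

lemma weak_eq: "weak = seminorm_topology X ((\<lambda>f x. \<bar>f x\<bar>) ` dual)"
proof -
  let ?Q = "(\<lambda>f x. \<bar>f x\<bar>) ` dual"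
  have sem: "seminorm_on X p" if "p \<in> ?Q" for p using that dual_seminorm by auto
  have op: "openin (seminorm_topology X ?Q) U \<longleftrightarrow>
      U \<subseteq> X \<and> (\<forall>x\<in>U. \<exists>P e. finite P \<and> P \<subseteq> ?Q \<and> 0 < e \<and> seminorm_ball X P x e \<subseteq> U)" for U
    by (rule openin_seminorm_topology[OF subspace_X sem])
  have zero: "(\<lambda>x. 0) \<in> dual" unfolding continuous_functionals_def by simp
  let ?G = "{{x \<in> X. f x \<in> U} | f U. f \<in> dual \<and> open U}"
  have "openin weak U" if "openin (seminorm_topology X ?Q) U" for U
  proof -
    have *: "openin weak S" if S: "S \<in> insert X {{y \<in> X. p (y - x) < e} | p x e. p \<in> ?Q \<and> x \<in> X \<and> 0 < e}" for S
    proof -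
      have "S \<in> ?G"
      proof (cases "S = X")
        case True
        then have "S = {x \<in> X. (\<lambda>x. 0) x \<in> (UNIV :: real set)}" by simp
        with zero show ?thesis by blast
      next
        case False
        then obtain f x e where f: "S = {y \<in> X. \<bar>f (y - x)\<bar> < e}" "f \<in> dual" "x \<in> X" using S by auto
        then have "S = {y \<in> X. f y \<in> ball (f x) e}"
          by (auto simp: dual_diff dist_real_def abs_minus_commute)
        with f(2) show ?thesis by blast
      qed
      then show ?thesis unfolding weak_topology_def by (rule topology_generated_by_Basis)
    qed
    show ?thesis
      by (rule generate_topology_on_coarsest[OF istopology_openin *
          that[unfolded seminorm_topology_def openin_topology_generated_by_iff]])
  qed
  moreover have "openin (seminorm_topology X ?Q) U" if "openin weak U" for U
  proof -
    have *: "openin (seminorm_topology X ?Q) S" if S: "S \<in> ?G" for S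
    proof -
      from S obtain f U where f: "S = {x \<in> X. f x \<in> U}" "f \<in> dual" "open U" by blast
      show ?thesis
        unfolding op
      proof (intro conjI ballI)
        fix x assume "x \<in> S"
        then have x: "x \<in> X" "f x \<in> U" using f by auto
        then obtain e where e: "e > 0" "\<And>r. \<bar>r - f x\<bar> < e \<Longrightarrow> r \<in> U"
          using f(3) unfolding open_dist dist_real_def by blast
        have "y \<in> S" if "y \<in> X" "\<bar>f (y - x)\<bar> < e" for y
          using e(2)[of "f y"] that x f by (auto simp: dual_diff)
        then show "\<exists>P e. finite P \<and> P \<subseteq> ?Q \<and> 0 < e \<and> seminorm_ball X P x e \<subseteq> S"
          using e f by (intro exI[of _ "{\<lambda>x. \<bar>f x\<bar>}"] exI[of _ e]) (auto simp: seminorm_ball_def)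
      qed (use f in auto)
    qed
    show ?thesis
      by (rule generate_topology_on_coarsest[OF istopology_openin *
          that[unfolded weak_topology_def openin_topology_generated_by_iff]])
  qed
  ultimately show ?thesis unfolding topology_eq by blast
qed

lemma topspace_weak [simp]: "topspace weak = X"
  unfolding weak_eq by simp

lemma openin_weak: "openin weak U \<longleftrightarrow>
    U \<subseteq> X \<and> (\<forall>x\<in>U. \<exists>\<Phi> e. finite \<Phi> \<and> \<Phi> \<subseteq> dual \<and> 0 < e \<and> (\<forall>y\<in>X. (\<forall>f\<in>\<Phi>. \<bar>f (y - x)\<bar> < e) \<longrightarrow> y \<in> U))"
proof -
  have "(\<exists>P e. finite P \<and> P \<subseteq> (\<lambda>f x. \<bar>f x\<bar>) ` dual \<and> 0 < e \<and> seminorm_ball X P x e \<subseteq> U) \<longleftrightarrow>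
    (\<exists>\<Phi> e. finite \<Phi> \<and> \<Phi> \<subseteq> dual \<and> 0 < e \<and> (\<forall>y\<in>X. (\<forall>f\<in>\<Phi>. \<bar>f (y - x)\<bar> < e) \<longrightarrow> y \<in> U))" (is "?L \<longleftrightarrow> ?R") for x
  proof
    assume ?L
    then obtain P e where P: "finite P" "P \<subseteq> (\<lambda>f x. \<bar>f x\<bar>) ` dual" "0 < e" "seminorm_ball X P x e \<subseteq> U" by blast
    then obtain \<Phi> where "\<Phi> \<subseteq> dual" "finite \<Phi>" "P = (\<lambda>f x. \<bar>f x\<bar>) ` \<Phi>"
      by (metis finite_subset_image)
    with P show ?R by (intro exI[of _ \<Phi>] exI[of _ e]) (auto simp: seminorm_ball_def)
  next
    assume ?R
    then obtain \<Phi> e where "finite \<Phi>" "\<Phi> \<subseteq> dual" "0 < e" "\<forall>y\<in>X. (\<forall>f\<in>\<Phi>. \<bar>f (y - x)\<bar> < e) \<longrightarrow> y \<in> U" by blast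
    then show ?L
      by (intro exI[of _ "(\<lambda>f x. \<bar>f x\<bar>) ` \<Phi>"] exI[of _ e]) (auto simp: seminorm_ball_def)
  qed
  moreover have "seminorm_on X p" if "p \<in> (\<lambda>f x. \<bar>f x\<bar>) ` dual" for p using that dual_seminorm by auto
  ultimately show ?thesis unfolding weak_eq by (subst openin_seminorm_topology[OF subspace_X]) auto
qed

lemma continuous_weak: "f \<in> dual \<Longrightarrow> continuous_map weak euclideanreal f"
proof -
  assume f: "f \<in> dual"
  have "openin weak {x \<in> X. f x \<in> U}" if "open U" for U
    unfolding weak_topology_def by (rule topology_generated_by_Basis) (use f that in blast)
  then show ?thesis unfolding continuous_map_def by auto
qed

lemma openin_weak_functional: "f \<in> dual \<Longrightarrow> open U \<Longrightarrow> openin weak {x \<in> X. f x \<in> U}"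
  using openin_continuous_map_preimage[OF continuous_weak, of f U] by simp

lemma openin_weak_ball:
  assumes "finite \<Phi>" "\<Phi> \<subseteq> dual" "x \<in> X"
  shows "openin weak {y \<in> X. \<forall>f\<in>\<Phi>. \<bar>f (y - x)\<bar> < e}"
proof -
  have "openin weak (X \<inter> \<Inter>((\<lambda>f. {y \<in> X. f y \<in> ball (f x) e}) ` \<Phi>))"
    using assms by (intro openin_Int_Inter) (auto intro!: openin_weak_functional simp: openin_topspace[of weak, simplified] simp del: mem_ball)
  also have "X \<inter> \<Inter>((\<lambda>f. {y \<in> X. f y \<in> ball (f x) e}) ` \<Phi>) = {y \<in> X. \<forall>f\<in>\<Phi>. \<bar>f (y - x)\<bar> < e}"
    using assms by (auto simp: dual_diff dist_real_def abs_minus_commute subset_iff)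
  finally show ?thesis .
qed

lemma openin_weak_imp_tau: "openin weak U \<Longrightarrow> openin \<tau> U"
proof -
  assume U: "openin weak U"
  have *: "openin \<tau> S" if "S \<in> {{x \<in> X. f x \<in> U} | f U. f \<in> dual \<and> open U}" for S
  proof -
    from that obtain f V where S: "S = {x \<in> X. f x \<in> V}" "f \<in> dual" "open V" by blast
    then have "continuous_map \<tau> euclideanreal f" unfolding continuous_functionals_def by blast
    from openin_continuous_map_preimage[OF this, of V] S show ?thesis by simp
  qed
  show ?thesis
    by (rule generate_topology_on_coarsest[OF istopology_openin *
        U[unfolded weak_topology_def openin_topology_generated_by_iff]])
qed

lemma Hausdorff_weak: "Hausdorff_space weak"
  unfolding Hausdorff_space_def
proof (intro allI impI)
  fix x y assume xy: "x \<in> topspace weak \<and> y \<in> topspace weak \<and> x \<noteq> y"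
  then have "x - y \<in> X" "x - y \<noteq> 0" by auto
  then obtain f where f: "f \<in> dual" "f (x - y) \<noteq> 0" using dual_separates by blast
  then have "f x \<noteq> f y" using xy by (simp add: dual_diff)
  then obtain U V where "open U" "open V" "f x \<in> U" "f y \<in> V" "U \<inter> V = {}"
    using separation_t2[of "f x" "f y"] by auto
  then show "\<exists>U V. openin weak U \<and> openin weak V \<and> x \<in> U \<and> y \<in> V \<and> disjnt U V"
    using xy by - (rule exI[of _ "{x \<in> X. f x \<in> U}"], intro exI[of _ "{x \<in> X. f x \<in> V}"], auto simp: disjnt_iff intro!: openin_weak_functional f)
qed

text \<open>This is weak lower semicontinuity of \<open>p\<close>: a functional norming
  \<open>x - z\<close> and dominated by \<open>p\<close> keeps a weak neighbourhood of
  \<open>z\<close> outside the ball.\<close>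

lemma closedin_weak_seminorm_ball:
  assumes p: "p \<in> Q" and x: "x \<in> X"
  shows "closedin weak {z \<in> X. p (x - z) \<le> r}"
  unfolding closedin_def
proof (intro conjI)
  show "openin weak (topspace weak - {z \<in> X. p (x - z) \<le> r})"
  proof (subst openin_subopen, intro ballI)
    fix z assume "z \<in> topspace weak - {z \<in> X. p (x - z) \<le> r}"
    then have z: "z \<in> X" "p (x - z) > r" by auto
    then obtain f where f: "f \<in> dual" "\<And>z. z \<in> X \<Longrightarrow> f z \<le> p z" "f (x - z) = p (x - z)"
      using norming_functional[OF p, of "x - z"] x by blast
    have "openin weak {y \<in> X. f y \<in> {..<f x - r}}" by (rule openin_weak_functional[OF f(1)]) simp
    moreover have "z \<in> {y \<in> X. f y \<in> {..<f x - r}}" using z f x by (simp add: dual_diff)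
    moreover have "{y \<in> X. f y \<in> {..<f x - r}} \<subseteq> topspace weak - {z \<in> X. p (x - z) \<le> r}"
    proof
      fix y assume "y \<in> {y \<in> X. f y \<in> {..<f x - r}}"
      then show "y \<in> topspace weak - {z \<in> X. p (x - z) \<le> r}"
        using f(2)[of "x - y"] x f(1) by (auto simp: dual_diff)
    qed
    ultimately show "\<exists>T. openin weak T \<and> z \<in> T \<and> T \<subseteq> topspace weak - {z \<in> X. p (x - z) \<le> r}" by blast
  qed
qed auto

text \<open>Mazur's theorem for a single seminorm: a convex set at positive
  \<open>p\<close>-distance from \<open>x\<close> is cut off from \<open>x\<close> by a weakly open
  half-space.\<close>

lemma weak_closure_convex:
  assumes p: "p \<in> Q" and C: "convex C" "C \<subseteq> X" and x: "x \<in> weak closure_of C" and d: "d > 0"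
  shows "\<exists>c\<in>C. p (c - x) < d"
proof (rule ccontr)
  assume "\<not> (\<exists>c\<in>C. p (c - x) < d)"
  then have far: "d \<le> p (c - x)" if "c \<in> C" for c using that by force
  have xX: "x \<in> X" using x by (auto simp: closure_of_def)
  obtain f where f: "linear f" "\<And>z. z \<in> X \<Longrightarrow> f z \<le> p z" "\<And>c. c \<in> C \<Longrightarrow> f c \<le> f x - d"
    by (rule separate_convex[OF subspace_X seminorm[OF p] C xX _ far]) (use d in auto)
  have fd: "f \<in> dual" using f p by (intro dominated_in_dual)
  have "openin weak {y \<in> X. f y \<in> {f x - d<..}}" by (rule openin_weak_functional[OF fd]) simp
  moreover have "x \<in> {y \<in> X. f y \<in> {f x - d<..}}" using xX d by simp
  ultimately have "\<exists>c. c \<in> C \<and> c \<in> {y \<in> X. f y \<in> {f x - d<..}}"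
    using x unfolding in_closure_of by metis
  then obtain c where "c \<in> C" "f c > f x - d" by auto
  with f(3)[of c] show False by simp
qed

end

subsection \<open>Minimal sets and precompactness\<close>

text \<open>Zorn's lemma, where compactness keeps intersections of chains nonempty. The family is
  left abstract because it is used both for invariant sets and for convex invariant sets.\<close>

lemma minimal_closed_set:
  assumes K: "compactin T K" and ne: "\<C> \<noteq> {}"
    and closed: "\<And>C. C \<in> \<C> \<Longrightarrow> closedin T C \<and> C \<subseteq> K \<and> C \<noteq> {}"
    and Inter: "\<And>\<D>. \<D> \<subseteq> \<C> \<Longrightarrow> \<D> \<noteq> {} \<Longrightarrow> \<Inter>\<D> \<noteq> {} \<Longrightarrow> \<Inter>\<D> \<in> \<C>"
  obtains M where "M \<in> \<C>" "\<And>C. C \<in> \<C> \<Longrightarrow> C \<subseteq> M \<Longrightarrow> C = M"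
proof -
  let ?P = "\<lambda>A B :: 'a set. B \<subseteq> A"
  have "\<exists>m\<in>\<C>. \<forall>a\<in>\<C>. ?P m a \<longrightarrow> a = m"
  proof (rule predicate_Zorn)
    show "partial_order_on \<C> (relation_of ?P \<C>)"
      by (rule partial_order_on_relation_ofI) auto
    fix \<D> assume "\<D> \<in> Chains (relation_of ?P \<C>)"
    then have sub: "\<D> \<subseteq> \<C>" and chain: "\<And>A B. A \<in> \<D> \<Longrightarrow> B \<in> \<D> \<Longrightarrow> A \<subseteq> B \<or> B \<subseteq> A"
      unfolding Chains_def relation_of_def by blast+
    show "\<exists>u\<in>\<C>. \<forall>a\<in>\<D>. ?P a u"
    proof (cases "\<D> = {}")
      case True
      then show ?thesis using ne by blast
    next
      case False
      have fin: "K \<inter> \<Inter>\<F> \<noteq> {}" if \<F>: "finite \<F>" "\<F> \<subseteq> \<D>" for \<F>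
      proof (cases "\<F> = {}")
        case True
        then show ?thesis using False closed sub by blast
      next
        case False
        then obtain m where m: "m \<in> \<F>" "\<And>b. b \<in> \<F> \<Longrightarrow> b \<subseteq> m \<Longrightarrow> m = b"
          using finite_has_minimal[OF \<F>(1)] by auto
        have "m \<subseteq> b" if "b \<in> \<F>" for b
          using chain[of m b] m(2)[OF that] that m(1) \<F>(2) by blast
        then have "m \<subseteq> \<Inter>\<F>" by blast
        moreover have "m \<subseteq> K" "m \<noteq> {}" using closed m(1) \<F>(2) sub by auto
        ultimately show ?thesis by blast
      qed
      have "K \<inter> \<Inter>\<D> \<noteq> {}"
        using K fin closed sub unfolding compactin_fip by blast
      then have "\<Inter>\<D> \<in> \<C>" using Inter[OF sub False] by blast
      then show ?thesis by blast
    qed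
  qed
  then show thesis using that by blast
qed

text \<open>Sets of small diameter replace balls, so that preimages of one small slice under
  translations form a cover without a choice of centres.\<close>

definition seminorm_precompact :: "('v::real_vector \<Rightarrow> real) \<Rightarrow> 'v set \<Rightarrow> bool" where
  "seminorm_precompact p A \<longleftrightarrow>
     (\<forall>e>0. \<exists>\<V>. finite \<V> \<and> A \<subseteq> \<Union>\<V> \<and> (\<forall>V\<in>\<V>. \<forall>x\<in>V \<inter> A. \<forall>y\<in>V \<inter> A. p (x - y) \<le> e))"

lemma seminorm_precompact_subset:
  assumes "seminorm_precompact p B" "A \<subseteq> B"
  shows "seminorm_precompact p A"
  unfolding seminorm_precompact_def
proof (intro allI impI)
  fix e :: real assume "e > 0"
  with assms(1) obtain \<V> where \<V>: "finite \<V>" "B \<subseteq> \<Union>\<V>" "\<forall>V\<in>\<V>. \<forall>x\<in>V \<inter> B. \<forall>y\<in>V \<inter> B. p (x - y) \<le> e"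
    unfolding seminorm_precompact_def by metis
  have "A \<subseteq> \<Union>\<V>" "\<forall>V\<in>\<V>. \<forall>x\<in>V \<inter> A. \<forall>y\<in>V \<inter> A. p (x - y) \<le> e"
    using \<V>(2,3) assms(2) by fast+
  with \<V>(1) show "\<exists>\<V>. finite \<V> \<and> A \<subseteq> \<Union>\<V> \<and> (\<forall>V\<in>\<V>. \<forall>x\<in>V \<inter> A. \<forall>y\<in>V \<inter> A. p (x - y) \<le> e)"
    by (intro exI[of _ \<V>]) blast
qed

text \<open>The centre is the mean of a finite \<open>M/2\<close>-net; every point of \<open>A\<close> is within \<open>M/2\<close> of one
  point of the net and within \<open>M\<close> of all others.\<close>

lemma precompact_center:
  assumes X: "subspace X" and p: "seminorm_on X p" and A: "A \<subseteq> X" "A \<noteq> {}" "seminorm_precompact p A"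
    and M: "M > 0" "\<And>x y. x \<in> A \<Longrightarrow> y \<in> A \<Longrightarrow> p (x - y) \<le> M"
  obtains u r where "u \<in> convex hull A" "r < M" "\<And>x. x \<in> A \<Longrightarrow> p (x - u) \<le> r"
proof -
  obtain \<V> where \<V>: "finite \<V>" "A \<subseteq> \<Union>\<V>" "\<And>V x y. V \<in> \<V> \<Longrightarrow> x \<in> V \<inter> A \<Longrightarrow> y \<in> V \<inter> A \<Longrightarrow> p (x - y) \<le> M / 2"
    using A(3) M(1) unfolding seminorm_precompact_def by (metis half_gt_zero)
  define N where "N = (\<lambda>V. SOME x. x \<in> V \<inter> A) ` {V \<in> \<V>. V \<inter> A \<noteq> {}}"
  have some: "(SOME x. x \<in> V \<inter> A) \<in> V \<inter> A" if "V \<inter> A \<noteq> {}" for V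
    using that by (auto intro!: someI_ex[of "\<lambda>x. x \<in> V \<inter> A"] simp only: ex_in_conv)
  have NA: "N \<subseteq> A" unfolding N_def using some by blast
  have fin: "finite N" unfolding N_def using \<V>(1) by simp
  have net: "\<exists>a\<in>N. p (x - a) \<le> M / 2" if xA: "x \<in> A" for x
  proof -
    obtain V where V: "V \<in> \<V>" "x \<in> V" using \<V>(2) xA by blast
    then have "V \<inter> A \<noteq> {}" using xA by blast
    then have "p (x - (SOME x. x \<in> V \<inter> A)) \<le> M / 2" using \<V>(3)[OF V(1)] V(2) xA some by blast
    then show ?thesis unfolding N_def using V \<open>V \<inter> A \<noteq> {}\<close> by blast
  qed
  have "N \<noteq> {}" using net A(2) by blast
  define n where "n = real (card N)"
  have n: "n > 0" unfolding n_def using fin \<open>N \<noteq> {}\<close> by (simp add: card_gt_0_iff)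
  define u where "u = (\<Sum>a\<in>N. (1 / n) *\<^sub>R a)"
  have "u \<in> convex hull N"
    unfolding u_def using n hull_subset[of N convex]
    by (intro convex_sum) (auto simp: fin convex_convex_hull n_def)
  then have "u \<in> convex hull A" using hull_mono[OF NA] by blast
  \<comment> \<open>The average of one bound \<open>M / 2\<close> and \<open>n - 1\<close> bounds
    \<open>M\<close>.\<close>
  moreover have "M * (1 - 1 / (2 * n)) < M" using M(1) n by (simp add: field_simps)
  moreover have "p (x - u) \<le> M * (1 - 1 / (2 * n))" if xA: "x \<in> A" for x
  proof -
    obtain a where a: "a \<in> N" "p (x - a) \<le> M / 2" using net[OF xA] by blast
    have dif: "x - b \<in> X" if "b \<in> N" for b using that \<open>x \<in> A\<close> NA A(1) X by (auto intro: subspace_diff)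
    have sum: "p (\<Sum>b\<in>B. x - b) \<le> (\<Sum>b\<in>B. p (x - b)) \<and> (\<Sum>b\<in>B. x - b) \<in> X" if "finite B" "B \<subseteq> N" for B
      using that
    proof (induction B rule: finite_induct)
      case empty
      then show ?case using X by (simp add: subspace_0 seminorm_on_zero[OF p X])
    next
      case (insert b B)
      then have "p ((x - b) + (\<Sum>b\<in>B. x - b)) \<le> p (x - b) + p (\<Sum>b\<in>B. x - b)"
        by (intro seminorm_onD(2)[OF p] dif) auto
      then show ?case using insert X dif[of b] by (auto intro: subspace_add)
    qed
    have "x = (\<Sum>b\<in>N. (1 / n) *\<^sub>R x)"
      using n by (simp add: n_def flip: scaleR_sum_left)
    then have "x - u = (\<Sum>b\<in>N. (1 / n) *\<^sub>R (x - b))"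
      unfolding u_def by (simp add: sum_subtractf scaleR_diff_right)
    also have "\<dots> = (1 / n) *\<^sub>R (\<Sum>b\<in>N. x - b)" by (simp add: scaleR_sum_right)
    finally have "p (x - u) = (1 / n) * p (\<Sum>b\<in>N. x - b)"
      using seminorm_onD(3)[OF p conjunct2[OF sum[OF fin subset_refl]], of "1 / n"] n by simp
    also have "\<dots> \<le> (1 / n) * (\<Sum>b\<in>N. p (x - b))"
      using sum[OF fin subset_refl] n by (intro mult_left_mono) auto
    also have "(\<Sum>b\<in>N. p (x - b)) = p (x - a) + (\<Sum>b\<in>N - {a}. p (x - b))"
      using a fin by (simp add: sum.remove)
    also have "(1 / n) * \<dots> \<le> (1 / n) * (M / 2 + (\<Sum>b\<in>N - {a}. M))"
      using a n NA \<open>x \<in> A\<close> by (intro mult_left_mono add_mono sum_mono M(2)) auto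
    also have "\<dots> = (1 / n) * (M / 2 + (n - 1) * M)"
      using card.remove[OF fin a(1)] by (simp add: n_def)
    also have "\<dots> = M * (1 - 1 / (2 * n))" using n by (simp add: field_simps)
    finally show ?thesis .
  qed
  ultimately show thesis using that by blast
qed

subsection \<open>Weakly compact sets have small slices\<close>

context lcs begin

lemma p_triangle: "p \<in> Q \<Longrightarrow> x \<in> X \<Longrightarrow> y \<in> X \<Longrightarrow> z \<in> X \<Longrightarrow> p (x - z) \<le> p (x - y) + p (y - z)"
  using seminorm_on_diff_triangle[OF seminorm subspace_X] .

lemma p_commute: "p \<in> Q \<Longrightarrow> x \<in> X \<Longrightarrow> y \<in> X \<Longrightarrow> p (x - y) = p (y - x)"
  using seminorm_on_diff_commute[OF seminorm subspace_X] .

text \<open>Otherwise one splits weakly open sets along a binary tree, choosing a point of \<open>F\<close> in each.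
  The branches yield uncountably many cluster points, any two at \<open>p\<close>-distance at least \<open>e\<close>, all
  in the \<open>p\<close>-separable closed span of the countably many chosen points.\<close>

lemma small_weak_slice:
  assumes F: "compactin weak F" "F \<noteq> {}" and p: "p \<in> Q" and e: "e > 0"
  obtains V where "openin weak V" "V \<inter> F \<noteq> {}" "\<And>x y. x \<in> V \<inter> F \<Longrightarrow> y \<in> V \<inter> F \<Longrightarrow> p (x - y) \<le> e"
proof (rule ccontr)
  assume "\<not> thesis"
  with that have big: "\<exists>x\<in>V \<inter> F. \<exists>y\<in>V \<inter> F. e < p (x - y)" if "openin weak V" "V \<inter> F \<noteq> {}" for V
    using that by (metis not_le)
  have FX: "F \<subseteq> X" using compactin_subset_topspace[OF F(1)] by simp
  define good where "good V \<longleftrightarrow> openin weak V \<and> V \<inter> F \<noteq> {}" for V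
  have "\<exists>W f c. good (W True) \<and> good (W False) \<and> W True \<subseteq> V \<and> W False \<subseteq> V \<and>
      f \<in> dual \<and> (\<forall>z\<in>X. f z \<le> p z) \<and> (\<forall>z\<in>W True. c + e \<le> f z) \<and> (\<forall>z\<in>W False. f z \<le> c)"
    if V: "good V" for V
  proof -
    obtain x y where xy: "x \<in> V \<inter> F" "y \<in> V \<inter> F" "e < p (x - y)" using big V unfolding good_def by blast
    then have X: "x \<in> X" "y \<in> X" using FX by auto
    obtain f where f: "f \<in> dual" "\<And>z. z \<in> X \<Longrightarrow> f z \<le> p z" "f (x - y) = p (x - y)"
      using norming_functional[OF p, of "x - y"] X by blast
    \<comment> \<open>Half of the amount by which the gap \<open>f x - f y\<close> exceeds
      \<open>e\<close>: moving both half-spaces inwards by \<open>d\<close> keeps \<open>x\<close>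
      and \<open>y\<close> in their interiors and leaves a gap of exactly \<open>e\<close>.\<close>
    define d where "d = (f x - f y - e) / 2"
    have d: "d > 0" "f y + d + e = f x - d" using xy f X by (auto simp: d_def dual_diff field_simps)
    define W where "W b = V \<inter> {z \<in> X. f z \<in> (if b then {f x - d<..} else {..<f y + d})}" for b
    have "openin weak (W b)" for b
      unfolding W_def using V f(1) by (intro openin_Int openin_weak_functional) (auto simp: good_def)
    moreover have "x \<in> W True" "y \<in> W False" using xy X d by (auto simp: W_def)
    ultimately have "good (W True)" "good (W False)" using xy unfolding good_def by blast+
    moreover have "W b \<subseteq> V" for b unfolding W_def by blast
    moreover have "(\<forall>z\<in>W True. (f y + d) + e \<le> f z)" "(\<forall>z\<in>W False. f z \<le> f y + d)"
      using d by (auto simp: W_def)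
    ultimately show ?thesis using f(1,2)
      by (intro exI[of _ W] exI[of _ f] exI[of _ "f y + d"]) blast
  qed
  then obtain W f c where W: "\<And>V. good V \<Longrightarrow> good (W V True) \<and> good (W V False) \<and> W V True \<subseteq> V \<and> W V False \<subseteq> V \<and>
      f V \<in> dual \<and> (\<forall>z\<in>X. f V z \<le> p z) \<and> (\<forall>z\<in>W V True. c V + e \<le> f V z) \<and> (\<forall>z\<in>W V False. f V z \<le> c V)"
    by metis
  \<comment> \<open>The newest choice is the head of the list, the root being the empty list;
    therefore \<open>path\<close> below reverses the initial segment of \<sigma>.\<close>
  define node where "node s = foldr (\<lambda>b V. W V b) s X" for s
  have node_Cons: "node (b # s) = W (node s) b" for b s unfolding node_def by simp
  have "good X" unfolding good_def using F(2) FX openin_topspace[of weak] by auto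
  have good_node: "good (node s)" for s
  proof (induction s)
    case Nil
    then show ?case using \<open>good X\<close> by (simp add: node_def)
  next
    case (Cons b s)
    then show ?case using W[OF Cons] by (cases b) (auto simp: node_Cons)
  qed
  have node_sub: "node (b # s) \<subseteq> node s" for b s
    using W[OF good_node[of s]] by (cases b) (auto simp: node_Cons)
  define d where "d s = (SOME x. x \<in> node s \<inter> F)" for s
  have d: "d s \<in> node s \<inter> F" for s
    unfolding d_def using good_node[of s] unfolding good_def
    by (auto intro!: someI_ex[of "\<lambda>x. x \<in> node s \<inter> F"] simp only: ex_in_conv)
  then have dX: "d s \<in> X" for s using FX by blast
  define path where "path \<sigma> n = rev (map (\<lambda>i. i \<in> \<sigma>) [0..<n])" for \<sigma> :: "nat set" and n
  have path_Suc: "path \<sigma> (Suc n) = (n \<in> \<sigma>) # path \<sigma> n" for \<sigma> n unfolding path_def by simp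
  have path_mono: "node (path \<sigma> m) \<subseteq> node (path \<sigma> n)" if "n \<le> m" for \<sigma> n m
    using that by (induction rule: dec_induct) (use node_sub path_Suc in fastforce)+
  have "\<exists>y\<in>F. \<forall>U N. openin weak U \<longrightarrow> y \<in> U \<longrightarrow> (\<exists>n\<ge>N. d (path \<sigma> n) \<in> U)" for \<sigma>
    using cluster_point_compactin[OF F(1), of "\<lambda>n. d (path \<sigma> n)"] d by (metis IntD2)
  then obtain y where y: "\<And>\<sigma>. y \<sigma> \<in> F" "\<And>\<sigma> U N. openin weak U \<Longrightarrow> y \<sigma> \<in> U \<Longrightarrow> \<exists>n\<ge>N. d (path \<sigma> n) \<in> U"
    by metis
  have yX: "y \<sigma> \<in> X" for \<sigma> using y(1) FX by blast
  \<comment> \<open>At the first index where the branches differ, the functional of the common node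
    separates all later chosen points of the two branches by \<open>e\<close>. Its half-space bounds
    pass to the cluster points, and \<open>p\<close> dominates it.\<close>
  have far1: "e \<le> p (y \<sigma> - y \<rho>)" if n: "n \<in> \<sigma>" "n \<notin> \<rho>" "\<And>i. i < n \<Longrightarrow> i \<in> \<sigma> \<longleftrightarrow> i \<in> \<rho>" for \<sigma> \<rho> n
  proof -
    have s: "path \<sigma> n = path \<rho> n" unfolding path_def using n(3) by simp
    let ?V = "node (path \<sigma> n)"
    note Ws = W[OF good_node[of "path \<sigma> n"]]
    have f: "f ?V \<in> dual" using Ws by blast
    have "c ?V + e \<le> f ?V (y \<sigma>)"
    proof (rule ccontr)
      assume "\<not> c ?V + e \<le> f ?V (y \<sigma>)"
      then obtain k where k: "k \<ge> Suc n" "d (path \<sigma> k) \<in> {x \<in> X. f ?V x \<in> {..<c ?V + e}}"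
        using y(2)[OF openin_weak_functional[OF f, of "{..<c ?V + e}"], of \<sigma> "Suc n"] yX by auto
      have "d (path \<sigma> k) \<in> W ?V True"
        using path_mono[OF k(1), of \<sigma>] d[of "path \<sigma> k"] n(1) by (auto simp: path_Suc node_Cons)
      then show False using Ws k(2) by force
    qed
    moreover have "f ?V (y \<rho>) \<le> c ?V"
    proof (rule ccontr)
      assume "\<not> f ?V (y \<rho>) \<le> c ?V"
      then obtain k where k: "k \<ge> Suc n" "d (path \<rho> k) \<in> {x \<in> X. f ?V x \<in> {c ?V<..}}"
        using y(2)[OF openin_weak_functional[OF f, of "{c ?V<..}"], of \<rho> "Suc n"] yX by auto
      have "d (path \<rho> k) \<in> W ?V False"
        using path_mono[OF k(1), of \<rho>] d[of "path \<rho> k"] n(2) s by (auto simp: path_Suc node_Cons)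
      then show False using Ws k(2) by force
    qed
    moreover have "f ?V (y \<sigma> - y \<rho>) \<le> p (y \<sigma> - y \<rho>)" using Ws yX by blast
    ultimately show ?thesis using dual_diff[OF f yX yX, of \<sigma> \<rho>] by simp
  qed
  have far: "e \<le> p (y \<sigma> - y \<rho>)" if neq: "\<sigma> \<noteq> \<rho>" for \<sigma> \<rho>
  proof -
    have ex: "\<exists>i. i \<in> \<sigma> \<longleftrightarrow> i \<notin> \<rho>" using neq by blast
    define n where "n = (LEAST i. i \<in> \<sigma> \<longleftrightarrow> i \<notin> \<rho>)"
    have n: "n \<in> \<sigma> \<longleftrightarrow> n \<notin> \<rho>" unfolding n_def using ex by (rule LeastI_ex)
    have less: "i \<in> \<sigma> \<longleftrightarrow> i \<in> \<rho>" if "i < n" for i using not_less_Least[OF that[unfolded n_def]] by blast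
    show ?thesis
      using far1[of n \<sigma> \<rho>] far1[of n \<rho> \<sigma>] n less p_commute[OF p yX yX, of \<sigma> \<rho>] by (cases "n \<in> \<sigma>") auto
  qed
  \<comment> \<open>Rational combinations are coded by lists over a countable type, which makes
    their range \<open>R\<close> countable.\<close>
  define comb where "comb l = (\<Sum>(q, s)\<leftarrow>l. real_of_rat q *\<^sub>R d s)" for l
  define R where "R = range comb"
  have RX: "r \<in> X" if "r \<in> R" for r
  proof -
    have "comb l \<in> X" for l by (induction l) (auto simp: comb_def dX)
    then show ?thesis using that unfolding R_def by blast
  qed
  have R_add: "r + s \<in> R" if "r \<in> R" "s \<in> R" for r s
  proof -
    obtain k l where "r = comb k" "s = comb l" using \<open>r \<in> R\<close> \<open>s \<in> R\<close> unfolding R_def by blast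
    then have "r + s = comb (k @ l)" by (simp add: comb_def)
    then show ?thesis unfolding R_def by blast
  qed
  have R_scale: "real_of_rat q *\<^sub>R r \<in> R" if "r \<in> R" for q r
  proof -
    obtain l where l: "r = comb l" using \<open>r \<in> R\<close> unfolding R_def by blast
    have "real_of_rat q *\<^sub>R comb l = comb (map (\<lambda>(a, s). (q * a, s)) l)"
      by (induction l) (auto simp: comb_def scaleR_add_right of_rat_mult)
    then show ?thesis unfolding R_def l by blast
  qed
  \<comment> \<open>The \<open>p\<close>-closure of \<open>R\<close> is convex, even closed under
    real combinations; so Mazur's theorem puts every weak cluster point at \<open>p\<close>-distance
    zero from it.\<close>
  define C where "C = {z \<in> X. \<forall>\<delta>>0. \<exists>r\<in>R. p (z - r) < \<delta>}"
  have p': "seminorm_on X p" using seminorm[OF p] .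
  have C_add: "a + b \<in> C" if ab: "a \<in> C" "b \<in> C" for a b
    unfolding C_def
  proof (intro CollectI conjI allI impI)
    show "a + b \<in> X" using that by (auto simp: C_def)
    fix \<delta> :: real assume "\<delta> > 0"
    then have "\<delta> / 2 > 0" by simp
    then obtain r s where rs: "r \<in> R" "p (a - r) < \<delta>/2" "s \<in> R" "p (b - s) < \<delta>/2"
      using ab unfolding C_def by blast
    have "p ((a - r) + (b - s)) \<le> p (a - r) + p (b - s)"
      using that rs RX by (intro seminorm_onD(2)[OF p']) (auto simp: C_def)
    then have "p ((a + b) - (r + s)) < \<delta>" using rs by (simp add: algebra_simps)
    then show "\<exists>r\<in>R. p (a + b - r) < \<delta>" using R_add rs by blast
  qed
  have C_scale: "t *\<^sub>R a \<in> C" if a: "a \<in> C" for a t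
    unfolding C_def
  proof (intro CollectI conjI allI impI)
    show "t *\<^sub>R a \<in> X" using that by (auto simp: C_def)
    fix \<delta> :: real assume \<delta>: "\<delta> > 0"
    define \<eta> where "\<eta> = \<delta> / (2 * (\<bar>t\<bar> + 1))"
    have "\<eta> > 0" unfolding \<eta>_def using \<delta> by simp
    then obtain r where r: "r \<in> R" "p (a - r) < \<eta>" using a unfolding C_def by blast
    have pr: "p r \<ge> 0" using seminorm_onD(1)[OF p' RX[OF r(1)]] .
    \<comment> \<open>The error \<open>\<bar>t - q\<bar> * p r\<close> gets one half of \<delta>,
      the error \<open>\<bar>t\<bar> * p (a - r)\<close> the other.\<close>
    obtain q where q: "t < real_of_rat q" "real_of_rat q < t + \<delta> / (2 * (p r + 1))"
      using of_rat_dense[of t "t + \<delta> / (2 * (p r + 1))"] \<delta> pr by auto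
    have "t *\<^sub>R a - real_of_rat q *\<^sub>R r = t *\<^sub>R (a - r) + (t - real_of_rat q) *\<^sub>R r" by (simp add: algebra_simps)
    moreover have "p (t *\<^sub>R (a - r) + (t - real_of_rat q) *\<^sub>R r) \<le> p (t *\<^sub>R (a - r)) + p ((t - real_of_rat q) *\<^sub>R r)"
      using a r RX by (intro seminorm_onD(2)[OF p']) (auto simp: C_def)
    moreover have "p (t *\<^sub>R (a - r)) = \<bar>t\<bar> * p (a - r)"
      using a r RX by (intro seminorm_onD(3)[OF p']) (auto simp: C_def)
    moreover have "p ((t - real_of_rat q) *\<^sub>R r) = \<bar>t - real_of_rat q\<bar> * p r"
      using r RX by (intro seminorm_onD(3)[OF p']) auto
    moreover have "\<bar>t\<bar> * p (a - r) \<le> (\<bar>t\<bar> + 1) * \<eta>"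
      using r a RX seminorm_onD(1)[OF p', of "a - r"] by (intro mult_mono) (auto simp: C_def)
    moreover have "(\<bar>t\<bar> + 1) * \<eta> = \<delta> / 2" unfolding \<eta>_def by (simp add: field_simps)
    moreover have "\<bar>t - real_of_rat q\<bar> * p r < \<delta> / (2 * (p r + 1)) * (p r + 1)"
      using q pr \<delta> by (intro mult_le_less_imp_less) auto
    moreover have "\<delta> / (2 * (p r + 1)) * (p r + 1) = \<delta> / 2" using pr by (simp add: field_simps)
    ultimately have "p (t *\<^sub>R a - real_of_rat q *\<^sub>R r) < \<delta>" by simp
    then show "\<exists>r\<in>R. p (t *\<^sub>R a - r) < \<delta>" using R_scale r by blast
  qed
  have "convex C" by (rule convexI) (simp add: C_add C_scale)
  have "d s \<in> C" for s
  proof -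
    have "comb [(1, s)] = d s" by (simp add: comb_def)
    then have "d s \<in> R" unfolding R_def by (metis rangeI)
    then show ?thesis unfolding C_def using dX seminorm_on_zero[OF p' subspace_X] by force
  qed
  then have ycl: "y \<sigma> \<in> weak closure_of C" for \<sigma>
    unfolding in_closure_of topspace_weak using yX y(2)[of _ \<sigma> 0] by blast
  have "\<exists>r\<in>R. p (r - y \<sigma>) < e / 2" for \<sigma>
  proof -
    have "e / 4 > 0" using e by simp
    obtain z where z: "z \<in> C" "p (z - y \<sigma>) < e / 4"
      using weak_closure_convex[OF p \<open>convex C\<close> _ ycl \<open>e / 4 > 0\<close>] unfolding C_def by blast
    then obtain r where r: "r \<in> R" "p (z - r) < e / 4" using \<open>e / 4 > 0\<close> unfolding C_def by blast
    have zX: "z \<in> X" using z unfolding C_def by blast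
    have "p (r - y \<sigma>) \<le> p (r - z) + p (z - y \<sigma>)" using p_triangle[OF p RX[OF r(1)] zX yX] .
    then have "p (r - y \<sigma>) < e / 2" using z r p_commute[OF p RX[OF r(1)] zX] by simp
    then show ?thesis using r(1) by blast
  qed
  then obtain r where r: "\<And>\<sigma>. r \<sigma> \<in> R" "\<And>\<sigma>. p (r \<sigma> - y \<sigma>) < e / 2" by metis
  \<comment> \<open>Two branches with the same approximant in \<open>R\<close> would have cluster
    points closer than \<open>e\<close>. The set of all subsets of the naturals would thus inject
    into a countable set.\<close>
  have "inj r"
  proof (rule injI, rule ccontr)
    fix \<sigma> \<rho> assume eq: "r \<sigma> = r \<rho>" and neq: "\<sigma> \<noteq> \<rho>"
    have "p (y \<sigma> - y \<rho>) \<le> p (y \<sigma> - r \<sigma>) + p (r \<sigma> - y \<rho>)" using p_triangle[OF p yX RX[OF r(1)] yX] .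
    then show False using far[OF neq] r(2)[of \<sigma>] r(2)[of \<rho>] eq p_commute[OF p RX[OF r(1)] yX, of \<sigma> \<sigma>] by simp
  qed
  moreover have "countable (range r)"
    by (rule countable_subset[of _ R]) (use r(1) in \<open>auto simp: R_def\<close>)
  ultimately have "countable (UNIV :: nat set set)" by (rule countable_image_inj_on[rotated])
  then have "range (from_nat_into (UNIV :: nat set set)) = UNIV" by (intro range_from_nat_into) auto
  then show False using Cantors_theorem[of "UNIV :: nat set"] by (metis Pow_UNIV)
qed

end

subsection \<open>Weakly equicontinuous nonexpansive systems\<close>

locale weak_system = lcs X \<tau> Q for X :: "'v::real_vector set" and \<tau> Q +
  fixes K :: "'v set" and act :: "'s::semitopological_semigroup \<Rightarrow> 'v \<Rightarrow> 'v"
  assumes K_X: "K \<subseteq> X" and K_ne: "K \<noteq> {}" and compact_K: "compactin weak K" and convex_K: "convex K"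
    and system: "dynamical_system (subtopology weak K) act" and nonexp: "nonexpansive Q K act"
    and equi: "equicontinuous_translations weak K act"
begin

lemma topspace_K [simp]: "topspace (subtopology weak K) = K"
  using K_X by auto

lemma act_in: "x \<in> K \<Longrightarrow> act s x \<in> K"
  using system unfolding dynamical_system_def topspace_K by blast

lemma act_act: "x \<in> K \<Longrightarrow> act s (act t x) = act (s * t) x"
  using system unfolding dynamical_system_def topspace_K by blast

lemma continuous_orbit: "x \<in> K \<Longrightarrow> continuous_map euclidean (subtopology weak K) (\<lambda>s. act s x)"
  using system unfolding dynamical_system_def topspace_K by blast

lemma continuous_act: "continuous_map (subtopology weak K) (subtopology weak K) (act s)"
  using system unfolding dynamical_system_def topspace_K by blast

lemma act_nonexpansive: "p \<in> Q \<Longrightarrow> x \<in> K \<Longrightarrow> y \<in> K \<Longrightarrow> p (act s x - act s y) \<le> p (x - y)"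
  using nonexp unfolding nonexpansive_def by blast

lemma equicontinuous_at:
  assumes x: "x \<in> K" and \<Phi>: "finite \<Phi>" "\<Phi> \<subseteq> dual" and e: "e > 0"
  obtains V where "openin weak V" "x \<in> V" "\<And>s y f. y \<in> V \<inter> K \<Longrightarrow> f \<in> \<Phi> \<Longrightarrow> \<bar>f (act s y - act s x)\<bar> < e"
proof -
  define U where "U = {y \<in> X. \<forall>f\<in>\<Phi>. \<bar>f (y - 0)\<bar> < e}"
  have "openin weak U" unfolding U_def by (rule openin_weak_ball[OF \<Phi> zero_in])
  moreover have "0 \<in> U" using \<Phi>(2) e by (auto simp: U_def dual_zero subset_iff)
  ultimately obtain V where V: "openin (subtopology weak K) V" "x \<in> V" "\<And>s y. y \<in> V \<Longrightarrow> act s y - act s x \<in> U"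
    using equi x unfolding equicontinuous_translations_def by meson
  then obtain V' where V': "openin weak V'" "V = V' \<inter> K" unfolding openin_subtopology by blast
  have "\<bar>f (act s y - act s x)\<bar> < e" if "y \<in> V' \<inter> K" "f \<in> \<Phi>" for s y f
    using V(3)[of y s] V'(2) that unfolding U_def by auto
  then show thesis using that[of V'] V' V(2) by blast
qed

text \<open>Compactness turns equicontinuity at points into a finite net that controls whole orbits
  at once. It feeds the pigeonhole argument for recurrence and the total boundedness of the
  translates of \<open>h\<close>.\<close>

lemma equicontinuous_cover:
  assumes F: "compactin weak F" "F \<subseteq> K" and \<Phi>: "finite \<Phi>" "\<Phi> \<subseteq> dual" and e: "e > 0"
  obtains A where "finite A" "A \<subseteq> F" "\<And>y. y \<in> F \<Longrightarrow> \<exists>x\<in>A. \<forall>f\<in>\<Phi>. \<bar>f (y - x)\<bar> < e \<and> (\<forall>s. \<bar>f (act s y - act s x)\<bar> < e)"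
proof -
  have "\<exists>V. openin weak V \<and> x \<in> V \<and> (\<forall>y\<in>V \<inter> K. \<forall>f\<in>\<Phi>. \<bar>f (y - x)\<bar> < e \<and> (\<forall>s. \<bar>f (act s y - act s x)\<bar> < e))"
    if x: "x \<in> F" for x
  proof -
    have "x \<in> K" "x \<in> X" using x F K_X by auto
    obtain V where V: "openin weak V" "x \<in> V" "\<And>s y f. y \<in> V \<inter> K \<Longrightarrow> f \<in> \<Phi> \<Longrightarrow> \<bar>f (act s y - act s x)\<bar> < e"
      using equicontinuous_at[OF \<open>x \<in> K\<close> \<Phi> e] by blast
    have "x \<in> {y \<in> X. \<forall>f\<in>\<Phi>. \<bar>f (y - x)\<bar> < e}"
      using \<Phi>(2) e \<open>x \<in> X\<close> by (auto simp: dual_zero subset_iff)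
    then show ?thesis
      using V openin_weak_ball[OF \<Phi> \<open>x \<in> X\<close>, of e]
      by (intro exI[of _ "V \<inter> {y \<in> X. \<forall>f\<in>\<Phi>. \<bar>f (y - x)\<bar> < e}"]) auto
  qed
  then obtain V where V: "\<And>x. x \<in> F \<Longrightarrow> openin weak (V x) \<and> x \<in> V x \<and>
      (\<forall>y\<in>V x \<inter> K. \<forall>f\<in>\<Phi>. \<bar>f (y - x)\<bar> < e \<and> (\<forall>s. \<bar>f (act s y - act s x)\<bar> < e))" by metis
  have "\<exists>\<F>. finite \<F> \<and> \<F> \<subseteq> V ` F \<and> F \<subseteq> \<Union>\<F>"
    by (rule compactinD[OF F(1)]) (use V in auto)
  then obtain A where A: "finite A" "A \<subseteq> F" "F \<subseteq> \<Union>(V ` A)" by (metis finite_subset_image)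
  show thesis
  proof (rule that[OF A(1,2)])
    fix y assume "y \<in> F"
    then obtain x where x: "x \<in> A" "y \<in> V x" using A(3) by blast
    then have "y \<in> V x \<inter> K" "x \<in> F" using \<open>y \<in> F\<close> F(2) A(2) by auto
    then show "\<exists>x\<in>A. \<forall>f\<in>\<Phi>. \<bar>f (y - x)\<bar> < e \<and> (\<forall>s. \<bar>f (act s y - act s x)\<bar> < e)"
      using V x(1) by blast
  qed
qed

text \<open>Since a semigroup may lack an identity, only exponents \<open>Suc m\<close> are
  represented by elements. The inequality holds because the iteration starts with
  \<open>act s\<close> and each further step is nonexpansive.\<close>

lemma act_power:
  "\<exists>t. (\<forall>z\<in>K. act t z = (act s ^^ Suc m) z) \<and> (\<forall>p\<in>Q. \<forall>x\<in>K. \<forall>y\<in>K. p (act t x - act t y) \<le> p (act s x - act s y))"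
proof (induction m)
  case 0
  then show ?case by (intro exI[of _ s]) simp
next
  case (Suc m)
  then obtain t where t: "\<And>z. z \<in> K \<Longrightarrow> act t z = (act s ^^ Suc m) z"
    "\<And>p x y. p \<in> Q \<Longrightarrow> x \<in> K \<Longrightarrow> y \<in> K \<Longrightarrow> p (act t x - act t y) \<le> p (act s x - act s y)" by blast
  have "act (s * t) z = (act s ^^ Suc (Suc m)) z" if "z \<in> K" for z
    using act_act[OF that, of s t] t(1)[OF that] by simp
  moreover have "p (act (s * t) x - act (s * t) y) \<le> p (act s x - act s y)" if "p \<in> Q" "x \<in> K" "y \<in> K" for p x y
    using act_nonexpansive[OF that(1) act_in[OF that(2)] act_in[OF that(3)], of s t t] t(2)[OF that]
      act_act[OF that(2), of s t] act_act[OF that(3), of s t] by simp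
  ultimately show ?case by blast
qed

text \<open>A backward orbit of the pair \<open>(x, y)\<close> comes back close to itself by the pigeonhole principle,
  uniformly under all translations; moving forward again shows that \<open>(x, y)\<close> is recurrent.\<close>

lemma recurrence:
  assumes F: "compactin weak F" "F \<subseteq> K" and surj: "act s ` F = F" and xy: "x \<in> F" "y \<in> F"
    and f: "f \<in> dual" and e: "e > 0"
  obtains t where "\<bar>f (act t x - x)\<bar> < e" "\<bar>f (act t y - y)\<bar> < e"
    "\<And>p. p \<in> Q \<Longrightarrow> p (act t x - act t y) \<le> p (act s x - act s y)"
proof -
  have "\<forall>z\<in>F. \<exists>z'\<in>F. act s z' = z" using surj by (metis imageE)
  then obtain g where g: "\<And>z. z \<in> F \<Longrightarrow> g z \<in> F \<and> act s (g z) = z" by metis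
  have gF: "(g ^^ k) z \<in> F" if "z \<in> F" for z k by (induction k) (use that g in auto)
  have rewind: "(act s ^^ k) ((g ^^ (k + j)) z) = (g ^^ j) z" if "z \<in> F" for z k j
  proof (induction k arbitrary: j)
    case (Suc k)
    have "(act s ^^ Suc k) ((g ^^ (Suc k + j)) z) = act s ((act s ^^ k) ((g ^^ (k + Suc j)) z))" by simp
    also have "\<dots> = act s (g ((g ^^ j) z))" unfolding Suc by simp
    finally show ?case using g gF[OF that] by simp
  qed simp
  obtain A where A: "finite A" "A \<subseteq> F" "\<And>y. y \<in> F \<Longrightarrow> \<exists>x\<in>A. \<forall>f'\<in>{f}. \<bar>f' (y - x)\<bar> < e / 2 \<and> (\<forall>s. \<bar>f' (act s y - act s x)\<bar> < e / 2)"
    using equicontinuous_cover[OF F, of "{f}" "e / 2"] f e by auto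
  then obtain a where a: "\<And>y. y \<in> F \<Longrightarrow> a y \<in> A" "\<And>y s. y \<in> F \<Longrightarrow> \<bar>f (act s y - act s (a y))\<bar> < e / 2"
    by (metis singletonI)
  \<comment> \<open>The pigeonhole is applied to pairs, so that the same times \<open>k < l\<close>
    serve both \<open>x\<close> and \<open>y\<close>.\<close>
  let ?c = "\<lambda>k. (a ((g ^^ k) x), a ((g ^^ k) y))"
  have "range ?c \<subseteq> A \<times> A" using a(1) gF xy by auto
  then have "finite (range ?c)" using A(1) by (meson finite_SigmaI finite_subset)
  then have "\<not> inj ?c" using finite_imageD infinite_UNIV_nat by blast
  then obtain i j where "i \<noteq> j" "?c i = ?c j" unfolding inj_on_def by blast
  then obtain k l where kl: "k < l" "?c k = ?c l" by (cases "i < j") (auto simp: not_less le_less)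
  obtain m where l: "l = k + Suc m" using less_imp_Suc_add[OF kl(1)] by auto
  obtain t where t: "\<And>z. z \<in> K \<Longrightarrow> act t z = (act s ^^ Suc m) z"
    "\<And>p x y. p \<in> Q \<Longrightarrow> x \<in> K \<Longrightarrow> y \<in> K \<Longrightarrow> p (act t x - act t y) \<le> p (act s x - act s y)"
    using act_power[where s = s and m = m] by blast
  \<comment> \<open>Applying the \<open>l\<close>-th power sends the backward point at time
    \<open>l\<close> to \<open>z\<close> and the one at time \<open>k\<close> to
    \<open>act t z\<close>. Both backward points share a net point, and closeness to it is uniform
    over all translations, in particular for \<open>u\<close>.\<close>
  obtain u where u: "\<And>z. z \<in> K \<Longrightarrow> act u z = (act s ^^ l) z"
    using act_power[where s = s and m = "k + m"] l by auto
  have close: "\<bar>f (act t z - z)\<bar> < e" if z: "z \<in> F" and eq: "a ((g ^^ k) z) = a ((g ^^ l) z)" for z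
  proof -
    have in_F: "(g ^^ i) z \<in> F" for i using gF z by blast
    then have in_K: "(g ^^ i) z \<in> K" for i using F by blast
    have "act u ((g ^^ l) z) = z" using u[OF in_K, of l] rewind[OF z, of l 0] by simp
    moreover have "act u ((g ^^ k) z) = act t z"
    proof -
      have "act u ((g ^^ k) z) = (act s ^^ Suc m) ((act s ^^ k) ((g ^^ k) z))"
        using u[OF in_K, of k] unfolding l by (simp only: funpow_add comp_apply add.commute[of k])
      then show ?thesis using rewind[OF z, of k 0] t(1)[of z] in_K[of 0] by simp
    qed
    ultimately have "\<bar>f (act t z - act u (a ((g ^^ k) z)))\<bar> < e / 2" "\<bar>f (z - act u (a ((g ^^ k) z)))\<bar> < e / 2"
      using a(2)[OF in_F, of u k] a(2)[OF in_F, of u l] eq by simp_all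
    moreover have "act t z \<in> X" "z \<in> X" "act u (a ((g ^^ k) z)) \<in> X"
      using act_in in_K[of 0] K_X a(1)[OF in_F] A(2) F(2) by (auto simp: subset_iff)
    ultimately show ?thesis using f by (simp add: dual_diff abs_if split: if_splits)
  qed
  show thesis
  proof (rule that[of t])
    show "p (act t x - act t y) \<le> p (act s x - act s y)" if "p \<in> Q" for p
      using t(2)[OF that] xy F(2) by blast
  qed (use close xy kl(2) in auto)
qed

text \<open>Recurrence is needed for one functional only: if \<open>f\<close> norms
  \<open>x - y\<close>, then \<open>f\<close> nearly attains \<open>p (x - y)\<close> at
  \<open>act t x - act t y\<close>, where \<open>p\<close> is at most
  \<open>p (act s x - act s y)\<close>.\<close>

lemma surjective_isometry:
  assumes F: "compactin weak F" "F \<subseteq> K" and surj: "act s ` F = F" and xy: "x \<in> F" "y \<in> F" and p: "p \<in> Q"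
  shows "p (x - y) \<le> p (act s x - act s y)"
proof (rule field_le_epsilon)
  fix e :: real assume e: "e > 0"
  have K: "x \<in> K" "y \<in> K" using xy F by auto
  then have X: "x \<in> X" "y \<in> X" using K_X by auto
  obtain f where f: "f \<in> dual" "\<And>z. z \<in> X \<Longrightarrow> f z \<le> p z" "f (x - y) = p (x - y)"
    using norming_functional[OF p, of "x - y"] X by blast
  obtain t where t: "\<bar>f (act t x - x)\<bar> < e / 2" "\<bar>f (act t y - y)\<bar> < e / 2"
    "p (act t x - act t y) \<le> p (act s x - act s y)"
    using recurrence[OF F surj xy f(1), of "e / 2"] e p by (metis half_gt_zero)
  have tX: "act t x \<in> X" "act t y \<in> X" using act_in K K_X by auto
  have "f (act t x - act t y) \<le> p (act t x - act t y)" using tX by (intro f(2)) auto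
  then show "p (x - y) \<le> p (act s x - act s y) + e"
    using t f(1,3) X tX by (simp add: dual_diff abs_if split: if_splits)
qed

section \<open>Minimal invariant sets and De Marr's argument\<close>

definition invariant_set :: "'v set \<Rightarrow> bool" where
  "invariant_set F \<longleftrightarrow> closedin weak F \<and> F \<subseteq> K \<and> F \<noteq> {} \<and> (\<forall>s. \<forall>x\<in>F. act s x \<in> F)"

definition minimal_set :: "'v set \<Rightarrow> bool" where
  "minimal_set F \<longleftrightarrow> invariant_set F \<and> (\<forall>G. invariant_set G \<longrightarrow> G \<subseteq> F \<longrightarrow> G = F)"

lemma invariant_compact: "invariant_set F \<Longrightarrow> compactin weak F"
  unfolding invariant_set_def using closed_compactin[OF compact_K] by blast

lemma closedin_K: "closedin weak K"
  using compactin_imp_closedin[OF Hausdorff_weak compact_K] .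

lemma exists_minimal_set:
  assumes "invariant_set C"
  obtains F where "F \<subseteq> C" "minimal_set F"
proof -
  obtain M where M: "M \<in> {G. invariant_set G \<and> G \<subseteq> C}"
      "\<And>G. G \<in> {G. invariant_set G \<and> G \<subseteq> C} \<Longrightarrow> G \<subseteq> M \<Longrightarrow> G = M"
  proof (rule minimal_closed_set[OF compact_K, of "{G. invariant_set G \<and> G \<subseteq> C}"])
    show "{G. invariant_set G \<and> G \<subseteq> C} \<noteq> {}" using assms by blast
    show "closedin weak G \<and> G \<subseteq> K \<and> G \<noteq> {}" if "G \<in> {G. invariant_set G \<and> G \<subseteq> C}" for G
      using that unfolding invariant_set_def by blast
    fix \<D> assume \<D>: "\<D> \<subseteq> {G. invariant_set G \<and> G \<subseteq> C}" "\<D> \<noteq> {}" "\<Inter>\<D> \<noteq> {}"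
    have "closedin weak (\<Inter>\<D>)" using \<D> by (intro closedin_Inter) (auto simp: invariant_set_def)
    moreover obtain D where "D \<in> \<D>" using \<D>(2) by blast
    then have "\<Inter>\<D> \<subseteq> D" "invariant_set D" "D \<subseteq> C" using \<D>(1) by auto
    then have "\<Inter>\<D> \<subseteq> K" "\<Inter>\<D> \<subseteq> C" unfolding invariant_set_def by auto
    moreover have "\<forall>s. \<forall>x\<in>\<Inter>\<D>. act s x \<in> \<Inter>\<D>" using \<D> unfolding invariant_set_def by blast
    ultimately show "\<Inter>\<D> \<in> {G. invariant_set G \<and> G \<subseteq> C}" using \<D> unfolding invariant_set_def by blast
  qed blast
  then have "minimal_set M" unfolding minimal_set_def by blast
  with M show thesis using that by blast
qed

text \<open>The closure of an orbit is invariant because translations are continuous, and it lies in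
  \<open>F\<close>; minimality makes it equal to \<open>F\<close>, even if the orbit does not
  contain \<open>x\<close> itself.\<close>

lemma minimal_orbit_dense:
  assumes F: "minimal_set F" and x: "x \<in> F" and V: "openin weak V" "V \<inter> F \<noteq> {}"
  obtains s where "act s x \<in> V"
proof -
  have inv: "invariant_set F" using F unfolding minimal_set_def by blast
  have FK: "F \<subseteq> K" and Fc: "closedin weak F" and FX: "F \<subseteq> X"
    using inv K_X unfolding invariant_set_def by auto
  define O' where "O' = range (\<lambda>s. act s x)"
  have O: "O' \<subseteq> F" unfolding O'_def using inv x unfolding invariant_set_def by blast
  define G where "G = weak closure_of O'"
  have GF: "G \<subseteq> F" unfolding G_def using O Fc by (rule closure_of_minimal)
  have OG: "O' \<subseteq> G" unfolding G_def using O FX by (intro closure_of_subset) auto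
  have "act s z \<in> G" if z: "z \<in> G" for s z
  proof -
    have sub: "G = subtopology weak K closure_of O'"
      using closure_of_subtopology_subset[of weak K O'] FK GF O Fc
      by (simp add: G_def closure_of_subtopology inf.absorb2)
    have "act s ` (subtopology weak K closure_of O') \<subseteq> subtopology weak K closure_of (act s ` O')"
      by (rule continuous_map_image_closure_subset[OF continuous_act])
    also have "\<dots> \<subseteq> subtopology weak K closure_of O'"
    proof (rule closure_of_mono)
      show "act s ` O' \<subseteq> O'" unfolding O'_def using act_act x FK by auto
    qed
    finally show ?thesis using z sub by blast
  qed
  moreover have "G \<noteq> {}" using OG unfolding O'_def by blast
  ultimately have "invariant_set G" unfolding invariant_set_def G_def using GF FK G_def by auto
  then have "G = F" using F GF unfolding minimal_set_def by blast
  then obtain y where "y \<in> V" "y \<in> G" using V by blast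
  then obtain z where "z \<in> O'" "z \<in> V" unfolding G_def in_closure_of using V(1) by blast
  then show thesis using that unfolding O'_def by blast
qed

text \<open>Every orbit meets \<open>V\<close>, so the open preimages of \<open>V\<close> cover
  \<open>F\<close>, and compactness leaves finitely many.\<close>

lemma minimal_translates_cover:
  assumes F: "minimal_set F" and V: "openin weak V" "V \<inter> F \<noteq> {}"
  obtains I where "finite I" "\<And>x. x \<in> F \<Longrightarrow> \<exists>s\<in>I. act s x \<in> V"
proof -
  have inv: "invariant_set F" using F unfolding minimal_set_def by blast
  have Fc: "compactin weak F" using invariant_compact[OF inv] .
  have FK: "F \<subseteq> K" using inv unfolding invariant_set_def by auto
  have "\<exists>U. openin weak U \<and> U \<inter> K = {x \<in> K. act s x \<in> V}" for s
  proof -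
    have "openin (subtopology weak K) (V \<inter> K)" using V(1) by (rule openin_subtopology_Int)
    note openin_continuous_map_preimage[OF continuous_act[of s] this]
    then have "openin (subtopology weak K) {x \<in> K. act s x \<in> V \<inter> K}" unfolding topspace_K .
    moreover have "{x \<in> K. act s x \<in> V \<inter> K} = {x \<in> K. act s x \<in> V}" using act_in by blast
    ultimately show ?thesis unfolding openin_subtopology by metis
  qed
  then obtain U where U: "\<And>s. openin weak (U s)" "\<And>s. U s \<inter> K = {x \<in> K. act s x \<in> V}" by metis
  have "F \<subseteq> \<Union>(range U)"
  proof
    fix x assume x: "x \<in> F"
    then obtain s where "act s x \<in> V" using minimal_orbit_dense[OF F x V] by blast
    then show "x \<in> \<Union>(range U)" using U(2)[of s] x FK by blast
  qed
  then have "\<exists>\<F>. finite \<F> \<and> \<F> \<subseteq> range U \<and> F \<subseteq> \<Union>\<F>"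
    by (intro compactinD[OF Fc]) (use U in auto)
  then obtain I where I: "finite I" "F \<subseteq> \<Union>(U ` I)" by (metis finite_subset_image)
  show thesis
  proof (rule that[OF I(1)])
    fix x assume x: "x \<in> F"
    then obtain s where "s \<in> I" "x \<in> U s" using I(2) by blast
    then show "\<exists>s\<in>I. act s x \<in> V" using U(2)[of s] x FK by blast
  qed
qed

text \<open>\<open>F\<close> is covered by finitely many preimages of one small slice, and
  translations do not shrink distances on \<open>F\<close>, so these preimages are as small as the
  slice.\<close>

lemma minimal_precompact:
  assumes F: "minimal_set F" and surj: "\<And>s. act s ` F = F" and p: "p \<in> Q"
  shows "seminorm_precompact p F"
  unfolding seminorm_precompact_def
proof (intro allI impI)
  fix e :: real assume e: "e > 0"
  have inv: "invariant_set F" using F unfolding minimal_set_def by blast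
  have Fc: "compactin weak F" using invariant_compact[OF inv] .
  have FK: "F \<subseteq> K" "F \<noteq> {}" using inv unfolding invariant_set_def by auto
  obtain V where V: "openin weak V" "V \<inter> F \<noteq> {}" "\<And>x y. x \<in> V \<inter> F \<Longrightarrow> y \<in> V \<inter> F \<Longrightarrow> p (x - y) \<le> e"
    using small_weak_slice[OF Fc FK(2) p e] by blast
  obtain I where I: "finite I" "\<And>x. x \<in> F \<Longrightarrow> \<exists>s\<in>I. act s x \<in> V"
    using minimal_translates_cover[OF F V(1,2)] by blast
  define \<V> where "\<V> = (\<lambda>s. {x \<in> F. act s x \<in> V}) ` I"
  have "p (x - y) \<le> e" if xy: "x \<in> F" "y \<in> F" "act s x \<in> V" "act s y \<in> V" for s x y
  proof -
    have "act s x \<in> V \<inter> F" "act s y \<in> V \<inter> F" using xy surj[of s] by blast+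
    then have "p (act s x - act s y) \<le> e" by (rule V(3))
    with surjective_isometry[OF Fc FK(1) surj xy(1,2) p, of s] show ?thesis by simp
  qed
  then have "\<forall>V\<in>\<V>. \<forall>x\<in>V \<inter> F. \<forall>y\<in>V \<inter> F. p (x - y) \<le> e" unfolding \<V>_def by blast
  moreover have "finite \<V>" "F \<subseteq> \<Union>\<V>" using I unfolding \<V>_def by auto
  ultimately show "\<exists>\<V>. finite \<V> \<and> F \<subseteq> \<Union>\<V> \<and> (\<forall>V\<in>\<V>. \<forall>x\<in>V \<inter> F. \<forall>y\<in>V \<inter> F. p (x - y) \<le> e)"
    by blast
qed

text \<open>Two distinct points in \<open>F\<close> would give a radius \<open>r\<close> below the
  diameter of \<open>F\<close> and a centre in \<open>M\<close>. The set of all such centres is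
  convex and invariant, hence all of \<open>M\<close>, and then \<open>F\<close> has diameter at
  most \<open>r\<close>. Surjectivity is used for precompactness and again for the invariance of the
  set of centres.\<close>

theorem fixed_point_if_surjective:
  assumes surj: "\<And>F s. minimal_set F \<Longrightarrow> act s ` F = F"
  shows "has_fixed_point K act"
proof -
  let ?\<C> = "{C. invariant_set C \<and> convex C}"
  obtain M where M: "M \<in> ?\<C>" "\<And>G. G \<in> ?\<C> \<Longrightarrow> G \<subseteq> M \<Longrightarrow> G = M"
  proof (rule minimal_closed_set[OF compact_K, of ?\<C>])
    have "invariant_set K" unfolding invariant_set_def using closedin_K K_ne act_in by blast
    then show "?\<C> \<noteq> {}" using convex_K by blast
    show "closedin weak G \<and> G \<subseteq> K \<and> G \<noteq> {}" if "G \<in> ?\<C>" for G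
      using that unfolding invariant_set_def by blast
    fix \<D> assume \<D>: "\<D> \<subseteq> ?\<C>" "\<D> \<noteq> {}" "\<Inter>\<D> \<noteq> {}"
    have "closedin weak (\<Inter>\<D>)" using \<D> by (intro closedin_Inter) (auto simp: invariant_set_def)
    moreover obtain D where "D \<in> \<D>" using \<D>(2) by blast
    then have "\<Inter>\<D> \<subseteq> D" "invariant_set D" using \<D>(1) by auto
    then have "\<Inter>\<D> \<subseteq> K" unfolding invariant_set_def by auto
    moreover have "\<forall>s. \<forall>x\<in>\<Inter>\<D>. act s x \<in> \<Inter>\<D>" using \<D> unfolding invariant_set_def by blast
    moreover have "convex (\<Inter>\<D>)" using \<D> by (intro convex_Inter) auto
    ultimately show "\<Inter>\<D> \<in> ?\<C>" using \<D> unfolding invariant_set_def by blast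
  qed blast
  then have Minv: "invariant_set M" and Mconv: "convex M" by auto
  obtain F where F: "F \<subseteq> M" "minimal_set F" using exists_minimal_set[OF Minv] by blast
  have FK: "F \<subseteq> K" "F \<noteq> {}" "\<And>s x. x \<in> F \<Longrightarrow> act s x \<in> F"
    using F(2) unfolding minimal_set_def invariant_set_def by auto
  then have FX: "F \<subseteq> X" using K_X by blast
  have "x = y" if xy: "x \<in> F" "y \<in> F" for x y
  proof (rule ccontr)
    assume "x \<noteq> y"
    then obtain p where p: "p \<in> Q" "p (x - y) > 0"
      using seminorm_separates[of "x - y"] xy FX by auto
    note pX = seminorm[OF p(1)]
    have pre: "seminorm_precompact p F" using minimal_precompact[OF F(2) surj[OF F(2)] p(1)] .
    define D where "D = (\<lambda>(x, y). p (x - y)) ` (F \<times> F)"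
    have "D \<noteq> {}" using xy unfolding D_def by blast
    \<comment> \<open>The diameter is a supremum of reals, which is meaningful only once
      \<open>F\<close> is known to be bounded.\<close>
    have bdd: "bdd_above D"
    proof -
      obtain \<V> where \<V>: "finite \<V>" "F \<subseteq> \<Union>\<V>" "\<forall>V\<in>\<V>. \<forall>x\<in>V \<inter> F. \<forall>y\<in>V \<inter> F. p (x - y) \<le> 1"
        using pre unfolding seminorm_precompact_def by (metis zero_less_one)
      have bV: "bdd_above ((\<lambda>z. p (z - x)) ` (V \<inter> F))" if "V \<in> \<V>" for V
      proof (cases "V \<inter> F = {}")
        case False
        then obtain a where a: "a \<in> V \<inter> F" by blast
        have "p (z - x) \<le> 1 + p (a - x)" if z: "z \<in> V \<inter> F" for z
        proof -
          have "p (z - x) \<le> p (z - a) + p (a - x)" using z a xy FX by (intro p_triangle[OF p(1)]) auto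
          moreover have "p (z - a) \<le> 1" using \<V>(3) \<open>V \<in> \<V>\<close> z a by blast
          ultimately show ?thesis by simp
        qed
        then show ?thesis by (intro bdd_aboveI2)
      qed simp
      have "bdd_above (\<Union>V\<in>\<V>. (\<lambda>z. p (z - x)) ` (V \<inter> F))"
        using bV \<V>(1) by (simp add: bdd_above_UN)
      then have "bdd_above ((\<lambda>z. p (z - x)) ` F)"
        by (rule bdd_above_mono) (use \<V>(2) in blast)
      then obtain B where B: "\<And>z. z \<in> F \<Longrightarrow> p (z - x) \<le> B" unfolding bdd_above_def by auto
      have "p (a - b) \<le> B + B" if ab: "a \<in> F" "b \<in> F" for a b
      proof -
        have "p (a - b) \<le> p (a - x) + p (x - b)" using ab xy FX by (intro p_triangle[OF p(1)]) auto
        moreover have "p (x - b) = p (b - x)" using ab xy FX by (intro p_commute[OF p(1)]) auto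
        ultimately show ?thesis using B[OF ab(1)] B[OF ab(2)] by simp
      qed
      then show ?thesis unfolding D_def by (intro bdd_aboveI2[where M = "B + B"]) auto
    qed
    have le: "p (a - b) \<le> Sup D" if "a \<in> F" "b \<in> F" for a b
      by (rule cSup_upper[OF _ bdd]) (use that in \<open>auto simp: D_def\<close>)
    have "Sup D > 0" using le[OF xy] p(2) by simp
    then obtain u r where u: "u \<in> convex hull F" "r < Sup D" "\<And>x. x \<in> F \<Longrightarrow> p (x - u) \<le> r"
      using precompact_center[OF subspace_X pX FX FK(2) pre _ le] by blast
    have MX: "M \<subseteq> X" "M \<subseteq> K" using Minv K_X unfolding invariant_set_def by auto
    have uM: "u \<in> M" using u(1) hull_minimal[of F M convex] F(1) Mconv by blast
    define G where "G = M \<inter> (\<Inter>x\<in>F. {z \<in> X. p (x - z) \<le> r})"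
    have "convex G"
    proof -
      have "convex {z \<in> X. p (x - z) \<le> r}" if "x \<in> X" for x
      proof (rule convexI)
        fix a b and s t :: real
        assume ab: "a \<in> {z \<in> X. p (x - z) \<le> r}" "b \<in> {z \<in> X. p (x - z) \<le> r}"
          and st: "0 \<le> s" "0 \<le> t" "s + t = 1"
        have "x - (s *\<^sub>R a + t *\<^sub>R b) = (s + t) *\<^sub>R x - (s *\<^sub>R a + t *\<^sub>R b)" using st by simp
        also have "\<dots> = s *\<^sub>R (x - a) + t *\<^sub>R (x - b)" by (simp add: algebra_simps)
        also have "p \<dots> \<le> p (s *\<^sub>R (x - a)) + p (t *\<^sub>R (x - b))"
          using ab that by (intro seminorm_onD(2)[OF pX]) auto
        also have "\<dots> = s * p (x - a) + t * p (x - b)"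
          using ab that st by (simp add: seminorm_onD(3)[OF pX])
        also have "\<dots> \<le> s * r + t * r" using ab st by (intro add_mono mult_left_mono) auto
        also have "\<dots> = r" using st by (simp flip: distrib_right)
        finally show "s *\<^sub>R a + t *\<^sub>R b \<in> {z \<in> X. p (x - z) \<le> r}" using ab by auto
      qed
      then show ?thesis unfolding G_def using Mconv FX by (intro convex_Int convex_INT) auto
    qed
    moreover have "invariant_set G"
      unfolding invariant_set_def
    proof (intro conjI allI ballI)
      show "closedin weak G"
        unfolding G_def using Minv FK(2) FX
        by (intro closedin_Int closedin_INT closedin_weak_seminorm_ball[OF p(1)]) (auto simp: invariant_set_def)
      show "G \<subseteq> K" unfolding G_def using MX by blast
      show "G \<noteq> {}" unfolding G_def using uM u(3) MX by auto
      fix s z assume z: "z \<in> G"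
      then have zM: "z \<in> M" and zle: "\<And>x. x \<in> F \<Longrightarrow> p (x - z) \<le> r" unfolding G_def by auto
      have "act s z \<in> M" using Minv zM unfolding invariant_set_def by blast
      moreover have "p (x - act s z) \<le> r" if x: "x \<in> F" for x
      proof -
        \<comment> \<open>Every point of \<open>F\<close> is a translate of a point of
          \<open>F\<close>, so nonexpansiveness transfers the bound from \<open>x'\<close> to
          \<open>x\<close>.\<close>
        obtain x' where x': "x' \<in> F" "x = act s x'" using surj[OF F(2), of s] x by blast
        have "p (act s x' - act s z) \<le> p (x' - z)" using x' zM MX FK by (intro act_nonexpansive[OF p(1)]) auto
        then show ?thesis using zle[OF x'(1)] x'(2) by simp
      qed
      ultimately show "act s z \<in> G" unfolding G_def using MX by auto
    qed
    ultimately have "G = M" using M(2) unfolding G_def by blast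
    then have "p (a - b) \<le> r" if "a \<in> F" "b \<in> F" for a b
      using that F(1) unfolding G_def by blast
    then have "Sup D \<le> r" using \<open>D \<noteq> {}\<close> by (intro cSup_least) (auto simp: D_def)
    then show False using u(2) by simp
  qed
  then show ?thesis unfolding has_fixed_point_def using FK by blast
qed

end

subsection \<open>Property (D) for compact convex sets of functions\<close>

text \<open>The hypothesis \<open>P_uniform\<close> says that the topologies of pointwise and of uniform convergence agree
  on \<open>P\<close>; \<open>T\<close> transports the latter, a norm topology on \<open>L\<close>, to a subspace of \<open>'v\<close>.\<close>

lemma property_D_functions:
  fixes T :: "('i \<Rightarrow> real) \<Rightarrow> 'v::real_vector" and idx :: "'s::semitopological_semigroup \<Rightarrow> 'i \<Rightarrow> 'i"
  assumes D: "property_D TYPE('s) TYPE('v)"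
    and L_zero: "(\<lambda>i. 0) \<in> L"
    and L_add: "\<And>a b. a \<in> L \<Longrightarrow> b \<in> L \<Longrightarrow> (\<lambda>i. a i + b i) \<in> L"
    and L_scale: "\<And>a c. a \<in> L \<Longrightarrow> (\<lambda>i. c * a i) \<in> L"
    and L_bounded: "\<And>a. a \<in> L \<Longrightarrow> \<exists>B. \<forall>i. \<bar>a i\<bar> \<le> B"
    and T_add: "\<And>a b. a \<in> L \<Longrightarrow> b \<in> L \<Longrightarrow> T (\<lambda>i. a i + b i) = T a + T b"
    and T_scale: "\<And>a c. a \<in> L \<Longrightarrow> T (\<lambda>i. c * a i) = c *\<^sub>R T a"
    and T_inj: "\<And>a i. a \<in> L \<Longrightarrow> T a = 0 \<Longrightarrow> a i = 0"
    and P: "P \<subseteq> L" "P \<noteq> {}" "compact P"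
    and P_convex: "\<And>a b u v. a \<in> P \<Longrightarrow> b \<in> P \<Longrightarrow> 0 \<le> u \<Longrightarrow> 0 \<le> v \<Longrightarrow> u + v = 1 \<Longrightarrow> (\<lambda>i. u * a i + v * b i) \<in> P"
    and P_uniform: "\<And>e. e > 0 \<Longrightarrow> \<exists>N d. finite N \<and> d > 0 \<and>
      (\<forall>a\<in>P. \<forall>b\<in>P. (\<forall>i\<in>N. \<bar>a i - b i\<bar> < d) \<longrightarrow> (\<forall>i. \<bar>a i - b i\<bar> \<le> e))"
    and idx: "\<And>s t i. idx (s * t) i = idx t (idx s i)"
    and P_invariant: "\<And>a t. a \<in> P \<Longrightarrow> (\<lambda>i. a (idx t i)) \<in> P"
    and P_continuous: "\<And>a t e. a \<in> P \<Longrightarrow> e > 0 \<Longrightarrow>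
      \<exists>W. open W \<and> t \<in> W \<and> (\<forall>t'\<in>W. \<forall>i. \<bar>a (idx t' i) - a (idx t i)\<bar> \<le> e)"
  obtains a where "a \<in> P" "\<And>t i. a (idx t i) = a i"
proof -
  have inj: "inj_on T L"
  proof (rule inj_onI)
    fix a b assume ab: "a \<in> L" "b \<in> L" "T a = T b"
    have b': "(\<lambda>i. (- 1) * b i) \<in> L" by (rule L_scale[OF ab(2)])
    have "T (\<lambda>i. a i + (- 1) * b i) = 0"
      using T_add[OF ab(1) b'] T_scale[OF ab(2), of "- 1"] ab(3) by simp
    then have "a i + (- 1) * b i = 0" for i by (rule T_inj[OF L_add[OF ab(1) b']])
    then show "a = b" by (intro ext) simp
  qed
  define Y where "Y = T ` L"
  define R where "R = inv_into L T"
  have TR: "y \<in> Y \<Longrightarrow> T (R y) = y" and RL: "y \<in> Y \<Longrightarrow> R y \<in> L" for y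
    unfolding R_def Y_def by (auto simp: f_inv_into_f inv_into_into)
  have RT: "a \<in> L \<Longrightarrow> R (T a) = a" for a unfolding R_def using inj by simp
  have TY: "a \<in> L \<Longrightarrow> T a \<in> Y" for a unfolding Y_def by blast
  have addY: "x + y \<in> Y \<and> R (x + y) = (\<lambda>i. R x i + R y i)" if "x \<in> Y" "y \<in> Y" for x y
    using T_add[OF RL[OF that(1)] RL[OF that(2)]] L_add[OF RL[OF that(1)] RL[OF that(2)]] that
      TR TY RT by metis
  have scaleY: "c *\<^sub>R x \<in> Y \<and> R (c *\<^sub>R x) = (\<lambda>i. c * R x i)" if "x \<in> Y" for x c
    using T_scale[OF RL[OF that]] L_scale[OF RL[OF that]] that TR TY RT by metis
  have zeroY: "0 \<in> Y"
    using T_scale[OF L_zero, of 0] TY[OF L_zero] by simp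
  have Y: "subspace Y"
    using addY scaleY zeroY unfolding subspace_def by blast
  have diffY: "x - y \<in> Y" "R (x - y) i = R x i - R y i" if "x \<in> Y" "y \<in> Y" for x y i
    using addY[of x "(-1) *\<^sub>R y"] scaleY[of y "-1"] that by auto
  \<comment> \<open>The uniform norm, carried over from \<open>L\<close> by
    \<open>T\<close>.\<close>
  define p where "p y = (SUP i. \<bar>R y i\<bar>)" for y
  have p_le: "p y \<le> B \<longleftrightarrow> (\<forall>i. \<bar>R y i\<bar> \<le> B)" if y: "y \<in> Y" for y B
  proof -
    obtain B' where "\<forall>i. \<bar>R y i\<bar> \<le> B'" using L_bounded[OF RL[OF y]] by blast
    then have "bdd_above (range (\<lambda>i. \<bar>R y i\<bar>))" by (auto intro: bdd_aboveI2)
    then show ?thesis unfolding p_def by (subst cSUP_le_iff) auto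
  qed
  have p_ge: "\<bar>R y i\<bar> \<le> p y" if "y \<in> Y" for y i using p_le[OF that, of "p y"] by simp
  have p: "seminorm_on Y p"
    unfolding seminorm_on_def
  proof (intro conjI ballI allI)
    show "0 \<le> p x" if "x \<in> Y" for x using p_ge[OF that] by (meson abs_ge_zero order_trans)
    show "p (x + y) \<le> p x + p y" if "x \<in> Y" "y \<in> Y" for x y
    proof -
      have "\<bar>R x i + R y i\<bar> \<le> p x + p y" for i
        using p_ge[OF that(1), of i] p_ge[OF that(2), of i] by linarith
      then show ?thesis using p_le[of "x + y"] addY[OF that] by simp
    qed
    have le: "p (c *\<^sub>R x) \<le> \<bar>c\<bar> * p x" if "x \<in> Y" for c x
      using p_le[of "c *\<^sub>R x"] scaleY[OF that] p_ge[OF that] by (simp add: abs_mult mult_left_mono)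
    show "p (c *\<^sub>R x) = \<bar>c\<bar> * p x" if x: "x \<in> Y" for c x
    proof (cases "c = 0")
      case True
      have "p 0 \<le> 0" using le[OF x, of 0] by simp
      moreover have "0 \<le> p 0" using p_ge[OF zeroY] by (meson abs_ge_zero order_trans)
      ultimately show ?thesis using True by simp
    next
      case False
      have "p x \<le> \<bar>inverse c\<bar> * p (c *\<^sub>R x)"
        using le[of "c *\<^sub>R x" "inverse c"] scaleY[OF x] False by simp
      then have "\<bar>c\<bar> * p x \<le> p (c *\<^sub>R x)" using False by (simp add: abs_inverse field_simps)
      with le[OF x, of c] show ?thesis by simp
    qed
  qed
  have pos: "0 < p x" if x: "x \<in> Y" "x \<noteq> 0" for x
  proof (rule ccontr)
    assume "\<not> 0 < p x"
    then have "\<bar>R x i\<bar> \<le> 0" for i using p_ge[OF x(1), of i] by simp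
    then have "R x = (\<lambda>i. 0 * R x i)" by auto
    then have "T (R x) = 0" using T_scale[OF RL[OF x(1)], of 0] by simp
    then show False using TR x by simp
  qed
  let ?T = "seminorm_topology Y {p}"
  note op = openin_seminorm_topology_singleton[OF Y p]
  define C where "C = T ` P"
  have CY: "C \<subseteq> Y" unfolding C_def Y_def using P(1) by blast
  have RC: "R y \<in> P" if "y \<in> C" for y using that P(1) RT unfolding C_def by auto
  have CI: "y \<in> C" if "y \<in> Y" "R y \<in> P" for y using that TR unfolding C_def by force
  have "compactin ?T C"
    unfolding C_def
  proof (rule image_compactin)
    show "compactin (subtopology euclidean P) P" using P(3) by (simp add: compactin_subtopology)
    show "continuous_map (subtopology euclidean P) ?T T"
      unfolding continuous_map_def
    proof (intro conjI allI impI)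
      show "T \<in> topspace (subtopology euclidean P) \<rightarrow> topspace ?T" using CY unfolding C_def by auto
      fix U assume U: "openin ?T U"
      show "openin (subtopology euclidean P) {a \<in> topspace (subtopology euclidean P). T a \<in> U}"
      proof (subst openin_subopen, intro ballI)
        fix a assume "a \<in> {a \<in> topspace (subtopology euclidean P). T a \<in> U}"
        then have a: "a \<in> P" "T a \<in> U" by auto
        then obtain e where e: "e > 0" "\<And>y. y \<in> Y \<Longrightarrow> p (y - T a) < e \<Longrightarrow> y \<in> U" using U unfolding op by blast
        have "e / 2 > 0" using e by simp
        \<comment> \<open>Closeness at finitely many indices becomes uniform closeness, so a basic
          open set of the product topology is mapped into the given norm ball.\<close>
        then obtain N d where N: "finite N" "d > 0" "\<And>b i. b \<in> P \<Longrightarrow> (\<And>i. i \<in> N \<Longrightarrow> \<bar>b i - a i\<bar> < d) \<Longrightarrow> \<bar>b i - a i\<bar> \<le> e / 2"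
          using P_uniform a(1) by meson
        have "open {b. b i \<in> ball (a i) d}" for i
          by (intro open_vimage[of _ "\<lambda>b. b i", unfolded vimage_def] continuous_on_product_coordinates) simp
        then have O: "open (\<Inter>i\<in>N. {b. b i \<in> ball (a i) d})" using N(1) by (intro open_INT) auto
        have sub: "T b \<in> U" if b: "b \<in> P" "\<And>i. i \<in> N \<Longrightarrow> \<bar>b i - a i\<bar> < d" for b
        proof (rule e(2))
          show bY: "T b \<in> Y" using b P(1) TY by blast
          have aY: "T a \<in> Y" using a P(1) TY by blast
          have "p (T b - T a) \<le> e / 2"
            using N(3)[OF b] RT[OF subsetD[OF P(1) b(1)]] RT[OF subsetD[OF P(1) a(1)]]
            unfolding p_le[OF diffY(1)[OF bY aY]] diffY(2)[OF bY aY] by simp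
          then show "p (T b - T a) < e" using e(1) by simp
        qed
        have "openin (subtopology euclidean P) (P \<inter> (\<Inter>i\<in>N. {b. b i \<in> ball (a i) d}))"
          using O by (auto simp: openin_open)
        moreover have "a \<in> P \<inter> (\<Inter>i\<in>N. {b. b i \<in> ball (a i) d})" using a N(2) by simp
        moreover have "P \<inter> (\<Inter>i\<in>N. {b. b i \<in> ball (a i) d}) \<subseteq> {a \<in> topspace (subtopology euclidean P). T a \<in> U}"
          using sub by (auto simp: dist_real_def abs_minus_commute)
        ultimately show "\<exists>S. openin (subtopology euclidean P) S \<and> a \<in> S \<and>
            S \<subseteq> {a \<in> topspace (subtopology euclidean P). T a \<in> U}" by blast
      qed
    qed
  qed
  moreover have "convex C"
  proof (rule convexI)
    fix x y and u v :: real assume "x \<in> C" "y \<in> C" "0 \<le> u" "0 \<le> v" "u + v = 1"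
    then show "u *\<^sub>R x + v *\<^sub>R y \<in> C"
      using P_convex[of "R x" "R y" u v] RC CY addY[of "u *\<^sub>R x" "v *\<^sub>R y"] scaleY[of x u] scaleY[of y v]
      by (intro CI) (auto simp: subset_iff)
  qed
  moreover have "C \<noteq> {}" using P(2) unfolding C_def by blast
  define act where "act t y = T (\<lambda>i. R y (idx t i))" for t y
  have act_C: "act t y \<in> C" if "y \<in> C" for t y
    unfolding act_def C_def using P_invariant[OF RC[OF that]] by blast
  have R_act: "R (act t y) = (\<lambda>i. R y (idx t i))" if "y \<in> C" for t y
    unfolding act_def using P_invariant[OF RC[OF that], of t] P(1) by (intro RT) auto
  have topC: "topspace (subtopology ?T C) = C" using CY by auto
  have act_ne: "p (act t x - act t y) \<le> p (x - y)" if "x \<in> C" "y \<in> C" for t x y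
  proof -
    have xy: "x \<in> Y" "y \<in> Y" "act t x \<in> Y" "act t y \<in> Y" using that act_C CY by auto
    show ?thesis
      using p_ge[OF diffY(1)[OF xy(1,2)]]
      by (simp add: p_le[OF diffY(1)[OF xy(3,4)]] diffY(2)[OF xy(3,4)] diffY(2)[OF xy(1,2)] R_act that)
  qed
  have "dynamical_system (subtopology ?T C) act"
    unfolding dynamical_system_def topC
  proof (intro conjI allI ballI)
    show "act s x \<in> C" if "x \<in> C" for s x using act_C that .
    \<comment> \<open>Precomposition reverses the order of maps; the reversed law required of
      \<open>idx\<close> compensates for this.\<close>
    show "act s (act t x) = act (s * t) x" if "x \<in> C" for s t x
      unfolding act_def[of s "act t x"] act_def[of "s * t"] R_act[OF that] idx ..
    show "continuous_map euclidean (subtopology ?T C) (\<lambda>s. act s x)" if x: "x \<in> C" for x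
      unfolding continuous_map_in_subtopology
    proof
      show "(\<lambda>s. act s x) \<in> topspace euclidean \<rightarrow> C" using act_C[OF x] by simp
      show "continuous_map euclidean ?T (\<lambda>s. act s x)"
        unfolding continuous_map_def
      proof (intro conjI allI impI)
        show "(\<lambda>s. act s x) \<in> topspace euclidean \<rightarrow> topspace ?T" using act_C[OF x] CY by auto
        fix U assume U: "openin ?T U"
        have "open {s. act s x \<in> U}"
        proof (subst open_subopen, intro ballI)
          fix t assume "t \<in> {s. act s x \<in> U}"
          then obtain e where e: "e > 0" "\<And>y. y \<in> Y \<Longrightarrow> p (y - act t x) < e \<Longrightarrow> y \<in> U" using U unfolding op by blast
          then have "e / 2 > 0" by simp
          then obtain W where W: "open W" "t \<in> W" "\<And>t' i. t' \<in> W \<Longrightarrow> \<bar>R x (idx t' i) - R x (idx t i)\<bar> \<le> e / 2"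
            using P_continuous[OF RC[OF x]] by meson
          have "act t' x \<in> U" if "t' \<in> W" for t'
          proof (rule e(2))
            show Y': "act t' x \<in> Y" using act_C x CY by blast
            have Y'': "act t x \<in> Y" using act_C x CY by blast
            have "p (act t' x - act t x) \<le> e / 2"
              using W(3)[OF that] unfolding p_le[OF diffY(1)[OF Y' Y'']] diffY(2)[OF Y' Y''] R_act[OF x] by simp
            then show "p (act t' x - act t x) < e" using e(1) by simp
          qed
          then show "\<exists>S. open S \<and> t \<in> S \<and> S \<subseteq> {s. act s x \<in> U}" using W by blast
        qed
        then show "openin euclidean {s \<in> topspace euclidean. act s x \<in> U}" by simp
      qed
    qed
    show "continuous_map (subtopology ?T C) (subtopology ?T C) (act s)" for s
      unfolding continuous_map_in_subtopology
    proof
      show "act s \<in> topspace (subtopology ?T C) \<rightarrow> C" using act_C by auto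
      show "continuous_map (subtopology ?T C) ?T (act s)"
        unfolding continuous_map_def
      proof (intro conjI allI impI)
        show "act s \<in> topspace (subtopology ?T C) \<rightarrow> topspace ?T" using act_C CY by auto
        fix U assume U: "openin ?T U"
        \<comment> \<open>A nonexpansive map is continuous with the same radius: \<open>V\<close> is
          the union of the balls whose radius works at the translated centre.\<close>
        define V where "V = {y \<in> Y. \<exists>x\<in>C. \<exists>e>0. p (y - x) < e \<and> (\<forall>z\<in>Y. p (z - act s x) < e \<longrightarrow> z \<in> U)}"
        have "openin ?T V"
          unfolding op
        proof (intro conjI ballI)
          fix y assume "y \<in> V"
          then obtain x e where xe: "y \<in> Y" "x \<in> C" "e > 0" "p (y - x) < e" "\<forall>z\<in>Y. p (z - act s x) < e \<longrightarrow> z \<in> U"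
            unfolding V_def by blast
          have "z \<in> V" if "z \<in> Y" "p (z - y) < e - p (y - x)" for z
          proof -
            have "p (z - x) < e"
              using seminorm_on_diff_triangle[OF p Y that(1) xe(1), of x] that xe CY by auto
            then show ?thesis unfolding V_def using xe that by blast
          qed
          then show "\<exists>e>0. \<forall>z\<in>Y. p (z - y) < e \<longrightarrow> z \<in> V"
            using xe by (intro exI[of _ "e - p (y - x)"]) auto
        qed (auto simp: V_def)
        moreover have "{x \<in> topspace (subtopology ?T C). act s x \<in> U} = V \<inter> C"
          unfolding topC
        proof (intro equalityI subsetI)
          fix x assume "x \<in> {x \<in> C. act s x \<in> U}"
          then have x: "x \<in> C" "act s x \<in> U" by auto
          then obtain e where "e > 0" "\<forall>z\<in>Y. p (z - act s x) < e \<longrightarrow> z \<in> U" using U unfolding op by blast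
          then show "x \<in> V \<inter> C"
            unfolding V_def using x CY seminorm_on_zero[OF p Y] by force
        next
          fix y assume "y \<in> V \<inter> C"
          then obtain x e where xe: "y \<in> C" "x \<in> C" "e > 0" "p (y - x) < e" "\<forall>z\<in>Y. p (z - act s x) < e \<longrightarrow> z \<in> U"
            unfolding V_def by blast
          then have "p (act s y - act s x) < e" using act_ne[OF xe(1,2), of s] by simp
          then show "y \<in> {x \<in> C. act s x \<in> U}" using xe act_C CY by blast
        qed
        ultimately show "openin (subtopology ?T C) {x \<in> topspace (subtopology ?T C). act s x \<in> U}"
          by (simp add: openin_subtopology_Int)
      qed
    qed
  qed
  moreover have "nonexpansive {p} C act" unfolding nonexpansive_def using act_ne by blast
  moreover have "locally_convex_space Y ?T" "determined_by_seminorms Y ?T {p}"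
    by (rule locally_convex_space_norm[OF Y p pos] determined_by_norm[OF Y p pos]; assumption)+
  ultimately have "has_fixed_point C act"
    using D[unfolded property_D_def, rule_format, of Y ?T "{p}" C act] CY \<open>C \<noteq> {}\<close> by simp
  then obtain y where y: "y \<in> C" "\<And>t. act t y = y" unfolding has_fixed_point_def by blast
  have "R y (idx t i) = R y i" for t i using R_act[OF y(1), of t] y(2)[of t] by metis
  with RC[OF y(1)] show thesis by (rule that)
qed

section \<open>Weakly convergent series and an embedding of the bounded sequences\<close>

context weak_system begin

text \<open>The weights sum to one, so a partial sum becomes a point of \<open>K\<close> once the
  remaining weight \<open>(1 / 2) ^ n\<close> is put on \<open>z 0\<close>. A weak cluster point of
  these points exists by compactness, and each functional identifies its value with the sum of the
  convergent scalar series.\<close>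

lemma weak_series:
  assumes z: "\<And>n. z n \<in> K"
  obtains y where "y \<in> K" "\<And>f. f \<in> dual \<Longrightarrow> (\<lambda>n. (1 / 2) ^ Suc n * f (z n)) sums f y"
proof -
  define y where "y n = (\<Sum>i<n. (1 / 2) ^ Suc i *\<^sub>R z i) + (1 / 2) ^ n *\<^sub>R z 0" for n :: nat
  have zX: "z n \<in> X" for n using z K_X by blast
  have fy: "(\<Sum>i<n. (1 / 2) ^ Suc i *\<^sub>R z i) \<in> X \<and>
      f (\<Sum>i<n. (1 / 2) ^ Suc i *\<^sub>R z i) = (\<Sum>i<n. (1 / 2) ^ Suc i * f (z i))" if "f \<in> dual" for f n
    by (induction n) (auto simp: dual_zero[OF that] dual_add[OF that] dual_scale[OF that] zX simp del: power_Suc)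
  have yK: "y n \<in> K" for n
  proof -
    \<comment> \<open>Written as a multiple of a point of \<open>K\<close> to cover
      \<open>n = 0\<close>, where the total weight vanishes; afterwards the total weight is at least
      \<open>1 / 2\<close> and may be divided by.\<close>
    have "\<exists>k\<in>K. (\<Sum>i<n. (1 / 2) ^ Suc i *\<^sub>R z i) = (1 - (1 / 2) ^ n) *\<^sub>R k"
    proof (induction n)
      case 0
      show ?case using z by auto
    next
      case (Suc n)
      then obtain k where k: "k \<in> K" "(\<Sum>i<n. (1 / 2) ^ Suc i *\<^sub>R z i) = (1 - (1 / 2) ^ n) *\<^sub>R k" by blast
      define a :: real where "a = 1 - (1 / 2) ^ Suc n"
      have "(1 / 2 :: real) ^ Suc n \<le> 1 / 2" using power_le_one[of "1 / 2 :: real" n] by simp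
      then have a: "a > 0" unfolding a_def by linarith
      have p1: "(1 / 2 :: real) ^ n \<le> 1" by (rule power_le_one) auto
      have a2: "(1 - (1 / 2) ^ n) / a + (1 / 2) ^ Suc n / a = 1"
        unfolding add_divide_distrib[symmetric] using a by (simp add: a_def)
      have "((1 - (1 / 2) ^ n) / a) *\<^sub>R k + ((1 / 2) ^ Suc n / a) *\<^sub>R z n \<in> K"
        using a p1 k z a2 by (intro convexD[OF convex_K]) auto
      moreover have "(\<Sum>i<Suc n. (1 / 2) ^ Suc i *\<^sub>R z i) =
          a *\<^sub>R (((1 - (1 / 2) ^ n) / a) *\<^sub>R k + ((1 / 2) ^ Suc n / a) *\<^sub>R z n)"
        using a by (simp add: k(2) scaleR_add_right del: power_Suc)
      ultimately show ?case unfolding a_def by blast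
    qed
    then obtain k where k: "k \<in> K" "y n = (1 - (1 / 2) ^ n) *\<^sub>R k + (1 / 2) ^ n *\<^sub>R z 0" unfolding y_def by metis
    have "(1 / 2 :: real) ^ n \<le> 1" by (rule power_le_one) auto
    then show ?thesis using convexD[OF convex_K k(1) z[of 0], of "1 - (1 / 2) ^ n" "(1 / 2) ^ n"] by (simp add: k(2))
  qed
  obtain l where l: "l \<in> K" "\<And>U N. openin weak U \<Longrightarrow> l \<in> U \<Longrightarrow> \<exists>n\<ge>N. y n \<in> U"
    using cluster_point_compactin[OF compact_K, of y, OF yK] by metis
  have lX: "l \<in> X" using l K_X by blast
  have "(\<lambda>n. (1 / 2) ^ Suc n * f (z n)) sums f l" if f: "f \<in> dual" for f
  proof -
    have "compact (f ` K)"
      using image_compactin[OF compact_K continuous_weak[OF f]] by simp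
    then have "bounded (f ` K)" by (rule compact_imp_bounded)
    then obtain B where "\<forall>r\<in>f ` K. norm r \<le> B" unfolding bounded_iff by blast
    then have B: "\<bar>f x\<bar> \<le> B" if "x \<in> K" for x using that by simp
    have summ: "summable (\<lambda>n. (1 / 2) ^ Suc n * f (z n))"
    proof (rule summable_comparison_test')
      show "summable (\<lambda>n. (1 / 2) ^ n * B)" by (intro summable_mult2 summable_geometric) simp
      fix n :: nat
      have "(1 / 2) ^ Suc n * \<bar>f (z n)\<bar> \<le> (1 / 2) ^ n * B"
        using B[OF z[of n]] by (intro mult_mono power_decreasing) auto
      then show "norm ((1 / 2) ^ Suc n * f (z n)) \<le> (1 / 2) ^ n * B" by (simp add: abs_mult)
    qed
    define S where "S = (\<Sum>n. (1 / 2) ^ Suc n * f (z n))"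
    have "(\<lambda>n. (\<Sum>i<n. (1 / 2) ^ Suc i * f (z i)) + (1 / 2) ^ n * f (z 0)) \<longlonglongrightarrow> S + 0 * f (z 0)"
      unfolding S_def
      by (intro tendsto_add tendsto_mult_right LIMSEQ_realpow_zero)
        (use summable_LIMSEQ[OF summ] in auto)
    moreover have "f (y n) = (\<Sum>i<n. (1 / 2) ^ Suc i * f (z i)) + (1 / 2) ^ n * f (z 0)" for n
      unfolding y_def using fy[OF f, of n] by (simp add: dual_add[OF f] dual_scale[OF f] zX)
    ultimately have lim: "(\<lambda>n. f (y n)) \<longlonglongrightarrow> S" by simp
    have "f l = S"
    proof (rule ccontr)
      assume "f l \<noteq> S"
      then have e: "\<bar>f l - S\<bar> / 2 > 0" by simp
      from LIMSEQ_D[OF lim e] obtain N where N: "\<And>n. n \<ge> N \<Longrightarrow> \<bar>f (y n) - S\<bar> < \<bar>f l - S\<bar> / 2" by auto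
      obtain n where n: "n \<ge> N" "y n \<in> {x \<in> X. f x \<in> ball (f l) (\<bar>f l - S\<bar> / 2)}"
        using l(2)[OF openin_weak_functional[OF f, of "ball (f l) (\<bar>f l - S\<bar> / 2)"], of N] lX e by auto
      then have "\<bar>f l - f (y n)\<bar> < \<bar>f l - S\<bar> / 2" by (simp add: dist_real_def)
      with N[OF n(1)] show False
        using abs_triangle_ineq[of "f l - f (y n)" "f (y n) - S"] by simp
    qed
    then show ?thesis using summable_sums[OF summ] unfolding S_def by simp
  qed
  with l(1) show thesis by (rule that)
qed

text \<open>The image of a bounded sequence is the weak sum of \<open>2\<^sup>-\<^sup>(\<^sup>n\<^sup>+\<^sup>1\<^sup>) a n (k n - l n)\<close>, where
  \<open>k n, l n \<in> K\<close> and functionals \<open>g n\<close> form a triangular system; this makes the map injective.\<close>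

lemma embed_bounded_sequences:
  assumes inf: "\<And>\<Phi>. finite \<Phi> \<Longrightarrow> \<Phi> \<subseteq> dual \<Longrightarrow> \<exists>k\<in>K. \<exists>l\<in>K. k \<noteq> l \<and> (\<forall>f\<in>\<Phi>. f k = f l)"
  obtains T :: "(nat \<Rightarrow> real) \<Rightarrow> 'v"
  where "\<And>a b. Bseq a \<Longrightarrow> Bseq b \<Longrightarrow> T (\<lambda>n. a n + b n) = T a + T b"
    "\<And>a c. Bseq a \<Longrightarrow> T (\<lambda>n. c * a n) = c *\<^sub>R T a"
    "\<And>a n. Bseq a \<Longrightarrow> T a = 0 \<Longrightarrow> a n = 0"
proof -
  have "\<exists>k l g. k \<in> K \<and> l \<in> K \<and> g \<in> dual \<and> g (k - l) \<noteq> 0 \<and> (\<forall>f\<in>\<Phi>. f (k - l) = 0)"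
    if \<Phi>: "finite \<Phi>" "\<Phi> \<subseteq> dual" for \<Phi>
  proof -
    obtain k l where kl: "k \<in> K" "l \<in> K" "k \<noteq> l" "\<forall>f\<in>\<Phi>. f k = f l" using inf[OF \<Phi>] by blast
    then have X: "k \<in> X" "l \<in> X" using K_X by auto
    then obtain g where "g \<in> dual" "g (k - l) \<noteq> 0" using dual_separates[of "k - l"] kl(3) by auto
    moreover have "\<forall>f\<in>\<Phi>. f (k - l) = 0" using kl(4) X \<Phi>(2) by (auto simp: dual_diff subset_iff)
    ultimately show ?thesis using kl by blast
  qed
  then obtain k0 l0 g0 where step: "\<And>\<Phi>. finite \<Phi> \<Longrightarrow> \<Phi> \<subseteq> dual \<Longrightarrow> k0 \<Phi> \<in> K \<and> l0 \<Phi> \<in> K \<and> g0 \<Phi> \<in> dual \<and>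
      g0 \<Phi> (k0 \<Phi> - l0 \<Phi>) \<noteq> 0 \<and> (\<forall>f\<in>\<Phi>. f (k0 \<Phi> - l0 \<Phi>) = 0)"
    by metis
  \<comment> \<open>Each new pair is chosen indistinguishable by all earlier functionals and is then
    separated by a new one; this produces the triangular shape.\<close>
  define \<Phi> where "\<Phi> = rec_nat {} (\<lambda>_ \<Phi>. insert (g0 \<Phi>) \<Phi>)"
  have \<Phi>_Suc: "\<Phi> (Suc n) = insert (g0 (\<Phi> n)) (\<Phi> n)" and \<Phi>_0: "\<Phi> 0 = {}" for n unfolding \<Phi>_def by auto
  have \<Phi>: "finite (\<Phi> n) \<and> \<Phi> n \<subseteq> dual" for n
    by (induction n) (use step in \<open>auto simp: \<Phi>_Suc \<Phi>_0\<close>)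
  define k l g where "k n = k0 (\<Phi> n)" and "l n = l0 (\<Phi> n)" and "g n = g0 (\<Phi> n)" for n
  have kl: "k n \<in> K" "l n \<in> K" "g n \<in> dual" "g n (k n - l n) \<noteq> 0" for n
    using step \<Phi> unfolding k_def l_def g_def by blast+
  have g_in: "g m \<in> \<Phi> n" if "m < n" for m n
    using that by (induction n) (auto simp: \<Phi>_Suc g_def less_Suc_eq)
  have tri: "g m (k n - l n) = 0" if "m < n" for m n
    using step[of "\<Phi> n"] \<Phi>[of n] g_in[OF that] unfolding k_def l_def by blast
  define v where "v n = k n - l n" for n
  have klX: "k n \<in> X" "l n \<in> X" "v n \<in> X" for n using kl(1,2)[of n] K_X unfolding v_def by auto
  \<comment> \<open>The weak sum is first a relation. The dual separates points, so it is
    single-valued, and linearity can be checked on functionals.\<close>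
  define S where "S a y \<longleftrightarrow> y \<in> X \<and> (\<forall>f\<in>dual. (\<lambda>n. (1 / 2) ^ Suc n * (a n * f (v n))) sums f y)" for a y
  have S_unique: "y = z" if "S a y" "S a z" for a y z
  proof -
    have X: "y \<in> X" "z \<in> X" using that unfolding S_def by auto
    have "f (y - z) = 0" if "f \<in> dual" for f
      using \<open>S a y\<close> \<open>S a z\<close> that X sums_unique2 unfolding S_def by (fastforce simp: dual_diff)
    then have "y - z = 0" by (rule dual_separates[rotated]) (use X in auto)
    then show ?thesis by simp
  qed
  have S_add: "S (\<lambda>n. a n + b n) (y + z)" if "S a y" "S b z" for a b y z
    unfolding S_def
  proof (intro conjI ballI)
    show "y + z \<in> X" using that unfolding S_def by auto
    fix f assume f: "f \<in> dual"
    have "(\<lambda>n. (1 / 2) ^ Suc n * (a n * f (v n)) + (1 / 2) ^ Suc n * (b n * f (v n))) sums (f y + f z)"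
      using that f unfolding S_def by (intro sums_add) auto
    then show "(\<lambda>n. (1 / 2) ^ Suc n * ((a n + b n) * f (v n))) sums f (y + z)"
      using that f unfolding S_def by (simp add: dual_add algebra_simps)
  qed
  have S_scale: "S (\<lambda>n. c * a n) (c *\<^sub>R y)" if "S a y" for a y c
    unfolding S_def
  proof (intro conjI ballI)
    show "c *\<^sub>R y \<in> X" using that unfolding S_def by auto
    fix f assume f: "f \<in> dual"
    have "(\<lambda>n. c * ((1 / 2) ^ Suc n * (a n * f (v n)))) sums (c * f y)"
      using that f unfolding S_def by (intro sums_mult) auto
    then show "(\<lambda>n. (1 / 2) ^ Suc n * ((c * a n) * f (v n))) sums f (c *\<^sub>R y)"
      using that f unfolding S_def by (simp add: dual_scale algebra_simps)
  qed
  \<comment> \<open>For a coefficient in the unit interval, \<open>a n *\<^sub>R v n\<close> is the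
    difference of a point on the segment from \<open>l n\<close> to \<open>k n\<close> and of
    \<open>l n\<close>. Both series have terms in \<open>K\<close>, so each converges
    weakly.\<close>
  have S_unit: "\<exists>y. S a y" if a: "\<And>n. 0 \<le> a n" "\<And>n. a n \<le> 1" for a
  proof -
    define z where "z n = a n *\<^sub>R k n + (1 - a n) *\<^sub>R l n" for n
    have "z n \<in> K" for n unfolding z_def using a kl by (intro convexD[OF convex_K]) auto
    then obtain y where y: "y \<in> K" "\<And>f. f \<in> dual \<Longrightarrow> (\<lambda>n. (1 / 2) ^ Suc n * f (z n)) sums f y"
      using weak_series by blast
    obtain y0 where y0: "y0 \<in> K" "\<And>f. f \<in> dual \<Longrightarrow> (\<lambda>n. (1 / 2) ^ Suc n * f (l n)) sums f y0"
      using weak_series[of l] kl(2) by blast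
    have X: "y \<in> X" "y0 \<in> X" using y y0 K_X by auto
    have "(\<lambda>n. (1 / 2) ^ Suc n * (a n * f (v n))) sums f (y - y0)" if f: "f \<in> dual" for f
    proof -
      have "f (z n) - f (l n) = a n * f (v n)" for n
        unfolding z_def v_def using f klX[of n] by (simp add: dual_add dual_scale dual_diff algebra_simps)
      then have "(1 / 2) ^ Suc n * f (z n) - (1 / 2) ^ Suc n * f (l n) = (1 / 2) ^ Suc n * (a n * f (v n))" for n
        by (metis right_diff_distrib)
      then show ?thesis
        using sums_diff[OF y(2)[OF f] y0(2)[OF f]] X f by (simp only: dual_diff)
    qed
    then have "S a (y - y0)" unfolding S_def using X by auto
    then show ?thesis by blast
  qed
  \<comment> \<open>An affine change of scale moves a bounded sequence into the unit interval; the
    constant sequence \<open>1\<close> undoes it.\<close>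
  have S_ex: "\<exists>y. S a y" if "Bseq a" for a
  proof -
    obtain B where B: "B > 0" "\<And>n. \<bar>a n\<bar> \<le> B" using \<open>Bseq a\<close> unfolding Bseq_def by auto
    have "\<bar>a n\<bar> / B \<le> 1" for n using B by (simp add: field_simps)
    then have b: "0 \<le> (a n / B + 1) / 2" "(a n / B + 1) / 2 \<le> 1" for n
      using B(1) abs_le_iff[of "a n / B" 1] by (auto simp: abs_divide)
    obtain y where y: "S (\<lambda>n. (a n / B + 1) / 2) y" using S_unit[of "\<lambda>n. (a n / B + 1) / 2"] b by blast
    obtain z where z: "S (\<lambda>n. 1) z" using S_unit[of "\<lambda>n. 1"] by auto
    have "S (\<lambda>n. (2 * B) * ((a n / B + 1) / 2) + (- B) * 1) ((2 * B) *\<^sub>R y + (- B) *\<^sub>R z)"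
      by (intro S_add S_scale y z)
    moreover have "(2 * B) * ((a n / B + 1) / 2) + (- B) * 1 = a n" for n using B(1) by (simp add: field_simps)
    ultimately show ?thesis by auto
  qed
  \<comment> \<open>Under \<open>g n\<close> the terms before \<open>n\<close> vanish by induction
    and those after \<open>n\<close> by triangularity, which isolates the coefficient
    \<open>a n\<close>.\<close>
  have S_inj: "a n = 0" if "S a 0" for a n
  proof (induction n rule: less_induct)
    case (less n)
    have "(\<lambda>i. (1 / 2) ^ Suc i * (a i * g n (v i))) sums g n 0" using that kl(3) unfolding S_def by blast
    moreover have "(1 / 2) ^ Suc i * (a i * g n (v i)) = 0" if "i \<noteq> n" for i
      using that less[of i] tri[of n i] unfolding v_def by (cases "i < n") auto
    then have "(\<lambda>i. (1 / 2) ^ Suc i * (a i * g n (v i))) sums (\<Sum>i\<in>{n}. (1 / 2) ^ Suc i * (a i * g n (v i)))"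
      by (intro sums_finite) auto
    ultimately have "(1 / 2) ^ Suc n * (a n * g n (v n)) = 0"
      using sums_unique2 dual_zero[OF kl(3)] by fastforce
    then show ?case using kl(4)[of n] unfolding v_def by simp
  qed
  define T where "T a = (SOME y. S a y)" for a
  have T: "S a (T a)" if "Bseq a" for a unfolding T_def using S_ex[OF that] by (rule someI_ex)
  have Bseq_sum: "Bseq (\<lambda>n. a n + b n)" if ab: "Bseq a" "Bseq b" for a b :: "nat \<Rightarrow> real"
  proof -
    obtain B C where "\<And>n. \<bar>a n\<bar> \<le> B" "\<And>n. \<bar>b n\<bar> \<le> C" using ab unfolding Bseq_def by auto
    then have "norm (a n + b n) \<le> B + C" for n
      using abs_triangle_ineq[of "a n" "b n"] by (metis add_mono order_trans real_norm_def)
    then show ?thesis by (rule BseqI')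
  qed
  have Bseq_times: "Bseq (\<lambda>n. c * a n)" if a: "Bseq a" for c :: real and a :: "nat \<Rightarrow> real"
  proof -
    obtain B where "\<And>n. \<bar>a n\<bar> \<le> B" using a unfolding Bseq_def by auto
    then have "norm (c * a n) \<le> \<bar>c\<bar> * B" for n by (simp add: abs_mult mult_left_mono)
    then show ?thesis by (rule BseqI')
  qed
  show thesis
  proof (rule that[of T])
    show "T (\<lambda>n. a n + b n) = T a + T b" if "Bseq a" "Bseq b" for a b
      by (rule S_unique[OF T[OF Bseq_sum[OF that]] S_add[OF T[OF that(1)] T[OF that(2)]]])
    show "T (\<lambda>n. c * a n) = c *\<^sub>R T a" if "Bseq a" for a c
      by (rule S_unique[OF T[OF Bseq_times[OF that]] S_scale[OF T[OF that]]])
    show "a n = 0" if "Bseq a" "T a = 0" for a n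
      using T[OF that(1)] that(2) S_inj by simp
  qed
qed

end

subsection \<open>Invariant means\<close>

text \<open>The functions \<open>i \<mapsto> m (H i)\<close>, where \<open>m\<close> is a mean on the functions on \<open>F\<close>.\<close>

definition mean_functions :: "'a set \<Rightarrow> ('i \<Rightarrow> 'a \<Rightarrow> real) \<Rightarrow> ('i \<Rightarrow> real) set" where
  "mean_functions F H = {a. \<forall>(n::nat) c j B.
     (\<forall>x\<in>F. (\<Sum>k<n. c k * H (j k) x) \<le> B) \<longrightarrow> (\<Sum>k<n. c k * a (j k)) \<le> B}"

lemma mean_functionsD:
  assumes "a \<in> mean_functions F H" "\<And>x. x \<in> F \<Longrightarrow> (\<Sum>k<n::nat. c k * H (j k) x) \<le> B"
  shows "(\<Sum>k<n. c k * a (j k)) \<le> B"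
  using assms unfolding mean_functions_def by blast

lemma mean_le:
  assumes "a \<in> mean_functions F H" "\<And>x. x \<in> F \<Longrightarrow> H i x \<le> B"
  shows "a i \<le> B"
  using mean_functionsD[OF assms(1), of "\<lambda>_. 1" "\<lambda>_. i" 1 B] assms(2) by simp

lemma mean_ge:
  assumes "a \<in> mean_functions F H" "\<And>x. x \<in> F \<Longrightarrow> B \<le> H i x"
  shows "B \<le> a i"
  using mean_functionsD[OF assms(1), of "\<lambda>_. - 1" "\<lambda>_. i" 1 "- B"] assms(2) by simp

lemma mean_dist:
  assumes a: "a \<in> mean_functions F H" and "\<And>x. x \<in> F \<Longrightarrow> \<bar>H i x - H j x\<bar> \<le> B"
  shows "\<bar>a i - a j\<bar> \<le> B"
proof -
  have diff: "a i - a j \<le> B" if "\<And>x. x \<in> F \<Longrightarrow> H i x - H j x \<le> B" for i j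
    using mean_functionsD[OF a, of "\<lambda>k. if k = 0 then 1 else - 1" "\<lambda>k. if k = 0 then i else j" 2 B] that
    by (simp add: numeral_2_eq_2)
  have "a i - a j \<le> B" "a j - a i \<le> B"
    by (rule diff, use assms(2) in \<open>force simp: abs_le_iff\<close>)+
  then show ?thesis by simp
qed

lemma mean_sum_ge:
  fixes H :: "'i \<Rightarrow> 'a \<Rightarrow> real"
  assumes a: "a \<in> mean_functions F H" and I: "finite I" "\<And>x. x \<in> F \<Longrightarrow> B \<le> (\<Sum>i\<in>I. H i x)"
  shows "B \<le> (\<Sum>i\<in>I. a i)"
proof -
  obtain j where "bij_betw j {0..<card I} I" using ex_bij_betw_nat_finite[OF I(1)] by blast
  then have j: "bij_betw j {..<card I} I" by (simp add: atLeast0LessThan)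
  have eq: "(\<Sum>k<card I. - 1 * g (j k)) = - (\<Sum>i\<in>I. g i)" for g :: "'i \<Rightarrow> real"
    using sum.reindex_bij_betw[OF j, of g] by (simp add: sum_negf)
  have "(\<Sum>k<card I. - 1 * a (j k)) \<le> - B"
  proof (rule mean_functionsD[OF a])
    fix x assume "x \<in> F"
    then show "(\<Sum>k<card I. - 1 * H (j k) x) \<le> - B"
      using I(2)[of x] eq[of "\<lambda>i. H i x"] by simp
  qed
  then show ?thesis unfolding eq by simp
qed

lemma mean_functions_point: "x \<in> F \<Longrightarrow> (\<lambda>i. H i x) \<in> mean_functions F H"
  unfolding mean_functions_def by blast

lemma mean_functions_convex:
  assumes "a \<in> mean_functions F H" "b \<in> mean_functions F H" "0 \<le> u" "0 \<le> v" "u + v = 1"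
  shows "(\<lambda>i. u * a i + v * b i) \<in> mean_functions F H"
  unfolding mean_functions_def
proof (intro CollectI allI impI)
  fix n :: nat and c j B assume *: "\<forall>x\<in>F. (\<Sum>k<n. c k * H (j k) x) \<le> B"
  have "(\<Sum>k<n. c k * (u * a (j k) + v * b (j k))) = u * (\<Sum>k<n. c k * a (j k)) + v * (\<Sum>k<n. c k * b (j k))"
    by (simp add: sum.distrib sum_distrib_left algebra_simps)
  also have "\<dots> \<le> u * B + v * B"
    using mean_functionsD[OF assms(1), of c j n B] mean_functionsD[OF assms(2), of c j n B] * assms(3,4)
    by (intro add_mono mult_left_mono) auto
  also have "\<dots> = B" using assms(5) by (simp flip: distrib_right)
  finally show "(\<Sum>k<n. c k * (u * a (j k) + v * b (j k))) \<le> B" .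
qed

text \<open>Reindexing by \<open>r\<close> is composition of the functions with \<open>g\<close>,
  and the push-forward of a mean along a self-map of \<open>F\<close> is again a mean.\<close>

lemma mean_functions_shift:
  assumes a: "a \<in> mean_functions F H" and g: "\<And>x. x \<in> F \<Longrightarrow> g x \<in> F" "\<And>i x. x \<in> F \<Longrightarrow> H (r i) x = H i (g x)"
  shows "(\<lambda>i. a (r i)) \<in> mean_functions F H"
  unfolding mean_functions_def
proof (intro CollectI allI impI)
  fix n :: nat and c j B assume *: "\<forall>x\<in>F. (\<Sum>k<n. c k * H (j k) x) \<le> B"
  show "(\<Sum>k<n. c k * a (r (j k))) \<le> B"
    by (rule mean_functionsD[OF a]) (use * g in auto)
qed

text \<open>The defining inequalities are closed conditions on finitely many coordinates and confine
  the functions to a cube, which is compact by Tychonoff's theorem.\<close>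

lemma compact_mean_functions:
  fixes H :: "'i \<Rightarrow> 'a \<Rightarrow> real"
  assumes H: "\<And>i x. x \<in> F \<Longrightarrow> 0 \<le> H i x \<and> H i x \<le> 1"
  shows "compact (mean_functions F H)"
proof -
  have "compactin (product_topology (\<lambda>_. euclideanreal) UNIV) (PiE UNIV (\<lambda>_ :: 'i. {0..1::real}))"
    by (simp add: compactin_PiE)
  then have cube: "compact (PiE UNIV (\<lambda>_ :: 'i. {0..1::real}))"
    by (simp add: euclidean_product_topology)
  have "closed {a :: 'i \<Rightarrow> real. (\<Sum>k<n. c k * a (j k)) \<le> B}" for n :: nat and c B and j :: "nat \<Rightarrow> 'i"
  proof (rule closed_Collect_le)
    show "continuous_on UNIV (\<lambda>a. \<Sum>k<n. c k * a (j k))"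
      by (intro continuous_on_sum continuous_on_mult continuous_on_const continuous_on_product_coordinates)
    show "continuous_on UNIV (\<lambda>a. B)" by (rule continuous_on_const)
  qed
  then have "closed (\<Inter>(n::nat, c, j, B) \<in> {(n, c, j, B). \<forall>x\<in>F. (\<Sum>k<n. c k * H (j k) x) \<le> B}.
      {a. (\<Sum>k<n. c k * a (j k)) \<le> B})"
    by (intro closed_INT) auto
  moreover have "mean_functions F H = (\<Inter>(n::nat, c, j, B) \<in> {(n, c, j, B). \<forall>x\<in>F. (\<Sum>k<n. c k * H (j k) x) \<le> B}.
      {a. (\<Sum>k<n. c k * a (j k)) \<le> B})"
    unfolding mean_functions_def by auto
  ultimately have "closed (mean_functions F H)" by simp
  moreover have "mean_functions F H \<subseteq> PiE UNIV (\<lambda>_. {0..1})"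
  proof
    fix a assume a: "a \<in> mean_functions F H"
    have "0 \<le> a i" "a i \<le> 1" for i
      using mean_ge[OF a, of 0 i] mean_le[OF a, of i 1] H by auto
    then show "a \<in> PiE UNIV (\<lambda>_. {0..1})" by auto
  qed
  ultimately show ?thesis
    using compact_Int_closed[OF cube, of "mean_functions F H"] by (simp add: Int_absorb1)
qed

text \<open>Total boundedness passes from one variable of \<open>H\<close> to the other: an index is
  known up to \<open>e\<close> once its values on a finite net of \<open>F\<close> are known up to
  \<open>e / 3\<close>.\<close>

lemma finite_index_net:
  assumes H: "\<And>i x. x \<in> F \<Longrightarrow> 0 \<le> H i x \<and> H i x \<le> (1::real)"
    and pre: "\<And>e. e > 0 \<Longrightarrow> \<exists>A. finite A \<and> A \<subseteq> F \<and> (\<forall>y\<in>F. \<exists>x\<in>A. \<forall>i. \<bar>H i y - H i x\<bar> \<le> e)"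
    and e: "e > 0"
  obtains N where "finite N" "\<And>i. \<exists>j\<in>N. \<forall>x\<in>F. \<bar>H i x - H j x\<bar> \<le> e"
proof -
  have "e / 3 > 0" using e by simp
  then obtain A where A: "finite A" "A \<subseteq> F" "\<And>y. y \<in> F \<Longrightarrow> \<exists>x\<in>A. \<forall>i. \<bar>H i y - H i x\<bar> \<le> e / 3"
    using pre by meson
  \<comment> \<open>Values are rounded to cells of width \<open>e / 3\<close>. As they lie between 0
    and 1, only finitely many rounded patterns occur, and one index is kept for each.\<close>
  define g where "g i = (\<lambda>x\<in>A. \<lfloor>H i x / (e / 3)\<rfloor>)" for i
  have "range g \<subseteq> PiE A (\<lambda>_. {0..\<lfloor>1 / (e / 3)\<rfloor>})"
  proof (clarify, rule PiE_I)
    fix i x assume "x \<in> A"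
    then have "0 \<le> H i x / (e / 3)" "H i x / (e / 3) \<le> 1 / (e / 3)"
      using H[of x i] A(2) e by (auto intro!: divide_right_mono)
    then show "g i x \<in> {0..\<lfloor>1 / (e / 3)\<rfloor>}" using \<open>x \<in> A\<close> by (simp add: g_def floor_mono)
  qed (simp add: g_def)
  then have "finite (range g)" using A(1) by (rule finite_subset[OF _ finite_PiE]) auto
  then obtain N where N: "finite N" "range g = g ` N" by (metis finite_subset_image subset_refl)
  show thesis
  proof (rule that[OF N(1)])
    fix i
    obtain j where j: "j \<in> N" "g i = g j" using N(2) by (metis imageE rangeI)
    have close: "\<bar>H i x - H j x\<bar> \<le> e / 3" if "x \<in> A" for x
    proof -
      have "\<lfloor>H i x / (e / 3)\<rfloor> = \<lfloor>H j x / (e / 3)\<rfloor>" using fun_cong[OF j(2), of x] that by (simp add: g_def)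
      then have "\<bar>H i x / (e / 3) - H j x / (e / 3)\<bar> < 1" by linarith
      then have "\<bar>H i x - H j x\<bar> / \<bar>e / 3\<bar> < 1" unfolding diff_divide_distrib[symmetric] abs_divide .
      then show ?thesis using pos_divide_less_eq[of "e / 3" "\<bar>H i x - H j x\<bar>" 1] e by simp
    qed
    have "\<bar>H i y - H j y\<bar> \<le> e" if y: "y \<in> F" for y
    proof -
      obtain x where "x \<in> A" "\<And>i. \<bar>H i y - H i x\<bar> \<le> e / 3" using A(3)[OF y] by blast
      from this(2)[of i] this(2)[of j] close[OF this(1)] show ?thesis by linarith
    qed
    then show "\<exists>j\<in>N. \<forall>x\<in>F. \<bar>H i x - H j x\<bar> \<le> e" using j(1) by blast
  qed
qed

context weak_system begin

text \<open>If \<open>act t\<close> is not onto, take \<open>h \<ge> 0\<close> vanishing on \<open>act t ` F\<close> but not on \<open>F\<close>. Property (D)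
  yields a mean that is invariant on the orbit of \<open>h\<close>. It vanishes on \<open>h \<circ> act t\<close>, hence on all
  translates of \<open>h\<close>, although finitely many of these have a sum bounded below. The index
  \<open>None\<close> stands for \<open>h\<close> itself and \<open>Some s\<close> for \<open>h \<circ> act s\<close>.\<close>

lemma minimal_surjective:
  assumes D: "property_D TYPE('s) TYPE('v)"
    and inf: "\<And>\<Phi>. finite \<Phi> \<Longrightarrow> \<Phi> \<subseteq> dual \<Longrightarrow> \<exists>k\<in>K. \<exists>l\<in>K. k \<noteq> l \<and> (\<forall>f\<in>\<Phi>. f k = f l)"
    and F: "minimal_set F"
  shows "act t ` F = F"
proof (rule ccontr)
  assume neq: "act t ` F \<noteq> F"
  have invF: "invariant_set F" using F unfolding minimal_set_def by blast
  have FK: "F \<subseteq> K" "F \<noteq> {}" and act_F: "\<And>s x. x \<in> F \<Longrightarrow> act s x \<in> F"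
    using invF unfolding invariant_set_def by auto
  have FX: "F \<subseteq> X" using FK K_X by blast
  have Fc: "compactin weak F" using invariant_compact[OF invF] .
  obtain x0 where x0: "x0 \<in> F" "x0 \<notin> act t ` F" using neq act_F by blast
  have x0X: "x0 \<in> X" using x0 FX by blast
  have "compactin (subtopology weak K) F" using Fc FK by (simp add: compactin_subtopology)
  then have "compactin (subtopology weak K) (act t ` F)" by (rule image_compactin[OF _ continuous_act])
  then have "compactin weak (act t ` F)" by (simp add: compactin_subtopology)
  then have "closedin weak (act t ` F)" using compactin_imp_closedin[OF Hausdorff_weak] by blast
  then have "openin weak (X - act t ` F)" unfolding closedin_def by simp
  then obtain \<Phi> e where \<Phi>: "finite \<Phi>" "\<Phi> \<subseteq> dual" and e: "0 < e"
    and sep: "\<And>y. y \<in> X \<Longrightarrow> (\<And>f. f \<in> \<Phi> \<Longrightarrow> \<bar>f (y - x0)\<bar> < e) \<Longrightarrow> y \<notin> act t ` F"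
    using x0 x0X unfolding openin_weak by (metis DiffD2 DiffI)
  define q where "q z = (\<Sum>f\<in>\<Phi>. \<bar>f z\<bar>)" for z
  define h where "h x = max 0 (1 - q (x - x0) / e)" for x
  have q0: "0 \<le> q z" for z unfolding q_def by (intro sum_nonneg) auto
  have h01: "0 \<le> h x" "h x \<le> 1" for x unfolding h_def using q0 e by auto
  have "q 0 = 0" unfolding q_def using \<Phi>(2) by (intro sum.neutral) (auto simp: dual_zero subset_iff)
  then have hx0: "h x0 = 1" unfolding h_def by simp
  have h_zero: "h x = 0" if x: "x \<in> act t ` F" for x
  proof -
    have "e \<le> q (x - x0)"
    proof (rule ccontr)
      assume "\<not> e \<le> q (x - x0)"
      moreover have "\<bar>f (x - x0)\<bar> \<le> q (x - x0)" if "f \<in> \<Phi>" for f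
        unfolding q_def using that \<Phi>(1) by (intro member_le_sum) auto
      ultimately have "x \<notin> act t ` F" using x act_F FX by (intro sep) force+
      then show False using x by simp
    qed
    then show ?thesis unfolding h_def using e by (simp add: field_simps)
  qed
  have h_unif: "\<exists>\<delta>>0. \<forall>x\<in>X. \<forall>y\<in>X. (\<forall>f\<in>\<Phi>. \<bar>f (x - y)\<bar> < \<delta>) \<longrightarrow> \<bar>h x - h y\<bar> \<le> \<epsilon>" if \<epsilon>: "\<epsilon> > 0" for \<epsilon>
  proof (intro exI conjI ballI impI)
    \<comment> \<open>The sum \<open>q\<close> changes by at most \<open>card \<Phi>\<close> times
      this amount, hence \<open>h\<close> by at most \<epsilon>; the summand \<open>+ 1\<close>
      covers the case of empty \<Phi>.\<close>
    let ?\<delta> = "\<epsilon> * e / (card \<Phi> + 1)"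
    show "?\<delta> > 0" using \<epsilon> e by simp
    fix x y assume xy: "x \<in> X" "y \<in> X" and small: "\<forall>f\<in>\<Phi>. \<bar>f (x - y)\<bar> < ?\<delta>"
    have "\<bar>q (x - x0) - q (y - x0)\<bar> \<le> (\<Sum>f\<in>\<Phi>. \<bar>\<bar>f (x - x0)\<bar> - \<bar>f (y - x0)\<bar>\<bar>)"
      unfolding q_def sum_subtractf[symmetric] by (rule sum_abs)
    also have "\<dots> \<le> (\<Sum>f\<in>\<Phi>. ?\<delta>)"
    proof (rule sum_mono)
      fix f assume f: "f \<in> \<Phi>"
      then have "f (x - x0) - f (y - x0) = f (x - y)" using \<Phi>(2) xy x0X by (simp add: dual_diff subset_iff)
      then show "\<bar>\<bar>f (x - x0)\<bar> - \<bar>f (y - x0)\<bar>\<bar> \<le> ?\<delta>"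
        using small f abs_triangle_ineq3[of "f (x - x0)" "f (y - x0)"] by fastforce
    qed
    also have "\<dots> = card \<Phi> * ?\<delta>" by simp
    also have "\<dots> \<le> (card \<Phi> + 1) * ?\<delta>" using \<open>?\<delta> > 0\<close> by (intro mult_right_mono) auto
    also have "\<dots> = \<epsilon> * e" by (simp add: field_simps)
    finally have "\<bar>q (x - x0) - q (y - x0)\<bar> / e \<le> \<epsilon>" using e by (simp add: field_simps)
    then have "\<bar>q (x - x0) / e - q (y - x0) / e\<bar> \<le> \<epsilon>" using e by (simp add: abs_divide flip: diff_divide_distrib)
    then show "\<bar>h x - h y\<bar> \<le> \<epsilon>" unfolding h_def by (auto simp: max_def abs_if split: if_splits)
  qed
  define H where "H i x = (case i of None \<Rightarrow> h x | Some s \<Rightarrow> h (act s x))" for i :: "'s option" and x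
  \<comment> \<open>Chosen so that evaluating at \<open>idx s i\<close> means applying
    \<open>act s\<close> before the function with index \<open>i\<close>; the order of the product
    follows from this.\<close>
  define idx where "idx t i = Some (case i of None \<Rightarrow> t | Some s \<Rightarrow> s * t)" for t :: 's and i
  have H_idx: "H (idx s i) x = H i (act s x)" if "x \<in> F" for s i x
    using act_act[of x] that FK by (auto simp: H_def idx_def split: option.split)
  have H01: "0 \<le> H i x \<and> H i x \<le> 1" for i x unfolding H_def using h01 by (auto split: option.split)
  have H_close: "\<bar>H i x - H i y\<bar> \<le> \<epsilon>"
    if "x \<in> X" "y \<in> X" "\<And>s. act s x \<in> X" "\<And>s. act s y \<in> X"
      and "\<And>x y. x \<in> X \<Longrightarrow> y \<in> X \<Longrightarrow> (\<And>f. f \<in> \<Phi> \<Longrightarrow> \<bar>f (x - y)\<bar> < \<delta>) \<Longrightarrow> \<bar>h x - h y\<bar> \<le> \<epsilon>"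
      and "\<And>f. f \<in> \<Phi> \<Longrightarrow> \<bar>f (x - y)\<bar> < \<delta>" "\<And>f s. f \<in> \<Phi> \<Longrightarrow> \<bar>f (act s x - act s y)\<bar> < \<delta>" for x y \<epsilon> \<delta> i
    unfolding H_def using that by (auto split: option.split)
  have act_X: "act s x \<in> X" "x \<in> X" if "x \<in> F" for s x using act_F FX that by auto
  have pre: "\<exists>A. finite A \<and> A \<subseteq> F \<and> (\<forall>y\<in>F. \<exists>x\<in>A. \<forall>i. \<bar>H i y - H i x\<bar> \<le> \<epsilon>)" if \<epsilon>: "\<epsilon> > 0" for \<epsilon>
  proof -
    obtain \<delta> where \<delta>: "\<delta> > 0" "\<And>x y. x \<in> X \<Longrightarrow> y \<in> X \<Longrightarrow> (\<And>f. f \<in> \<Phi> \<Longrightarrow> \<bar>f (x - y)\<bar> < \<delta>) \<Longrightarrow> \<bar>h x - h y\<bar> \<le> \<epsilon>"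
      using h_unif[OF \<epsilon>] by blast
    obtain A where A: "finite A" "A \<subseteq> F"
      "\<And>y. y \<in> F \<Longrightarrow> \<exists>x\<in>A. \<forall>f\<in>\<Phi>. \<bar>f (y - x)\<bar> < \<delta> \<and> (\<forall>s. \<bar>f (act s y - act s x)\<bar> < \<delta>)"
      using equicontinuous_cover[OF Fc FK(1) \<Phi> \<delta>(1)] by blast
    have "\<exists>x\<in>A. \<forall>i. \<bar>H i y - H i x\<bar> \<le> \<epsilon>" if y: "y \<in> F" for y
    proof -
      obtain x where x: "x \<in> A" "\<forall>f\<in>\<Phi>. \<bar>f (y - x)\<bar> < \<delta> \<and> (\<forall>s. \<bar>f (act s y - act s x)\<bar> < \<delta>)"
        using A(3)[OF y] by blast
      then have "x \<in> F" using A(2) by blast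
      have "\<bar>H i y - H i x\<bar> \<le> \<epsilon>" for i
        by (rule H_close[OF _ _ _ _ \<delta>(2)]) (use act_X[OF y] act_X[OF \<open>x \<in> F\<close>] x(2) in auto)
      then show ?thesis using x(1) by blast
    qed
    then show ?thesis using A(1,2) by blast
  qed
  have net: "\<exists>N. finite N \<and> (\<forall>i. \<exists>j\<in>N. \<forall>x\<in>F. \<bar>H i x - H j x\<bar> \<le> \<epsilon>)" if "\<epsilon> > 0" for \<epsilon>
    by (rule finite_index_net[of F H, OF H01 pre that]) blast+
  have "\<exists>N. finite N \<and> (\<forall>i. \<exists>j\<in>N. \<forall>x\<in>F. \<bar>H i x - H j x\<bar> \<le> 1 / Suc n)" for n :: nat
    by (rule net) simp
  then obtain N where N: "\<And>n. finite (N n)" "\<And>n i. \<exists>j\<in>N n. \<forall>x\<in>F. \<bar>H i x - H j x\<bar> \<le> 1 / Suc n"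
    by metis
  \<comment> \<open>An enumeration of indices whose functions are uniformly dense among all
    translates.\<close>
  define \<nu> where "\<nu> = from_nat_into (\<Union>n. N n)"
  have "(\<Union>n. N n) \<noteq> {}" using N(2)[of 0 None] by blast
  then have range_\<nu>: "range \<nu> = (\<Union>n. N n)"
    unfolding \<nu>_def by (intro range_from_nat_into countable_UN) (auto intro: countable_finite N(1))
  obtain T :: "(nat \<Rightarrow> real) \<Rightarrow> 'v" where T:
    "\<forall>a b. Bseq a \<longrightarrow> Bseq b \<longrightarrow> T (\<lambda>n. a n + b n) = T a + T b"
    "\<forall>a c. Bseq a \<longrightarrow> T (\<lambda>n. c * a n) = c *\<^sub>R T a"
    "\<forall>a n. Bseq a \<longrightarrow> T a = 0 \<longrightarrow> a n = 0"
    by (rule embed_bounded_sequences[OF inf]) (assumption+, blast)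
  note T = T[rule_format]
  \<comment> \<open>Bounded functions that are Lipschitz for the uniform distance of the indexed
    functions. The Lipschitz condition makes a function vanish once it vanishes along \<nu>, which
    gives injectivity; means satisfy it with constant 1.\<close>
  define L where "L = {a. (\<exists>B. \<forall>i. \<bar>a i\<bar> \<le> B) \<and>
      (\<exists>C. \<forall>i j \<epsilon>. (\<forall>x\<in>F. \<bar>H i x - H j x\<bar> \<le> \<epsilon>) \<longrightarrow> \<bar>a i - a j\<bar> \<le> C * \<epsilon>)}"
  have LB: "Bseq (\<lambda>n. a (\<nu> n))" if a: "a \<in> L" for a
  proof -
    obtain B where "\<forall>i. \<bar>a i\<bar> \<le> B" using a unfolding L_def by blast
    then show ?thesis by (intro BseqI'[of _ B]) simp
  qed
  let ?P = "mean_functions F H"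
  obtain a where a: "a \<in> ?P" "\<And>s i. a (idx s i) = a i"
  proof (rule property_D_functions[OF D, of L "\<lambda>a. T (\<lambda>n. a (\<nu> n))" ?P idx])
    show "(\<lambda>i. 0) \<in> L" unfolding L_def by (auto intro!: exI[of _ 0])
    show "(\<lambda>i. a i + b i) \<in> L" if ab: "a \<in> L" "b \<in> L" for a b
    proof -
      obtain B1 C1 B2 C2 where *: "\<And>i. \<bar>a i\<bar> \<le> B1" "\<And>i. \<bar>b i\<bar> \<le> B2"
        "\<And>i j \<epsilon>. (\<forall>x\<in>F. \<bar>H i x - H j x\<bar> \<le> \<epsilon>) \<Longrightarrow> \<bar>a i - a j\<bar> \<le> C1 * \<epsilon>"
        "\<And>i j \<epsilon>. (\<forall>x\<in>F. \<bar>H i x - H j x\<bar> \<le> \<epsilon>) \<Longrightarrow> \<bar>b i - b j\<bar> \<le> C2 * \<epsilon>"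
        using ab unfolding L_def by blast
      have "\<bar>a i + b i\<bar> \<le> B1 + B2" for i using *(1,2)[of i] by linarith
      moreover have "\<bar>(a i + b i) - (a j + b j)\<bar> \<le> (C1 + C2) * \<epsilon>" if "\<forall>x\<in>F. \<bar>H i x - H j x\<bar> \<le> \<epsilon>" for i j \<epsilon>
        using *(3,4)[OF that] by (simp add: distrib_right)
      ultimately show ?thesis unfolding L_def by blast
    qed
    show "(\<lambda>i. c * a i) \<in> L" if a: "a \<in> L" for a c
    proof -
      obtain B C where *: "\<And>i. \<bar>a i\<bar> \<le> B"
        "\<And>i j \<epsilon>. (\<forall>x\<in>F. \<bar>H i x - H j x\<bar> \<le> \<epsilon>) \<Longrightarrow> \<bar>a i - a j\<bar> \<le> C * \<epsilon>"
        using a unfolding L_def by blast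
      have "\<bar>c * a i\<bar> \<le> \<bar>c\<bar> * B" for i using *(1)[of i] by (simp add: abs_mult mult_left_mono)
      moreover have "\<bar>c * a i - c * a j\<bar> \<le> (\<bar>c\<bar> * C) * \<epsilon>" if "\<forall>x\<in>F. \<bar>H i x - H j x\<bar> \<le> \<epsilon>" for i j \<epsilon>
        using mult_left_mono[OF *(2)[OF that], of "\<bar>c\<bar>"]
        by (simp add: mult.assoc flip: abs_mult right_diff_distrib)
      ultimately show ?thesis unfolding L_def by blast
    qed
    show "\<exists>B. \<forall>i. \<bar>a i\<bar> \<le> B" if "a \<in> L" for a using that unfolding L_def by blast
    show "T (\<lambda>n. a (\<nu> n) + b (\<nu> n)) = T (\<lambda>n. a (\<nu> n)) + T (\<lambda>n. b (\<nu> n))" if "a \<in> L" "b \<in> L" for a b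
      by (rule T(1)[OF LB[OF that(1)] LB[OF that(2)]])
    show "T (\<lambda>n. c * a (\<nu> n)) = c *\<^sub>R T (\<lambda>n. a (\<nu> n))" if "a \<in> L" for a c
      by (rule T(2)[OF LB[OF that]])
    show "a i = 0" if a: "a \<in> L" "T (\<lambda>n. a (\<nu> n)) = 0" for a i
    proof (rule ccontr)
      assume nz: "a i \<noteq> 0"
      obtain C where C: "\<And>i j \<epsilon>. (\<forall>x\<in>F. \<bar>H i x - H j x\<bar> \<le> \<epsilon>) \<Longrightarrow> \<bar>a i - a j\<bar> \<le> C * \<epsilon>"
        using a unfolding L_def by blast
      have "\<bar>a i\<bar> / (\<bar>C\<bar> + 1) > 0" using nz by simp
      then obtain n where n: "1 / Suc n < \<bar>a i\<bar> / (\<bar>C\<bar> + 1)"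
        using nat_approx_posE by blast
      obtain j where j: "j \<in> N n" "\<forall>x\<in>F. \<bar>H i x - H j x\<bar> \<le> 1 / Suc n" using N(2) by blast
      obtain m where "j = \<nu> m" using range_\<nu> j(1) by blast
      then have "a j = 0" using T(3)[OF LB[OF a(1)] a(2), of m] by simp
      then have "\<bar>a i\<bar> \<le> C * (1 / Suc n)" using C[OF j(2)] by simp
      also have "\<dots> \<le> (\<bar>C\<bar> + 1) * (1 / Suc n)" by (intro mult_right_mono) auto
      also have "\<dots> < \<bar>a i\<bar>" using n by (simp add: field_simps)
      finally show False by simp
    qed
    show "?P \<subseteq> L"
    proof
      fix a assume a: "a \<in> ?P"
      have "0 \<le> a i" "a i \<le> 1" for i using mean_ge[OF a, of 0 i] mean_le[OF a, of i 1] H01 by auto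
      then have "\<forall>i. \<bar>a i\<bar> \<le> 1" by simp
      moreover have "\<forall>i j \<epsilon>. (\<forall>x\<in>F. \<bar>H i x - H j x\<bar> \<le> \<epsilon>) \<longrightarrow> \<bar>a i - a j\<bar> \<le> 1 * \<epsilon>"
        using mean_dist[OF a] by simp
      ultimately show "a \<in> L" unfolding L_def by blast
    qed
    show "?P \<noteq> {}" using mean_functions_point[OF x0(1)] by blast
    show "compact ?P" by (rule compact_mean_functions) (rule H01)
    show "(\<lambda>i. u * a i + v * b i) \<in> ?P" if "a \<in> ?P" "b \<in> ?P" "0 \<le> u" "0 \<le> v" "u + v = 1" for a b u v
      by (rule mean_functions_convex[OF that])
    \<comment> \<open>Means do not increase uniform distances, so two means that are close on a
      finite net of indices are close at every index.\<close>
    show "\<exists>N d. finite N \<and> d > 0 \<and> (\<forall>a\<in>?P. \<forall>b\<in>?P. (\<forall>i\<in>N. \<bar>a i - b i\<bar> < d) \<longrightarrow> (\<forall>i. \<bar>a i - b i\<bar> \<le> \<epsilon>))"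
      if \<epsilon>: "\<epsilon> > 0" for \<epsilon>
    proof -
      have "\<epsilon> / 3 > 0" using \<epsilon> by simp
      then obtain M where M: "finite M" "\<And>i. \<exists>j\<in>M. \<forall>x\<in>F. \<bar>H i x - H j x\<bar> \<le> \<epsilon> / 3" using net by blast
      have "\<bar>a i - b i\<bar> \<le> \<epsilon>" if ab: "a \<in> ?P" "b \<in> ?P" "\<forall>i\<in>M. \<bar>a i - b i\<bar> < \<epsilon> / 3" for a b i
      proof -
        obtain j where j: "j \<in> M" "\<forall>x\<in>F. \<bar>H i x - H j x\<bar> \<le> \<epsilon> / 3" using M(2) by blast
        have "\<bar>a i - a j\<bar> \<le> \<epsilon> / 3" "\<bar>b i - b j\<bar> \<le> \<epsilon> / 3"
          using j(2) by (intro mean_dist[OF ab(1)] mean_dist[OF ab(2)]; simp)+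
        moreover have "\<bar>a j - b j\<bar> < \<epsilon> / 3" using ab(3) j(1) by blast
        ultimately show ?thesis by linarith
      qed
      then show ?thesis using M(1) \<open>\<epsilon> / 3 > 0\<close> by blast
    qed
    show "idx (s * t) i = idx t (idx s i)" for s t i
      unfolding idx_def by (auto simp: mult.assoc split: option.split)
    show "(\<lambda>i. a (idx s i)) \<in> ?P" if "a \<in> ?P" for a s
      using that by (rule mean_functions_shift[where g = "act s"]) (use act_F H_idx in auto)
    \<comment> \<open>A finite net \<open>A\<close> of \<open>F\<close> reduces the claim to
      finitely many orbits. Continuity of the orbit of \<open>x\<close> brings
      \<open>act s' x\<close> near \<open>act s x\<close>, and equicontinuity at
      \<open>act s x\<close> then controls all further translates.\<close>
    show "\<exists>W. open W \<and> s \<in> W \<and> (\<forall>s'\<in>W. \<forall>i. \<bar>a (idx s' i) - a (idx s i)\<bar> \<le> \<epsilon>)" if a: "a \<in> ?P" and \<epsilon>: "\<epsilon> > 0" for a s \<epsilon>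
    proof -
      have \<epsilon>3: "\<epsilon> / 3 > 0" using \<epsilon> by simp
      obtain \<delta> where \<delta>: "\<delta> > 0" "\<And>x y. x \<in> X \<Longrightarrow> y \<in> X \<Longrightarrow> (\<And>f. f \<in> \<Phi> \<Longrightarrow> \<bar>f (x - y)\<bar> < \<delta>) \<Longrightarrow> \<bar>h x - h y\<bar> \<le> \<epsilon> / 3"
        using h_unif[OF \<epsilon>3] by blast
      obtain A where A: "finite A" "A \<subseteq> F" "\<And>y. y \<in> F \<Longrightarrow> \<exists>x\<in>A. \<forall>i. \<bar>H i y - H i x\<bar> \<le> \<epsilon> / 3"
        using pre[OF \<epsilon>3] by blast
      have "\<exists>W. open W \<and> s \<in> W \<and> (\<forall>s'\<in>W. \<forall>i. \<bar>H i (act s' x) - H i (act s x)\<bar> \<le> \<epsilon> / 3)" if x: "x \<in> F" for x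
      proof -
        have xK: "x \<in> K" using x FK by blast
        obtain V where V: "openin weak V" "act s x \<in> V"
          "\<And>r y f. y \<in> V \<inter> K \<Longrightarrow> f \<in> \<Phi> \<Longrightarrow> \<bar>f (act r y - act r (act s x))\<bar> < \<delta>"
          using equicontinuous_at[OF act_in[OF xK] \<Phi> \<delta>(1)] by blast
        define U where "U = V \<inter> {y \<in> X. \<forall>f\<in>\<Phi>. \<bar>f (y - act s x)\<bar> < \<delta>}"
        have "openin weak U"
          unfolding U_def using V(1) act_X[OF x] \<Phi> by (intro openin_Int openin_weak_ball) auto
        then have "openin (subtopology weak K) (U \<inter> K)" by (rule openin_subtopology_Int)
        from openin_continuous_map_preimage[OF continuous_orbit[OF xK] this]
        have "open {r. act r x \<in> U \<inter> K}" by simp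
        moreover have "s \<in> {r. act r x \<in> U \<inter> K}"
          using V(2) act_in[OF xK] act_X[OF x] \<Phi>(2) \<delta>(1) by (auto simp: U_def dual_zero subset_iff)
        moreover have "\<bar>H i (act r x) - H i (act s x)\<bar> \<le> \<epsilon> / 3" if r: "r \<in> {r. act r x \<in> U \<inter> K}" for r i
          by (rule H_close[OF _ _ _ _ \<delta>(2)])
            (use act_X[OF x] act_X[OF act_F[OF x]] r V(3) in \<open>auto simp: U_def\<close>)
        ultimately show ?thesis by blast
      qed
      then obtain W where W: "\<And>x. x \<in> F \<Longrightarrow> open (W x) \<and> s \<in> W x \<and>
          (\<forall>s'\<in>W x. \<forall>i. \<bar>H i (act s' x) - H i (act s x)\<bar> \<le> \<epsilon> / 3)" by metis
      have "\<bar>a (idx s' i) - a (idx s i)\<bar> \<le> \<epsilon>" if s': "s' \<in> (\<Inter>x\<in>A. W x)" for s' i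
      proof (rule mean_dist[OF a])
        fix y assume y: "y \<in> F"
        obtain x where x: "x \<in> A" "\<And>i. \<bar>H i y - H i x\<bar> \<le> \<epsilon> / 3" using A(3)[OF y] by blast
        have "\<bar>H (idx s' i) x - H (idx s i) x\<bar> \<le> \<epsilon> / 3"
          using W[of x] s' x(1) A(2) by (auto simp: H_idx subset_iff)
        with x(2)[of "idx s' i"] x(2)[of "idx s i"]
        show "\<bar>H (idx s' i) y - H (idx s i) y\<bar> \<le> \<epsilon>" by linarith
      qed
      moreover have "open (\<Inter>x\<in>A. W x)" using A W by (intro open_INT) auto
      moreover have "s \<in> (\<Inter>x\<in>A. W x)" using A W by auto
      ultimately show ?thesis by blast
    qed
  qed blast
  \<comment> \<open>The translate of \<open>h\<close> by \<open>t\<close> vanishes on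
    \<open>F\<close>, and invariance carries this zero back to \<open>h\<close>.\<close>
  have a_None: "a None \<le> 0"
  proof -
    have "H (idx t None) x \<le> 0" if "x \<in> F" for x
      using h_zero[of "act t x"] that H_idx[OF that, of t None] by (simp add: H_def)
    then have "a (idx t None) \<le> 0" by (rule mean_le[OF a(1)])
    then show ?thesis using a(2) by simp
  qed
  have a_Some: "a (Some s) \<le> 0" for s
    using a(2)[of s None] a_None by (simp add: idx_def)
  obtain \<delta> where \<delta>: "\<delta> > 0" "\<And>x y. x \<in> X \<Longrightarrow> y \<in> X \<Longrightarrow> (\<And>f. f \<in> \<Phi> \<Longrightarrow> \<bar>f (x - y)\<bar> < \<delta>) \<Longrightarrow> \<bar>h x - h y\<bar> \<le> 1 / 2"
    using h_unif[of "1 / 2"] by auto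
  \<comment> \<open>On \<open>V\<close> the function \<open>h\<close> is at least
    \<open>1 / 2\<close>; finitely many translations bring every point of \<open>F\<close> into
    \<open>V\<close>, so finitely many translates of \<open>h\<close> have a sum of at least
    \<open>1 / 2\<close>.\<close>
  define V where "V = {y \<in> X. \<forall>f\<in>\<Phi>. \<bar>f (y - x0)\<bar> < \<delta>}"
  have "openin weak V" unfolding V_def by (rule openin_weak_ball[OF \<Phi> x0X])
  moreover have "x0 \<in> V" unfolding V_def using x0X \<delta>(1) \<Phi>(2) by (auto simp: dual_zero subset_iff)
  ultimately obtain I where I: "finite I" "\<And>x. x \<in> F \<Longrightarrow> \<exists>s\<in>I. act s x \<in> V"
    using minimal_translates_cover[OF F, of V] x0(1) by blast
  have hV: "1 / 2 \<le> h y" if "y \<in> V" for y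
  proof -
    have "\<bar>h y - h x0\<bar> \<le> 1 / 2" using that x0X unfolding V_def by (intro \<delta>(2)) auto
    then show ?thesis using hx0 by linarith
  qed
  have "1 / 2 \<le> (\<Sum>i\<in>Some ` I. a i)"
  proof (rule mean_sum_ge[OF a(1)])
    show "finite (Some ` I)" using I(1) by simp
    fix x assume "x \<in> F"
    then obtain s where s: "s \<in> I" "act s x \<in> V" using I(2) by blast
    then have "1 / 2 \<le> H (Some s) x" using hV by (simp add: H_def)
    also have "\<dots> \<le> (\<Sum>i\<in>Some ` I. H i x)" using s(1) I(1) H01 by (intro member_le_sum) auto
    finally show "1 / 2 \<le> (\<Sum>i\<in>Some ` I. H i x)" .
  qed
  moreover have "(\<Sum>i\<in>Some ` I. a i) \<le> 0" using a_Some by (intro sum_nonpos) auto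
  ultimately show False by simp
qed

end

subsection \<open>Comparison of \<open>\<tau>\<close> with the weak topology\<close>

context lcs begin

text \<open>The hypotheses make \<open>Y\<close> finite-dimensional. Induction splits off one
  functional at a time: if \<open>f v = 1\<close>, then \<open>y - f y *\<^sub>R v\<close> lies in
  the kernel of \<open>f\<close>, where the remaining functionals separate points.\<close>

lemma finite_functionals_bound:
  assumes "finite \<Phi>" "\<Phi> \<subseteq> dual" "subspace Y" "Y \<subseteq> X"
    and "\<And>y. y \<in> Y \<Longrightarrow> (\<And>f. f \<in> \<Phi> \<Longrightarrow> f y = 0) \<Longrightarrow> y = 0" and p: "seminorm_on X p"
  shows "\<exists>C\<ge>0. \<forall>y\<in>Y. p y \<le> C * (\<Sum>f\<in>\<Phi>. \<bar>f y\<bar>)"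
  using assms(1-5)
proof (induction \<Phi> arbitrary: Y rule: finite_induct)
  case empty
  then have "Y \<subseteq> {0}" by blast
  then show ?case using seminorm_on_zero[OF p subspace_X] by (intro exI[of _ 0]) force
next
  case (insert f \<Phi>)
  have f: "f \<in> dual" and \<Phi>: "\<Phi> \<subseteq> dual" using insert.prems(1) by auto
  have YX: "y \<in> X" if "y \<in> Y" for y using that insert.prems(3) by blast
  define Z where "Z = {y \<in> Y. f y = 0}"
  have "subspace Z"
    unfolding subspace_def Z_def
    using insert.prems(2) YX f by (auto simp: subspace_0 subspace_add subspace_scale dual_zero dual_add dual_scale)
  then obtain C where C: "C \<ge> 0" "\<And>y. y \<in> Z \<Longrightarrow> p y \<le> C * (\<Sum>f\<in>\<Phi>. \<bar>f y\<bar>)"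
    using insert.IH[OF \<Phi> _ _ , of Z] insert.prems(3,4) unfolding Z_def by blast
  show ?case
  proof (cases "\<forall>y\<in>Y. f y = 0")
    case True
    then have "Z = Y" unfolding Z_def by blast
    have "p y \<le> C * (\<Sum>f\<in>insert f \<Phi>. \<bar>f y\<bar>)" if "y \<in> Y" for y
    proof -
      have "p y \<le> C * (\<Sum>f\<in>\<Phi>. \<bar>f y\<bar>)" using C(2) that \<open>Z = Y\<close> by blast
      also have "\<dots> \<le> C * (\<Sum>f\<in>insert f \<Phi>. \<bar>f y\<bar>)"
        using C(1) insert.hyps by (intro mult_left_mono) auto
      finally show ?thesis .
    qed
    then show ?thesis using C(1) by blast
  next
    case False
    then obtain w where w: "w \<in> Y" "f w \<noteq> 0" by blast
    define v where "v = (1 / f w) *\<^sub>R w"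
    have vY: "v \<in> Y" unfolding v_def using w(1) insert.prems(2) by (intro subspace_scale)
    have fv: "f v = 1" unfolding v_def using w f YX by (simp add: dual_scale)
    define S where "S = (\<Sum>g\<in>\<Phi>. \<bar>g v\<bar>)"
    have S: "S \<ge> 0" unfolding S_def by (intro sum_nonneg) auto
    have pv: "p v \<ge> 0" using seminorm_onD(1)[OF p YX[OF vY]] .
    \<comment> \<open>The constant adds the bound on the kernel, the cost of projecting into the
      kernel along \<open>v\<close>, and the size of \<open>v\<close>.\<close>
    have "p y \<le> (C + C * S + p v) * (\<Sum>f\<in>insert f \<Phi>. \<bar>f y\<bar>)" if y: "y \<in> Y" for y
    proof -
      define z where "z = y - f y *\<^sub>R v"
      have "z \<in> Z" unfolding Z_def z_def using y vY insert.prems(2) f fv YX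
        by (auto intro: subspace_diff subspace_scale simp: dual_diff dual_scale)
      define A where "A = (\<Sum>g\<in>\<Phi>. \<bar>g y\<bar>)"
      have A: "A \<ge> 0" unfolding A_def by (intro sum_nonneg) auto
      have "(\<Sum>g\<in>\<Phi>. \<bar>g z\<bar>) \<le> (\<Sum>g\<in>\<Phi>. \<bar>g y\<bar> + \<bar>f y\<bar> * \<bar>g v\<bar>)"
      proof (rule sum_mono)
        fix g assume "g \<in> \<Phi>"
        then have "g z = g y - f y * g v"
          unfolding z_def using \<Phi> YX[OF y] YX[OF vY] by (simp add: dual_diff dual_scale subset_iff)
        then show "\<bar>g z\<bar> \<le> \<bar>g y\<bar> + \<bar>f y\<bar> * \<bar>g v\<bar>"
          using abs_triangle_ineq4[of "g y" "f y * g v"] by (simp add: abs_mult)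
      qed
      also have "\<dots> = A + \<bar>f y\<bar> * S" unfolding A_def S_def by (simp add: sum.distrib sum_distrib_left)
      finally have "p z \<le> C * (A + \<bar>f y\<bar> * S)"
        using C(2)[OF \<open>z \<in> Z\<close>] mult_left_mono[OF _ C(1)] by (meson order_trans)
      moreover have "p y \<le> p z + \<bar>f y\<bar> * p v"
        using seminorm_onD(2)[OF p, of z "f y *\<^sub>R v"] seminorm_onD(3)[OF p YX[OF vY], of "f y"]
          YX[OF y] YX[OF vY] unfolding z_def by simp
      moreover have "C * (A + \<bar>f y\<bar> * S) + \<bar>f y\<bar> * p v \<le> (C + C * S + p v) * (\<bar>f y\<bar> + A)"
        using A C(1) S pv by (simp add: algebra_simps)
      ultimately have "p y \<le> (C + C * S + p v) * (\<bar>f y\<bar> + A)" by linarith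
      also have "\<bar>f y\<bar> + A = (\<Sum>f\<in>insert f \<Phi>. \<bar>f y\<bar>)" unfolding A_def using insert.hyps by simp
      finally show ?thesis .
    qed
    moreover have "C + C * S + p v \<ge> 0" using C(1) S pv by simp
    ultimately show ?thesis by blast
  qed
qed

lemma openin_seminorm_ball:
  assumes "finite P" "P \<subseteq> Q" "x \<in> X"
  shows "openin \<tau> (seminorm_ball X P x e)"
  unfolding openin_tau
proof (intro conjI ballI)
  show "seminorm_ball X P x e \<subseteq> X" unfolding seminorm_ball_def by blast
  fix y assume "y \<in> seminorm_ball X P x e"
  then have y: "y \<in> X" "\<And>p. p \<in> P \<Longrightarrow> p (y - x) < e" unfolding seminorm_ball_def by auto
  define d where "d = Min (insert 1 ((\<lambda>p. e - p (y - x)) ` P))"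
  have "d > 0" unfolding d_def using assms(1) y(2) by auto
  moreover have "seminorm_ball X P y d \<subseteq> seminorm_ball X P x e"
    unfolding seminorm_ball_def
  proof clarify
    fix z p assume z: "z \<in> X" "\<forall>p\<in>P. p (z - y) < d" and p: "p \<in> P"
    have "d \<le> e - p (y - x)" unfolding d_def using assms(1) p by auto
    moreover have "p (z - x) \<le> p (z - y) + p (y - x)"
      using p assms(2,3) z(1) y(1) by (intro p_triangle) auto
    ultimately show "p (z - x) < e" using z(2) p by fastforce
  qed
  ultimately show "\<exists>P' d. finite P' \<and> P' \<subseteq> Q \<and> 0 < d \<and> seminorm_ball X P' y d \<subseteq> seminorm_ball X P x e"
    using assms(1,2) by blast
qed

lemma subtopology_eqI:
  assumes "\<And>U. openin \<tau> U \<Longrightarrow> openin (subtopology weak K) (U \<inter> K)"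
  shows "subtopology \<tau> K = subtopology weak K"
  unfolding topology_eq
proof (intro allI iffI)
  fix W assume "openin (subtopology \<tau> K) W"
  then show "openin (subtopology weak K) W" using assms unfolding openin_subtopology[of \<tau>] by auto
next
  fix W assume "openin (subtopology weak K) W"
  then show "openin (subtopology \<tau> K) W" using openin_weak_imp_tau unfolding openin_subtopology by blast
qed

text \<open>The identity from a compact to a Hausdorff topology is closed: \<open>K - U\<close> is
  \<tau>-compact, thus weakly compact, thus weakly closed.\<close>

lemma subtopology_eq_compact:
  assumes K: "compactin \<tau> K"
  shows "subtopology \<tau> K = subtopology weak K"
proof (rule subtopology_eqI)
  fix U assume U: "openin \<tau> U"
  have KX: "K \<subseteq> X" using compactin_subset_topspace[OF K] by simp
  have "continuous_map \<tau> weak id"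
    unfolding continuous_map_def using openin_weak_imp_tau openin_subset[of weak]
    by (auto simp: Collect_conj_eq Int_absorb1 openin_Int)
  moreover have "compactin \<tau> (K - U)"
  proof -
    have "closedin \<tau> (X - U)" using U openin_subset[OF U] by (auto simp: closedin_def Diff_Diff_Int Int_absorb1)
    then have "compactin \<tau> (K \<inter> (X - U))" using K by (rule compact_Int_closedin[rotated])
    moreover have "K \<inter> (X - U) = K - U" using KX by blast
    ultimately show ?thesis by simp
  qed
  ultimately have "compactin weak (K - U)" using image_compactin[of \<tau> "K - U" weak id] by simp
  then have "closedin weak (K - U)" using compactin_imp_closedin[OF Hausdorff_weak] by blast
  then have "openin weak (X - (K - U))" unfolding closedin_def by simp
  then have "openin (subtopology weak K) ((X - (K - U)) \<inter> K)" by (rule openin_subtopology_Int)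
  moreover have "(X - (K - U)) \<inter> K = U \<inter> K" using KX by blast
  ultimately show "openin (subtopology weak K) (U \<inter> K)" by simp
qed

lemma compact_precompact:
  assumes K: "compactin \<tau> K" and p: "p \<in> Q"
  shows "seminorm_precompact p K"
  unfolding seminorm_precompact_def
proof (intro allI impI)
  fix e :: real assume e: "e > 0"
  have KX: "K \<subseteq> X" using compactin_subset_topspace[OF K] by simp
  let ?B = "\<lambda>x. seminorm_ball X {p} x (e / 2)"
  have "\<exists>\<F>. finite \<F> \<and> \<F> \<subseteq> ?B ` K \<and> K \<subseteq> \<Union>\<F>"
  proof (rule compactinD[OF K])
    show "openin \<tau> U" if "U \<in> ?B ` K" for U
      using that KX p by (auto intro!: openin_seminorm_ball)
    show "K \<subseteq> \<Union>(?B ` K)"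
      using KX e seminorm_on_zero[OF seminorm[OF p] subspace_X] by (force simp: seminorm_ball_def)
  qed
  then obtain \<F> where \<F>: "finite \<F>" "\<F> \<subseteq> ?B ` K" "K \<subseteq> \<Union>\<F>" by blast
  have "p (x - y) \<le> e" if V: "V \<in> \<F>" and xy: "x \<in> V" "y \<in> V" for V x y
  proof -
    obtain a where a: "a \<in> K" "V = ?B a" using \<F>(2) V by blast
    then have X: "x \<in> X" "y \<in> X" "a \<in> X" using xy KX by (auto simp: seminorm_ball_def)
    have "p (x - a) < e / 2" "p (y - a) < e / 2" using xy a by (auto simp: seminorm_ball_def)
    then show ?thesis using p_triangle[OF p X(1) X(3) X(2)] p_commute[OF p X(3) X(2)] by simp
  qed
  then show "\<exists>\<V>. finite \<V> \<and> K \<subseteq> \<Union>\<V> \<and> (\<forall>V\<in>\<V>. \<forall>x\<in>V \<inter> K. \<forall>y\<in>V \<inter> K. p (x - y) \<le> e)"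
    using \<F>(1,3) by (intro exI[of _ \<F>]) auto
qed

text \<open>A subset of a \<tau>-compact set is precompact for every \<open>p\<close>, so the
  averaged net of \<open>A\<close> is a centre with radius below the diameter. It suffices to choose
  \<open>p\<close> positive on some difference of points of \<open>A\<close>.\<close>

lemma compact_normal_structure:
  assumes K: "compactin \<tau> K"
  shows "normal_structure \<tau> Q K"
  unfolding normal_structure_def
proof (intro allI impI, elim conjE)
  fix A assume AK: "A \<subseteq> K" and bounded: "seminorm_bounded Q A" and two: "\<exists>x\<in>A. \<exists>y\<in>A. x \<noteq> y"
  have KX: "K \<subseteq> X" using compactin_subset_topspace[OF K] by simp
  then have AX: "A \<subseteq> X" using AK by blast
  obtain x y where xy: "x \<in> A" "y \<in> A" "x \<noteq> y" using two by blast
  then obtain p where p: "p \<in> Q" "p (x - y) > 0" using seminorm_separates[of "x - y"] AX by auto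
  note pX = seminorm[OF p(1)]
  obtain d where d: "\<And>x. x \<in> A \<Longrightarrow> p x \<le> d" using bounded p(1) unfolding seminorm_bounded_def by blast
  define D where "D = {p (x - y) | x y. x \<in> A \<and> y \<in> A}"
  have "p (a - b) \<le> d + d" if "a \<in> A" "b \<in> A" for a b
  proof -
    have "p (a - b) \<le> p (a - 0) + p (0 - b)" using that AX by (intro p_triangle[OF p(1)]) auto
    then show ?thesis using d[OF that(1)] d[OF that(2)] seminorm_on_minus[OF pX, of b] that AX by auto
  qed
  then have bdd: "bdd_above D" unfolding D_def bdd_above_def by auto
  have le: "p (a - b) \<le> Sup D" if "a \<in> A" "b \<in> A" for a b
    by (rule cSup_upper[OF _ bdd]) (use that in \<open>auto simp: D_def\<close>)
  have "Sup D > 0" using le[OF xy(1,2)] p(2) by simp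
  moreover have "seminorm_precompact p A" using seminorm_precompact_subset[OF compact_precompact[OF K p(1)] AK] .
  ultimately obtain u r where u: "u \<in> convex hull A" "r < Sup D" "\<And>x. x \<in> A \<Longrightarrow> p (x - u) \<le> r"
    using precompact_center[OF subspace_X pX AX _ _ _ le] xy(1) by blast
  have "convex X" using subspace_X by (rule subspace_imp_convex)
  then have "convex hull K \<subseteq> \<tau> closure_of (convex hull K)"
    using hull_minimal[of K X convex] KX by (intro closure_of_subset) auto
  then have "u \<in> \<tau> closure_of (convex hull K)" using u(1) hull_mono[OF AK, of convex] by blast
  moreover have "Sup {p (x - u) | x. x \<in> A} \<le> r" using u(3) xy(1) by (intro cSup_least) auto
  ultimately show "\<exists>u\<in>\<tau> closure_of (convex hull K). \<exists>p\<in>Q.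
      Sup {p (x - u) | x. x \<in> A} < Sup {p (x - y) | x y. x \<in> A \<and> y \<in> A}"
    using p(1) u(2) unfolding D_def by force
qed

text \<open>A neighbourhood given by finitely many members of \<open>Q\<close> serves all
  translations at once. It is weakly relatively open in \<open>K\<close> only because the two
  topologies agree there.\<close>

lemma nonexpansive_equicontinuous:
  assumes K: "K \<subseteq> X" and act: "\<And>s x. x \<in> K \<Longrightarrow> act s x \<in> K" "nonexpansive Q K act"
    and eq: "subtopology \<tau> K = subtopology weak K"
  shows "equicontinuous_translations weak K act"
  unfolding equicontinuous_translations_def
proof (intro ballI allI impI)
  fix x U assume x: "x \<in> K" and U: "openin weak U \<and> 0 \<in> U"
  then have "openin \<tau> U" using openin_weak_imp_tau by blast
  then obtain P e where P: "finite P" "P \<subseteq> Q" "0 < e" "seminorm_ball X P 0 e \<subseteq> U"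
    using U unfolding openin_tau by meson
  let ?V = "seminorm_ball X P x e \<inter> K"
  have "openin (subtopology \<tau> K) ?V"
    using openin_seminorm_ball[OF P(1,2)] x K by (intro openin_subtopology_Int) auto
  then have "openin (subtopology weak K) ?V" unfolding eq .
  moreover have "x \<in> ?V"
    using x K P(2,3) seminorm_on_zero[OF seminorm subspace_X] by (force simp: seminorm_ball_def)
  moreover have "act s y - act s x \<in> U" if "y \<in> ?V" for s y
  proof -
    have "p (act s y - act s x) < e" if p: "p \<in> P" for p
    proof -
      have "p (act s y - act s x) \<le> p (y - x)"
        using act(2) p P(2) \<open>y \<in> ?V\<close> x unfolding nonexpansive_def by blast
      then show ?thesis using \<open>y \<in> ?V\<close> p unfolding seminorm_ball_def by fastforce
    qed
    moreover have "act s y - act s x \<in> X" using that x act(1) K by auto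
    ultimately show ?thesis using P(4) unfolding seminorm_ball_def by auto
  qed
  ultimately show "\<exists>V. openin (subtopology weak K) V \<and> x \<in> V \<and> (\<forall>s. \<forall>y\<in>V. act s y - act s x \<in> U)" by blast
qed

end

context weak_system begin

text \<open>Injectivity of finitely many functionals on \<open>K\<close> makes the span of the
  differences finite-dimensional, and there each \<open>p\<close> is controlled by these
  functionals.\<close>

lemma subtopology_eq_finite:
  assumes \<Phi>: "finite \<Phi>" "\<Phi> \<subseteq> dual" and inj: "\<And>k l. k \<in> K \<Longrightarrow> l \<in> K \<Longrightarrow> (\<And>f. f \<in> \<Phi> \<Longrightarrow> f k = f l) \<Longrightarrow> k = l"
  shows "subtopology \<tau> K = subtopology weak K"
proof (rule subtopology_eqI)
  \<comment> \<open>This cone is already the span of the differences: it is closed under sums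
    because \<open>K\<close> is convex, and under negation by exchanging \<open>k\<close> and
    \<open>l\<close>. In this form injectivity on \<open>K\<close> gives separation on
    \<open>Y\<close> directly.\<close>
  define Y where "Y = {c *\<^sub>R (k - l) | c k l. c \<ge> 0 \<and> k \<in> K \<and> l \<in> K}"
  obtain k0 where k0: "k0 \<in> K" using K_ne by blast
  have YI: "c *\<^sub>R (k - l) \<in> Y" if "c \<ge> 0" "k \<in> K" "l \<in> K" for c k l using that unfolding Y_def by blast
  have YX: "Y \<subseteq> X" unfolding Y_def using K_X by auto
  have "subspace Y"
    unfolding subspace_def
  proof (intro conjI ballI allI)
    show "0 \<in> Y" using YI[of 0 k0 k0] k0 by simp
    fix x assume "x \<in> Y"
    then obtain c k l where x: "x = c *\<^sub>R (k - l)" "c \<ge> 0" "k \<in> K" "l \<in> K" unfolding Y_def by blast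
    show "a *\<^sub>R x \<in> Y" for a
    proof (cases "a \<ge> 0")
      case True
      then show ?thesis using YI[of "a * c" k l] x by simp
    next
      case False
      then have "(- a * c) *\<^sub>R (l - k) \<in> Y" using x by (intro YI) (auto simp: mult_nonpos_nonneg)
      then show ?thesis unfolding x(1) by (simp add: algebra_simps)
    qed
    fix y assume "y \<in> Y"
    then obtain d m n where y: "y = d *\<^sub>R (m - n)" "d \<ge> 0" "m \<in> K" "n \<in> K" unfolding Y_def by blast
    show "x + y \<in> Y"
    proof (cases "c + d = 0")
      case True
      then have "c = 0" "d = 0" using x(2) y(2) by auto
      then show ?thesis using x y YI[of 0 k0 k0] k0 by simp
    next
      case False
      let ?t = "c / (c + d)" and ?u = "d / (c + d)"
      have tu: "?t \<ge> 0" "?u \<ge> 0" "?t + ?u = 1"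
        using x(2) y(2) False by (auto simp: add_divide_distrib[symmetric])
      have "(c + d) *\<^sub>R ((?t *\<^sub>R k + ?u *\<^sub>R m) - (?t *\<^sub>R l + ?u *\<^sub>R n)) \<in> Y"
        using x y tu by (intro YI convexD[OF convex_K]) auto
      moreover have "(c + d) *\<^sub>R ((?t *\<^sub>R k + ?u *\<^sub>R m) - (?t *\<^sub>R l + ?u *\<^sub>R n)) = x + y"
        unfolding x(1) y(1) scaleR_diff_right scaleR_add_right scaleR_scaleR nonzero_mult_div_cancel_left[OF False]
          times_divide_eq_right
        by simp
      ultimately show ?thesis by simp
    qed
  qed
  have zero: "y = 0" if y: "y \<in> Y" "\<And>f. f \<in> \<Phi> \<Longrightarrow> f y = 0" for y
  proof -
    obtain c k l where ckl: "y = c *\<^sub>R (k - l)" "k \<in> K" "l \<in> K" using y(1) unfolding Y_def by blast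
    show ?thesis
    proof (cases "c = 0")
      case False
      have "f k = f l" if f: "f \<in> \<Phi>" for f
      proof -
        have "f \<in> dual" "k \<in> X" "l \<in> X" using f \<Phi>(2) ckl K_X by auto
        then show ?thesis using y(2)[OF f] False unfolding ckl(1) by (simp add: dual_scale dual_diff)
      qed
      then have "k = l" using inj ckl by blast
      then show ?thesis using ckl by simp
    qed (use ckl in simp)
  qed
  fix U assume U: "openin \<tau> U"
  show "openin (subtopology weak K) (U \<inter> K)"
  proof (subst openin_subopen, intro ballI)
    fix x assume "x \<in> U \<inter> K"
    then have x: "x \<in> U" "x \<in> K" "x \<in> X" using K_X by auto
    then obtain P e where P: "finite P" "P \<subseteq> Q" "0 < e" "seminorm_ball X P x e \<subseteq> U"
      using U unfolding openin_tau by meson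
    have "\<forall>p\<in>P. \<exists>C\<ge>0. \<forall>y\<in>Y. p y \<le> C * (\<Sum>f\<in>\<Phi>. \<bar>f y\<bar>)"
      using finite_functionals_bound[OF \<Phi> \<open>subspace Y\<close> YX zero seminorm] P(2) by blast
    then obtain C where C: "\<And>p. p \<in> P \<Longrightarrow> C p \<ge> 0" "\<And>p y. p \<in> P \<Longrightarrow> y \<in> Y \<Longrightarrow> p y \<le> C p * (\<Sum>f\<in>\<Phi>. \<bar>f y\<bar>)"
      by metis
    \<comment> \<open>One constant for all \<open>p \<in> P\<close>; the added 1 makes
      \<open>B\<close> positive and the final estimate strict.\<close>
    define B where "B = (\<Sum>p\<in>P. C p) * card \<Phi> + 1"
    have B: "B > 0" unfolding B_def using C(1) by (simp add: add_nonneg_pos sum_nonneg)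
    define V where "V = {y \<in> X. \<forall>f\<in>\<Phi>. \<bar>f (y - x)\<bar> < e / B}"
    have "openin weak V" unfolding V_def by (rule openin_weak_ball[OF \<Phi> x(3)])
    then have "openin (subtopology weak K) (V \<inter> K)" by (rule openin_subtopology_Int)
    moreover have "x \<in> V \<inter> K" unfolding V_def using x P(3) B \<Phi>(2) by (auto simp: dual_zero subset_iff)
    moreover have "V \<inter> K \<subseteq> U \<inter> K"
    proof
      fix y assume y: "y \<in> V \<inter> K"
      have yxY: "y - x \<in> Y" using YI[of 1 y x] y x by simp
      have "p (y - x) < e" if p: "p \<in> P" for p
      proof -
        have "p (y - x) \<le> C p * (\<Sum>f\<in>\<Phi>. \<bar>f (y - x)\<bar>)" using C(2)[OF p yxY] .
        also have "\<dots> \<le> C p * (\<Sum>f\<in>\<Phi>. e / B)"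
          using y C(1)[OF p] by (intro mult_left_mono sum_mono) (auto simp: V_def less_imp_le)
        also have "\<dots> = C p * card \<Phi> * (e / B)" by simp
        also have "\<dots> \<le> (\<Sum>p\<in>P. C p) * card \<Phi> * (e / B)"
          using P(1,3) B C(1) p by (intro mult_right_mono member_le_sum) auto
        also have "\<dots> < B * (e / B)"
          using P(3) B by (intro mult_strict_right_mono) (auto simp: B_def)
        also have "\<dots> = e" using B by simp
        finally show ?thesis .
      qed
      then show "y \<in> U \<inter> K" using y P(4) K_X unfolding seminorm_ball_def by auto
    qed
    ultimately show "\<exists>T. openin (subtopology weak K) T \<and> x \<in> T \<and> T \<subseteq> U \<inter> K" by blast
  qed
qed

theorem fixed_point_of_property_D:
  assumes D: "property_D TYPE('s) TYPE('v)"
  shows "has_fixed_point K act"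
proof (cases "\<exists>\<Phi>. finite \<Phi> \<and> \<Phi> \<subseteq> dual \<and> (\<forall>k\<in>K. \<forall>l\<in>K. (\<forall>f\<in>\<Phi>. f k = f l) \<longrightarrow> k = l)")
  case True
  then obtain \<Phi> where \<Phi>: "finite \<Phi>" "\<Phi> \<subseteq> dual" "\<And>k l. k \<in> K \<Longrightarrow> l \<in> K \<Longrightarrow> (\<And>f. f \<in> \<Phi> \<Longrightarrow> f k = f l) \<Longrightarrow> k = l"
    by metis
  have eq: "subtopology \<tau> K = subtopology weak K"
    by (rule subtopology_eq_finite[OF \<Phi>])
  have "compactin (subtopology weak K) K" using compact_K by (simp add: compactin_subtopology)
  then have "compactin \<tau> K" unfolding eq[symmetric] by (simp add: compactin_subtopology)
  moreover have "dynamical_system (subtopology \<tau> K) act" using system unfolding eq .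
  ultimately show ?thesis
    using D[unfolded property_D_def, rule_format, of X \<tau> Q K act] lcs det K_X K_ne convex_K nonexp by simp
next
  case False
  then have inf: "\<exists>k\<in>K. \<exists>l\<in>K. k \<noteq> l \<and> (\<forall>f\<in>\<Phi>. f k = f l)" if "finite \<Phi>" "\<Phi> \<subseteq> dual" for \<Phi>
    using that by metis
  show ?thesis
    by (rule fixed_point_if_surjective, rule minimal_surjective[OF D inf])
qed

end

section \<open>The three implications\<close>

lemma property_D_imp_E:
  assumes D: "property_D TYPE('s::semitopological_semigroup) TYPE('v::real_vector)"
  shows "property_E TYPE('s) TYPE('v)"
  unfolding property_E_def
proof (intro allI impI, elim conjE)
  fix X :: "'v set" and \<tau> Q K and act :: "'s \<Rightarrow> 'v \<Rightarrow> 'v"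
  assume "locally_convex_space X \<tau>" "determined_by_seminorms X \<tau> Q" "K \<subseteq> X" "K \<noteq> {}"
    "compactin (weak_topology X \<tau>) K" "convex K" "dynamical_system (subtopology (weak_topology X \<tau>) K) act"
    "nonexpansive Q K act" "equicontinuous_translations (weak_topology X \<tau>) K act"
  then interpret weak_system X \<tau> Q K act by unfold_locales
  show "has_fixed_point K act" using D by (rule fixed_point_of_property_D)
qed

lemma property_E_imp_E': "property_E S V \<Longrightarrow> property_E' S V"
  unfolding property_E_def property_E'_def by blast

lemma property_E'_imp_D:
  assumes E': "property_E' TYPE('s::semitopological_semigroup) TYPE('v::real_vector)"
  shows "property_D TYPE('s) TYPE('v)"
  unfolding property_D_def
proof (intro allI impI, elim conjE)
  fix X :: "'v set" and \<tau> Q K and act :: "'s \<Rightarrow> 'v \<Rightarrow> 'v"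
  assume lc: "locally_convex_space X \<tau>" "determined_by_seminorms X \<tau> Q"
    and K: "K \<subseteq> X" "K \<noteq> {}" "compactin \<tau> K" "convex K"
    and act: "dynamical_system (subtopology \<tau> K) act" "nonexpansive Q K act"
  interpret lcs X \<tau> Q using lc by unfold_locales
  have eq: "subtopology \<tau> K = subtopology weak K" by (rule subtopology_eq_compact[OF K(3)])
  have "compactin (subtopology \<tau> K) K" using K(3) by (simp add: compactin_subtopology)
  then have "compactin weak K" unfolding eq by (simp add: compactin_subtopology)
  moreover have "dynamical_system (subtopology weak K) act" using act(1) unfolding eq .
  moreover have "act s x \<in> K" if "x \<in> K" for s x
    using act(1) that K(1) unfolding dynamical_system_def by (simp add: Int_absorb1)
  then have "equicontinuous_translations weak K act"
    by (rule nonexpansive_equicontinuous[OF K(1) _ act(2) eq])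
  moreover have "normal_structure \<tau> Q K" by (rule compact_normal_structure[OF K(3)])
  ultimately show "has_fixed_point K act"
    using E'[unfolded property_E'_def, rule_format, of X \<tau> Q K act] lc K act(2) by simp
qed

theorem mainTheorem5:
  shows "(property_D TYPE('s::semitopological_semigroup) TYPE('v::real_vector) \<longleftrightarrow>
            property_E TYPE('s) TYPE('v)) \<and>
         (property_E TYPE('s) TYPE('v) \<longleftrightarrow> property_E' TYPE('s) TYPE('v))"
  using property_D_imp_E property_E_imp_E' property_E'_imp_D by blast

end
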